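(* Let $(M,g_M)$ be a Riemannian manifold of dimension $m>1$ and let $\mathcal{T}_M$ be the total space of its tangent bundle, endowed with the weighted almost-Hermitian structure $(g,J)$ defined by positive smooth weights $\mu,\lambda$ which depend only on $r(u)=\|u\|_M$. Let $f:M\to M$ be an isometry. Then the differential $\mathrm{d}f:TM\to f^*TM$ is a vector bundle isomorphism, which corresponds to a well-defined map $f_\star:\mathcal{T}_M\to\mathcal{T}_M$, $f_\star(u)=\mathrm{d}f_{\pi(u)}(u)$, which is an isometry of $(\mathcal{T}_M,g)$ and is pseudo-holomorphic, i.e. $J_{f_\star(u)}\circ(\mathrm{d}f_\star)_u=(\mathrm{d}f_\star)_u\circ J_u$ for all $u\in\mathcal{T}_M$. In other words, the almost-Hermitian structure $(g,J)$ is invariant under isometries $f$ of $M$.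
   Context: Let $\pi:\mathcal{T}_M\to M$ be the projection and $\nabla$ the Levi-Civita connection of $g_M$. It induces a splitting $T\mathcal{T}_M=H^\nabla\oplus V$ into horizontal and vertical ($V=\ker\mathrm{d}\pi$) sub-bundles, each canonically isomorphic to $\pi^*TM$. For $u\in\mathcal{T}_M$ and $w\in T_{\pi(u)}M$, denote by $w^h\in H^\nabla_u$ and $w^v\in V_u$ the horizontal and vertical lifts. The metric $g$ makes $H^\nabla$ and $V$ orthogonal and satisfies $g(w^h,z^h)=\mu^2g_M(w,z)$, $g(w^v,z^v)=\lambda^2g_M(w,z)$. The almost-complex structure is $J(w^h)=\frac{\mu}{\lambda}w^v$, $J(w^v)=-\frac{\lambda}{\mu}w^h$. *)

theory Defs
  imports "HOL-Analysis.Analysis" "HOL-Library.Function_Algebras"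
begin

section \<open>Smooth maps between normed spaces\<close>

fun Ck_on :: "nat \<Rightarrow> 'e::real_normed_vector set \<Rightarrow> ('e \<Rightarrow> 'f::real_normed_vector) \<Rightarrow> bool" where
  "Ck_on 0 S F \<longleftrightarrow> continuous_on S F"
| "Ck_on (Suc k) S F \<longleftrightarrow>
     (\<forall>x\<in>S. F differentiable (at x)) \<and> (\<forall>v. Ck_on k S (\<lambda>x. frechet_derivative F (at x) v))"

text \<open>Only used for open sets.\<close>

definition smooth_on :: "'e::real_normed_vector set \<Rightarrow> ('e \<Rightarrow> 'f::real_normed_vector) \<Rightarrow> bool" where
  "smooth_on S F \<longleftrightarrow> (\<forall>k. Ck_on k S F)"


section \<open>Smooth manifolds and smooth maps\<close>

text \<open>
  A manifold without boundary, modelled on the Euclidean space \<open>'e\<close> (so of dimension \<open>DIM('e)\<close>),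
  is given by an atlas.  A chart is a pair of its domain and its coordinate map, whose values
  outside the domain are irrelevant.  The underlying set and the topology are those determined by
  the atlas.
\<close>

type_synonym ('a, 'e) chart = "'a set \<times> ('a \<Rightarrow> 'e)"

definition chart_inv :: "('a, 'e) chart \<Rightarrow> 'e \<Rightarrow> 'a" where
  "chart_inv c = inv_into (fst c) (snd c)"

definition points :: "('a, 'e) chart set \<Rightarrow> 'a set" where
  "points A = (\<Union>c\<in>A. fst c)"

definition atlas_topology :: "('a, 'e::euclidean_space) chart set \<Rightarrow> 'a topology" where
  "atlas_topology A = topology (\<lambda>W. W \<subseteq> points A \<and> (\<forall>c\<in>A. open (snd c ` (W \<inter> fst c))))"

definition smooth_manifold :: "('a, 'e::euclidean_space) chart set \<Rightarrow> bool" where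
  "smooth_manifold A \<longleftrightarrow>
     (\<forall>c\<in>A. inj_on (snd c) (fst c) \<and> open (snd c ` fst c)) \<and>
     (\<forall>c\<in>A. \<forall>d\<in>A. open (snd c ` (fst c \<inter> fst d)) \<and>
        smooth_on (snd c ` (fst c \<inter> fst d)) (snd d \<circ> chart_inv c)) \<and>
     Hausdorff_space (atlas_topology A) \<and> second_countable (atlas_topology A)"

definition smooth_map ::
  "('a, 'e::euclidean_space) chart set \<Rightarrow> ('b, 'f::euclidean_space) chart set \<Rightarrow> ('a \<Rightarrow> 'b) \<Rightarrow> bool" where
  "smooth_map A B f \<longleftrightarrow>
     continuous_map (atlas_topology A) (atlas_topology B) f \<and>
     (\<forall>c\<in>A. \<forall>d\<in>B. smooth_on (snd c ` {p \<in> fst c. f p \<in> fst d}) (snd d \<circ> f \<circ> chart_inv c))"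

definition diffeomorphism ::
  "('a, 'e::euclidean_space) chart set \<Rightarrow> ('b, 'f::euclidean_space) chart set \<Rightarrow> ('a \<Rightarrow> 'b) \<Rightarrow> bool" where
  "diffeomorphism A B f \<longleftrightarrow>
     bij_betw f (points A) (points B) \<and> smooth_map A B f \<and>
     smooth_map B A (inv_into (points A) f)"

definition smooth_fun :: "('a, 'e::euclidean_space) chart set \<Rightarrow> ('a \<Rightarrow> real) \<Rightarrow> bool" where
  "smooth_fun A h \<longleftrightarrow> (\<forall>c\<in>A. smooth_on (snd c ` fst c) (h \<circ> chart_inv c))"


section \<open>Tangent vectors and differentials\<close>

text \<open>
  A tangent vector at \<open>p\<close> is a family of coordinate vectors, one for each chart around \<open>p\<close>, which
  transform into each other by the derivatives of the coordinate changes.  The family is \<open>0\<close> at all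
  other charts, which makes the representation unique.  Addition is the pointwise one.
\<close>

type_synonym ('a, 'e) tvec = "('a, 'e) chart \<Rightarrow> 'e"

definition tscale :: "real \<Rightarrow> ('a, 'e::euclidean_space) tvec \<Rightarrow> ('a, 'e) tvec" (infixr "\<cdot>\<^sub>t" 75) where
  "a \<cdot>\<^sub>t v = (\<lambda>c. a *\<^sub>R v c)"

definition charts_at :: "('a, 'e) chart set \<Rightarrow> 'a \<Rightarrow> ('a, 'e) chart set" where
  "charts_at A p = {c \<in> A. p \<in> fst c}"

definition tangent_space :: "('a, 'e::euclidean_space) chart set \<Rightarrow> 'a \<Rightarrow> ('a, 'e) tvec set" where
  "tangent_space A p =
     {v. (\<forall>c\<in>charts_at A p. \<forall>d\<in>charts_at A p.
            v d = frechet_derivative (snd d \<circ> chart_inv c) (at (snd c p)) (v c)) \<and>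
         (\<forall>c. c \<notin> charts_at A p \<longrightarrow> v c = 0)}"

text \<open>The tangent vector at \<open>p\<close> whose coordinate vector in the chart \<open>c\<close> is \<open>x\<close>.\<close>

definition tvec_of ::
  "('a, 'e::euclidean_space) chart set \<Rightarrow> 'a \<Rightarrow> ('a, 'e) chart \<Rightarrow> 'e \<Rightarrow> ('a, 'e) tvec" where
  "tvec_of A p c x =
     (\<lambda>d. if d \<in> charts_at A p then frechet_derivative (snd d \<circ> chart_inv c) (at (snd c p)) x else 0)"

text \<open>By the chain rule the result does not depend on the chart chosen around \<open>p\<close>; likewise below.\<close>

definition differential ::
  "('a, 'e::euclidean_space) chart set \<Rightarrow> ('b, 'f::euclidean_space) chart set \<Rightarrow> ('a \<Rightarrow> 'b) \<Rightarrow> 'a \<Rightarrow>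
   ('a, 'e) tvec \<Rightarrow> ('b, 'f) tvec" where
  "differential A B f p v =
     (let c = (SOME c. c \<in> charts_at A p) in
      (\<lambda>d. if d \<in> charts_at B (f p)
           then frechet_derivative (snd d \<circ> f \<circ> chart_inv c) (at (snd c p)) (v c) else 0))"

definition dir_deriv ::
  "('a, 'e::euclidean_space) chart set \<Rightarrow> ('a \<Rightarrow> real) \<Rightarrow> 'a \<Rightarrow> ('a, 'e) tvec \<Rightarrow> real" where
  "dir_deriv A h p v =
     (let c = (SOME c. c \<in> charts_at A p) in
      frechet_derivative (h \<circ> chart_inv c) (at (snd c p)) (v c))"


section \<open>Vector fields, Riemannian metrics, the Levi-Civita connection\<close>

type_synonym ('a, 'e) vfield = "'a \<Rightarrow> ('a, 'e) tvec"

definition smooth_vfield :: "('a, 'e::euclidean_space) chart set \<Rightarrow> ('a, 'e) vfield \<Rightarrow> bool" where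
  "smooth_vfield A X \<longleftrightarrow>
     (\<forall>p\<in>points A. X p \<in> tangent_space A p) \<and>
     (\<forall>c\<in>A. smooth_on (snd c ` fst c) (\<lambda>x. X (chart_inv c x) c))"

definition riemannian_metric ::
  "('a, 'e::euclidean_space) chart set \<Rightarrow> ('a \<Rightarrow> ('a, 'e) tvec \<Rightarrow> ('a, 'e) tvec \<Rightarrow> real) \<Rightarrow> bool" where
  "riemannian_metric A g \<longleftrightarrow>
     (\<forall>p\<in>points A. \<forall>v\<in>tangent_space A p. \<forall>w\<in>tangent_space A p. \<forall>z\<in>tangent_space A p. \<forall>a.
        g p v w = g p w v \<and>
        g p (v + w) z = g p v z + g p w z \<and>
        g p (a \<cdot>\<^sub>t v) w = a * g p v w \<and>
        (v \<noteq> 0 \<longrightarrow> g p v v > 0)) \<and>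
     (\<forall>c\<in>A. \<forall>x y. smooth_on (snd c ` fst c)
        (\<lambda>z. g (chart_inv c z) (tvec_of A (chart_inv c z) c x) (tvec_of A (chart_inv c z) c y)))"

definition affine_connection ::
  "('a, 'e::euclidean_space) chart set \<Rightarrow>
   (('a, 'e) vfield \<Rightarrow> ('a, 'e) vfield \<Rightarrow> ('a, 'e) vfield) \<Rightarrow> bool" where
  "affine_connection A nabla \<longleftrightarrow>
     (\<forall>X Y. smooth_vfield A X \<and> smooth_vfield A Y \<longrightarrow> smooth_vfield A (nabla X Y)) \<and>
     (\<forall>X Y Z h. smooth_vfield A X \<and> smooth_vfield A Y \<and> smooth_vfield A Z \<and> smooth_fun A h \<longrightarrow>
        (\<forall>p\<in>points A.
           nabla (\<lambda>q. X q + Y q) Z p = nabla X Z p + nabla Y Z p \<and>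
           nabla (\<lambda>q. h q \<cdot>\<^sub>t X q) Z p = h p \<cdot>\<^sub>t nabla X Z p \<and>
           nabla X (\<lambda>q. Y q + Z q) p = nabla X Y p + nabla X Z p \<and>
           nabla X (\<lambda>q. h q \<cdot>\<^sub>t Y q) p = dir_deriv A h p (X p) \<cdot>\<^sub>t Y p + h p \<cdot>\<^sub>t nabla X Y p))"

text \<open>
  Torsion-freeness is \<open>nabla X Y - nabla Y X = [X, Y]\<close>, where the Lie bracket \<open>[X, Y]\<close> is the
  vector field acting on smooth functions by \<open>h \<mapsto> X (Y h) - Y (X h)\<close>.
\<close>

definition torsion_free ::
  "('a, 'e::euclidean_space) chart set \<Rightarrow>
   (('a, 'e) vfield \<Rightarrow> ('a, 'e) vfield \<Rightarrow> ('a, 'e) vfield) \<Rightarrow> bool" where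
  "torsion_free A nabla \<longleftrightarrow>
     (\<forall>X Y h. smooth_vfield A X \<and> smooth_vfield A Y \<and> smooth_fun A h \<longrightarrow>
        (\<forall>p\<in>points A.
           dir_deriv A h p (nabla X Y p - nabla Y X p) =
           dir_deriv A (\<lambda>q. dir_deriv A h q (Y q)) p (X p) -
           dir_deriv A (\<lambda>q. dir_deriv A h q (X q)) p (Y p)))"

definition metric_compatible ::
  "('a, 'e::euclidean_space) chart set \<Rightarrow> ('a \<Rightarrow> ('a, 'e) tvec \<Rightarrow> ('a, 'e) tvec \<Rightarrow> real) \<Rightarrow>
   (('a, 'e) vfield \<Rightarrow> ('a, 'e) vfield \<Rightarrow> ('a, 'e) vfield) \<Rightarrow> bool" where
  "metric_compatible A g nabla \<longleftrightarrow>
     (\<forall>X Y Z. smooth_vfield A X \<and> smooth_vfield A Y \<and> smooth_vfield A Z \<longrightarrow>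
        (\<forall>p\<in>points A.
           dir_deriv A (\<lambda>q. g q (Y q) (Z q)) p (X p) =
           g p (nabla X Y p) (Z p) + g p (Y p) (nabla X Z p)))"

definition levi_civita_connection ::
  "('a, 'e::euclidean_space) chart set \<Rightarrow> ('a \<Rightarrow> ('a, 'e) tvec \<Rightarrow> ('a, 'e) tvec \<Rightarrow> real) \<Rightarrow>
   (('a, 'e) vfield \<Rightarrow> ('a, 'e) vfield \<Rightarrow> ('a, 'e) vfield) \<Rightarrow> bool" where
  "levi_civita_connection A g nabla \<longleftrightarrow>
     affine_connection A nabla \<and> torsion_free A nabla \<and> metric_compatible A g nabla"

definition isometry ::
  "('a, 'e::euclidean_space) chart set \<Rightarrow> ('a \<Rightarrow> ('a, 'e) tvec \<Rightarrow> ('a, 'e) tvec \<Rightarrow> real) \<Rightarrow>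
   ('a \<Rightarrow> 'a) \<Rightarrow> bool" where
  "isometry A g f \<longleftrightarrow>
     diffeomorphism A A f \<and>
     (\<forall>p\<in>points A. \<forall>v\<in>tangent_space A p. \<forall>w\<in>tangent_space A p.
        g (f p) (differential A A f p v) (differential A A f p w) = g p v w)"


section \<open>The tangent bundle\<close>

text \<open>
  The total space of the tangent bundle consists of the pairs \<open>(p, v)\<close> with \<open>v\<close> tangent at \<open>p\<close>;
  the bundle projection is \<open>fst\<close>.
\<close>

type_synonym ('a, 'e) tpoint = "'a \<times> ('a, 'e) tvec"

type_synonym ('a, 'e) ttvec = "(('a, 'e) tpoint, 'e \<times> 'e) tvec"

definition tangent_atlas ::
  "('a, 'e::euclidean_space) chart set \<Rightarrow> (('a, 'e) tpoint, 'e \<times> 'e) chart set" where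
  "tangent_atlas A =
     {({(p, v). p \<in> fst c \<and> v \<in> tangent_space A p}, \<lambda>(p, v). (snd c p, v c)) | c. c \<in> A}"

text \<open>The pull-back bundle \<open>f\<^sup>*TM\<close>, with fibre \<open>tangent_space A (f p)\<close> over \<open>p\<close>.\<close>

definition pullback_tangent_atlas ::
  "('a, 'e::euclidean_space) chart set \<Rightarrow> ('a \<Rightarrow> 'a) \<Rightarrow> (('a, 'e) tpoint, 'e \<times> 'e) chart set" where
  "pullback_tangent_atlas A f =
     {({(p, v). p \<in> fst c \<and> f p \<in> fst d \<and> v \<in> tangent_space A (f p)}, \<lambda>(p, v). (snd c p, v d))
      | c d. c \<in> A \<and> d \<in> A}"

text \<open>Isomorphisms of such bundles over the identity of the base manifold.\<close>

definition vector_bundle_isomorphism ::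
  "(('a, 'e) tpoint, 'e::euclidean_space \<times> 'e) chart set \<Rightarrow> (('a, 'e) tpoint, 'e \<times> 'e) chart set \<Rightarrow>
   (('a, 'e) tpoint \<Rightarrow> ('a, 'e) tpoint) \<Rightarrow> bool" where
  "vector_bundle_isomorphism E F L \<longleftrightarrow>
     diffeomorphism E F L \<and>
     (\<forall>u\<in>points E. fst (L u) = fst u) \<and>
     (\<forall>p v w a. (p, v) \<in> points E \<and> (p, w) \<in> points E \<longrightarrow>
        snd (L (p, v + w)) = snd (L (p, v)) + snd (L (p, w)) \<and>
        snd (L (p, a \<cdot>\<^sub>t v)) = a \<cdot>\<^sub>t snd (L (p, v)))"

definition differential_bundle_map ::
  "('a, 'e::euclidean_space) chart set \<Rightarrow> ('a \<Rightarrow> 'a) \<Rightarrow> ('a, 'e) tpoint \<Rightarrow> ('a, 'e) tpoint" where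
  "differential_bundle_map A f u = (fst u, differential A A f (fst u) (snd u))"

text \<open>The map \<open>f\<^sub>\<star>\<close>.\<close>

definition tangent_map ::
  "('a, 'e::euclidean_space) chart set \<Rightarrow> ('a \<Rightarrow> 'a) \<Rightarrow> ('a, 'e) tpoint \<Rightarrow> ('a, 'e) tpoint" where
  "tangent_map A f u = (f (fst u), differential A A f (fst u) (snd u))"


section \<open>Horizontal and vertical lifts, the weighted structure\<close>

text \<open>The velocity at \<open>t = 0\<close> of the curve \<open>u + t w\<close> in the fibre.\<close>

definition vertical_lift ::
  "('a, 'e::euclidean_space) chart set \<Rightarrow> ('a, 'e) tpoint \<Rightarrow> ('a, 'e) tvec \<Rightarrow> ('a, 'e) ttvec" where
  "vertical_lift A u w =
     (\<lambda>C. if C \<in> charts_at (tangent_atlas A) u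
          then vector_derivative (\<lambda>t. snd C (fst u, snd u + t \<cdot>\<^sub>t w)) (at 0) else 0)"

text \<open>
  The horizontal space at \<open>u\<close>: the images of tangent vectors \<open>X p\<close> under the differentials of
  sections through \<open>u\<close> whose covariant derivative in the direction \<open>X p\<close> vanishes.
\<close>

definition horizontal_space ::
  "('a, 'e::euclidean_space) chart set \<Rightarrow> (('a, 'e) vfield \<Rightarrow> ('a, 'e) vfield \<Rightarrow> ('a, 'e) vfield) \<Rightarrow>
   ('a, 'e) tpoint \<Rightarrow> ('a, 'e) ttvec set" where
  "horizontal_space A nabla u =
     {differential A (tangent_atlas A) (\<lambda>q. (q, Y q)) (fst u) (X (fst u)) | X Y.
        smooth_vfield A X \<and> smooth_vfield A Y \<and> Y (fst u) = snd u \<and> nabla X Y (fst u) = 0}"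

definition proj_differential ::
  "('a, 'e::euclidean_space) chart set \<Rightarrow> ('a, 'e) tpoint \<Rightarrow> ('a, 'e) ttvec \<Rightarrow> ('a, 'e) tvec" where
  "proj_differential A u \<xi> = differential (tangent_atlas A) A fst u \<xi>"

definition horizontal_lift ::
  "('a, 'e::euclidean_space) chart set \<Rightarrow> (('a, 'e) vfield \<Rightarrow> ('a, 'e) vfield \<Rightarrow> ('a, 'e) vfield) \<Rightarrow>
   ('a, 'e) tpoint \<Rightarrow> ('a, 'e) tvec \<Rightarrow> ('a, 'e) ttvec" where
  "horizontal_lift A nabla u w =
     (THE \<xi>. \<xi> \<in> horizontal_space A nabla u \<and> proj_differential A u \<xi> = w)"

text \<open>
  The two components of \<open>\<xi>\<close> in the splitting into horizontal and vertical vectors, both regarded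
  as tangent vectors of the base: \<open>\<xi>\<close> is the horizontal lift of the first plus the vertical lift
  of the second.
\<close>

definition hor_part ::
  "('a, 'e::euclidean_space) chart set \<Rightarrow> ('a, 'e) tpoint \<Rightarrow> ('a, 'e) ttvec \<Rightarrow> ('a, 'e) tvec" where
  "hor_part A u \<xi> = proj_differential A u \<xi>"

definition ver_part ::
  "('a, 'e::euclidean_space) chart set \<Rightarrow> (('a, 'e) vfield \<Rightarrow> ('a, 'e) vfield \<Rightarrow> ('a, 'e) vfield) \<Rightarrow>
   ('a, 'e) tpoint \<Rightarrow> ('a, 'e) ttvec \<Rightarrow> ('a, 'e) tvec" where
  "ver_part A nabla u \<xi> =
     (THE z. z \<in> tangent_space A (fst u) \<and>
             \<xi> = horizontal_lift A nabla u (hor_part A u \<xi>) + vertical_lift A u z)"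

definition weighted_metric ::
  "('a, 'e::euclidean_space) chart set \<Rightarrow> ('a \<Rightarrow> ('a, 'e) tvec \<Rightarrow> ('a, 'e) tvec \<Rightarrow> real) \<Rightarrow>
   (('a, 'e) vfield \<Rightarrow> ('a, 'e) vfield \<Rightarrow> ('a, 'e) vfield) \<Rightarrow>
   (('a, 'e) tpoint \<Rightarrow> real) \<Rightarrow> (('a, 'e) tpoint \<Rightarrow> real) \<Rightarrow>
   ('a, 'e) tpoint \<Rightarrow> ('a, 'e) ttvec \<Rightarrow> ('a, 'e) ttvec \<Rightarrow> real" where
  "weighted_metric A g nabla mu lam u \<xi> \<eta> =
     (mu u)\<^sup>2 * g (fst u) (hor_part A u \<xi>) (hor_part A u \<eta>) +
     (lam u)\<^sup>2 * g (fst u) (ver_part A nabla u \<xi>) (ver_part A nabla u \<eta>)"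

definition weighted_complex_structure ::
  "('a, 'e::euclidean_space) chart set \<Rightarrow>
   (('a, 'e) vfield \<Rightarrow> ('a, 'e) vfield \<Rightarrow> ('a, 'e) vfield) \<Rightarrow>
   (('a, 'e) tpoint \<Rightarrow> real) \<Rightarrow> (('a, 'e) tpoint \<Rightarrow> real) \<Rightarrow>
   ('a, 'e) tpoint \<Rightarrow> ('a, 'e) ttvec \<Rightarrow> ('a, 'e) ttvec" where
  "weighted_complex_structure A nabla mu lam u \<xi> =
     (mu u / lam u) \<cdot>\<^sub>t vertical_lift A u (hor_part A u \<xi>) +
     (- (lam u / mu u)) \<cdot>\<^sub>t horizontal_lift A nabla u (ver_part A nabla u \<xi>)"

definition tnorm ::
  "('a \<Rightarrow> ('a, 'e) tvec \<Rightarrow> ('a, 'e) tvec \<Rightarrow> real) \<Rightarrow> ('a, 'e::euclidean_space) tpoint \<Rightarrow> real" where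
  "tnorm g u = sqrt (g (fst u) (snd u) (snd u))"

definition radial_weight ::
  "('a, 'e::euclidean_space) chart set \<Rightarrow> ('a \<Rightarrow> ('a, 'e) tvec \<Rightarrow> ('a, 'e) tvec \<Rightarrow> real) \<Rightarrow>
   (('a, 'e) tpoint \<Rightarrow> real) \<Rightarrow> bool" where
  "radial_weight A g mu \<longleftrightarrow>
     smooth_fun (tangent_atlas A) mu \<and>
     (\<forall>u\<in>points (tangent_atlas A). mu u > 0) \<and>
     (\<forall>u\<in>points (tangent_atlas A). \<forall>u'\<in>points (tangent_atlas A).
        tnorm g u = tnorm g u' \<longrightarrow> mu u = mu u')"

end

theory Submission
  imports Defs
begin

text \<open>
  An isometry \<open>f\<close> carries the Levi-Civita connection to itself: the difference \<open>D\<close> between the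
  connection and its transport is a tensor for which \<open>g (D X Y) Z\<close> is symmetric in \<open>X, Y\<close> (both
  connections are torsion-free) and antisymmetric in \<open>Y, Z\<close> (both are metric), so it vanishes.
  Since \<open>f\<^sub>\<star> \<circ> Y = (push-forward of Y) \<circ> f\<close> for every vector field \<open>Y\<close>, the chain rule then shows that
  \<open>df\<^sub>\<star>\<close> preserves horizontal spaces; together with \<open>\<pi> \<circ> f\<^sub>\<star> = f \<circ> \<pi>\<close> this gives
  \<open>df\<^sub>\<star> (w\<^sup>h) = (df w)\<^sup>h\<close>.  A vertical lift is the velocity of the curve \<open>u + t w\<close>, which \<open>f\<^sub>\<star>\<close> maps
  to \<open>f\<^sub>\<star> u + t df w\<close>, so \<open>df\<^sub>\<star> (w\<^sup>v) = (df w)\<^sup>v\<close>.  As \<open>df\<close> is isometric and the weights depend on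
  the norm only, both \<open>g\<close> and \<open>J\<close> are preserved.
  Horizontal lifts are defined through global vector fields with a prescribed first-order behaviour
  at a point, which is why smooth cutoff functions are needed.
\<close>

section \<open>Calculus of smooth maps\<close>

text \<open>A connection acts on global vector fields, and lifts and vertical parts are definite
  descriptions, so existence and uniqueness of the splitting must be proved before anything can be
  transported. The key fact is that at a zero of a field W the Leibniz rule leaves only the
  coordinate derivative of W, the same for every connection. Hence two sections through u whose
  covariant derivatives along one direction vanish at the point have the same differential in that
  direction, and any section can be corrected to such a one by adding a field multiplied by a
  function that vanishes at the point. To make the chain rule the main tool, changes of charts, real
  functions and curves are all treated as smooth maps between atlases. The changes of bundle charts,
  df, its inverse and f_* are likewise instances of one computation of a bundle map in
  coordinates.\<close>

lemma Ck_on_cong: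
  assumes "open S" "\<And>x. x \<in> S \<Longrightarrow> F x = G x"
  shows "Ck_on k S F \<longleftrightarrow> Ck_on k S G"
  using assms(2)
proof (induction k arbitrary: F G)
  case 0
  then show ?case by (simp cong: continuous_on_cong)
next
  case (Suc k)
  have d: "(F has_derivative D) (at x) \<longleftrightarrow> (G has_derivative D) (at x)" if "x \<in> S" for x D
    using has_derivative_transform_within_open[OF _ assms(1) that, of F D UNIV G]
      has_derivative_transform_within_open[OF _ assms(1) that, of G D UNIV F] Suc.prems by auto
  have e: "frechet_derivative F (at x) = frechet_derivative G (at x)" if "x \<in> S" for x
    unfolding frechet_derivative_def using d[OF that] by simp
  have "F differentiable (at x) \<longleftrightarrow> G differentiable (at x)" if "x \<in> S" for x
    unfolding differentiable_def using d[OF that] by simp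
  moreover have "Ck_on k S (\<lambda>x. frechet_derivative F (at x) v)
      \<longleftrightarrow> Ck_on k S (\<lambda>x. frechet_derivative G (at x) v)" for v
    by (rule Suc.IH) (simp add: e)
  ultimately show ?case by simp
qed

lemma Ck_on_subset: "Ck_on k S F \<Longrightarrow> T \<subseteq> S \<Longrightarrow> Ck_on k T F"
  by (induction k arbitrary: F) (auto intro: continuous_on_subset)

lemma Ck_on_continuous: "Ck_on k S F \<Longrightarrow> continuous_on S F"
  by (cases k) (simp_all add: continuous_at_imp_continuous_on differentiable_imp_continuous_within)

lemma Ck_on_Suc_D: "Ck_on (Suc k) S F \<Longrightarrow> Ck_on k S F"
proof (induction k arbitrary: F)
  case 0
  then show ?case using Ck_on_continuous[OF 0] by simp
next
  case (Suc k)
  have "Ck_on k S (\<lambda>x. frechet_derivative F (at x) v)" for v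
    by (rule Suc.IH) (use Suc.prems in simp)
  then show ?case using Suc.prems by simp
qed

text \<open>Derivatives are unique, so an explicit candidate may replace
  \<open>frechet_derivative\<close>, and on an open set this also preserves regularity. The closure
  properties below use it by induction on the order: the candidate is built from terms of the same
  shape as the original function.\<close>

lemma Ck_on_SucI:
  assumes "open S" "\<And>x. x \<in> S \<Longrightarrow> (F has_derivative F' x) (at x)"
    and "\<And>v. Ck_on k S (\<lambda>x. F' x v)"
  shows "Ck_on (Suc k) S F"
proof -
  have "frechet_derivative F (at x) = F' x" if "x \<in> S" for x
    using frechet_derivative_at[OF assms(2)[OF that]] by simp
  then have "Ck_on k S (\<lambda>x. frechet_derivative F (at x) v)" for v
    using assms(3)[of v] Ck_on_cong[OF assms(1), of "\<lambda>x. frechet_derivative F (at x) v" "\<lambda>x. F' x v" k]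
    by simp
  then show ?thesis using assms(2) by (auto simp: differentiable_def)
qed

lemma Ck_on_Suc_has_derivative:
  "Ck_on (Suc k) S F \<Longrightarrow> x \<in> S \<Longrightarrow> (F has_derivative frechet_derivative F (at x)) (at x)"
  by (simp add: frechet_derivative_works)

lemma Ck_on_const: "open S \<Longrightarrow> Ck_on k S (\<lambda>x. a)"
proof (induction k arbitrary: a)
  case (Suc k)
  show ?case by (rule Ck_on_SucI[where F' = "\<lambda>x v. 0"]) (use Suc in auto)
qed simp

lemma Ck_on_bounded_linear:
  assumes "open S" "bounded_linear L"
  shows "Ck_on k S L"
proof (cases k)
  case 0
  then show ?thesis using linear_continuous_on[OF assms(2)] by simp
next
  case (Suc k')
  show ?thesis unfolding Suc
    by (rule Ck_on_SucI[where F' = "\<lambda>x v. L v"])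
      (use assms in \<open>auto intro: Ck_on_const bounded_linear_imp_has_derivative\<close>)
qed

lemma Ck_on_add:
  assumes "open S" "Ck_on k S F" "Ck_on k S G"
  shows "Ck_on k S (\<lambda>x. F x + G x)"
  using assms(2,3)
proof (induction k arbitrary: F G)
  case 0
  then show ?case by (simp add: continuous_on_Pair continuous_on_add)
next
  case (Suc k)
  show ?case
  proof (rule Ck_on_SucI[OF assms(1)])
    show "((\<lambda>x. F x + G x) has_derivative
        (\<lambda>v. frechet_derivative F (at x) v + frechet_derivative G (at x) v)) (at x)" if "x \<in> S" for x
      by (intro has_derivative_add Ck_on_Suc_has_derivative[OF Suc.prems(1) that]
          Ck_on_Suc_has_derivative[OF Suc.prems(2) that])
    show "Ck_on k S (\<lambda>x. frechet_derivative F (at x) v + frechet_derivative G (at x) v)" for v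
      using Suc by simp
  qed
qed

text \<open>The Leibniz rule pairs the derivative of one factor with the other factor itself. The
  induction therefore needs the undifferentiated factors at the lower order too, which
  \<open>Ck_on_Suc_D\<close> supplies.\<close>

lemma Ck_on_bilinear:
  assumes "open S" "bounded_bilinear B" "Ck_on k S F" "Ck_on k S G"
  shows "Ck_on k S (\<lambda>x. B (F x) (G x))"
  using assms(3,4)
proof (induction k arbitrary: F G)
  case 0
  then show ?case using bounded_bilinear.continuous_on[OF assms(2)] by simp
next
  case (Suc k)
  show ?case
  proof (rule Ck_on_SucI[OF assms(1)])
    show "((\<lambda>x. B (F x) (G x)) has_derivative
        (\<lambda>v. B (F x) (frechet_derivative G (at x) v) + B (frechet_derivative F (at x) v) (G x))) (at x)"
      if "x \<in> S" for x
      by (intro bounded_bilinear.FDERIV[OF assms(2)] Ck_on_Suc_has_derivative[OF Suc.prems(1) that]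
          Ck_on_Suc_has_derivative[OF Suc.prems(2) that])
    show "Ck_on k S (\<lambda>x. B (F x) (frechet_derivative G (at x) v) + B (frechet_derivative F (at x) v) (G x))"
      for v
      using Suc.prems by (intro Ck_on_add Suc.IH assms(1) Ck_on_Suc_D[OF Suc.prems(1)] Ck_on_Suc_D[OF Suc.prems(2)]) auto
  qed
qed

lemma Ck_on_sum:
  assumes "open S" "\<And>i. i \<in> I \<Longrightarrow> Ck_on k S (F i)"
  shows "Ck_on k S (\<lambda>x. \<Sum>i\<in>I. F i x)"
  using assms(2)
  by (induction I rule: infinite_finite_induct) (simp_all add: Ck_on_const Ck_on_add assms(1))

lemma Ck_on_Pair:
  assumes "open S" "Ck_on k S F" "Ck_on k S G"
  shows "Ck_on k S (\<lambda>x. (F x, G x))"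
  using assms(2,3)
proof (induction k arbitrary: F G)
  case 0
  then show ?case by (simp add: continuous_on_Pair continuous_on_add)
next
  case (Suc k)
  show ?case
  proof (rule Ck_on_SucI[OF assms(1)])
    show "((\<lambda>x. (F x, G x)) has_derivative
        (\<lambda>v. (frechet_derivative F (at x) v, frechet_derivative G (at x) v))) (at x)" if "x \<in> S" for x
      by (intro has_derivative_Pair Ck_on_Suc_has_derivative[OF Suc.prems(1) that]
          Ck_on_Suc_has_derivative[OF Suc.prems(2) that])
    show "Ck_on k S (\<lambda>x. (frechet_derivative F (at x) v, frechet_derivative G (at x) v))" for v
      using Suc by simp
  qed
qed

text \<open>Turns a derivative in a direction that varies with the point into a combination of
  derivatives in fixed directions, the only ones that \<open>Ck_on\<close> controls.\<close>

lemma linear_basis_expansion: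
  fixes L :: "'e::euclidean_space \<Rightarrow> 'f::real_vector"
  assumes "linear L"
  shows "L v = (\<Sum>b\<in>Basis. (v \<bullet> b) *\<^sub>R L b)"
proof -
  have "L v = L (\<Sum>b\<in>Basis. (v \<bullet> b) *\<^sub>R b)" by (simp add: euclidean_representation)
  then show ?thesis by (simp add: linear_sum[OF assms] linear_scale[OF assms])
qed

text \<open>In the chain rule the derivative of \<open>G\<close> is taken in the direction
  \<open>frechet_derivative F (at x) v\<close>, which moves with \<open>x\<close>. Expanded in a
  basis of the intermediate Euclidean space it becomes a finite sum of products, each with a factor
  of the form \<open>G' (F x)\<close> for a fixed direction, to which the induction hypothesis
  applies.\<close>

lemma Ck_on_compose:
  fixes F :: "'e::real_normed_vector \<Rightarrow> 'f::euclidean_space"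
  assumes "open S" "Ck_on k S F" "Ck_on k T G" "F ` S \<subseteq> T"
  shows "Ck_on k S (\<lambda>x. G (F x))"
  using assms(2,3)
proof (induction k arbitrary: G)
  case 0
  then show ?case using assms(4) by (auto intro: continuous_on_compose2)
next
  case (Suc k)
  show ?case
  proof (rule Ck_on_SucI[OF assms(1)])
    fix x assume x: "x \<in> S"
    then have G: "(G has_derivative frechet_derivative G (at (F x))) (at (F x))"
      using assms(4) by (intro Ck_on_Suc_has_derivative[OF Suc.prems(2)]) auto
    have "((\<lambda>x. G (F x)) has_derivative
        (\<lambda>v. frechet_derivative G (at (F x)) (frechet_derivative F (at x) v))) (at x)"
      by (rule has_derivative_compose[OF Ck_on_Suc_has_derivative[OF Suc.prems(1) x] G])
    moreover have "frechet_derivative G (at (F x)) (frechet_derivative F (at x) v) =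
        (\<Sum>b\<in>Basis. (frechet_derivative F (at x) v \<bullet> b) *\<^sub>R frechet_derivative G (at (F x)) b)" for v
      by (rule linear_basis_expansion[OF has_derivative_linear[OF G]])
    ultimately show "((\<lambda>x. G (F x)) has_derivative
        (\<lambda>v. \<Sum>b\<in>Basis. (frechet_derivative F (at x) v \<bullet> b) *\<^sub>R frechet_derivative G (at (F x)) b)) (at x)"
      by simp
  next
    fix v
    show "Ck_on k S (\<lambda>x. \<Sum>b\<in>Basis. (frechet_derivative F (at x) v \<bullet> b) *\<^sub>R frechet_derivative G (at (F x)) b)"
    proof (intro Ck_on_sum assms(1) Ck_on_bilinear[OF _ bounded_bilinear_scaleR]
          Ck_on_bilinear[OF _ bounded_bilinear_inner] Ck_on_const)
      show "Ck_on k S (\<lambda>x. frechet_derivative F (at x) v)" using Suc.prems by simp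
      show "Ck_on k S (\<lambda>x. frechet_derivative G (at (F x)) b)" for b
        using Suc.prems by (intro Suc.IH[of "\<lambda>y. frechet_derivative G (at y) b"] Ck_on_Suc_D[OF Suc.prems(1)]) simp
    qed
  qed
qed

lemma Ck_on_local:
  assumes "\<And>x. x \<in> S \<Longrightarrow> \<exists>T. open T \<and> x \<in> T \<and> Ck_on k T F"
  shows "Ck_on k S F"
  using assms
proof (induction k arbitrary: F)
  case 0
  have "isCont F x" if x: "x \<in> S" for x
  proof -
    obtain T where "open T" "x \<in> T" "continuous_on T F" using 0[OF x] by auto
    then show ?thesis using continuous_on_eq_continuous_at by blast
  qed
  then show ?case by (simp add: continuous_at_imp_continuous_on)
next
  case (Suc k)
  have "F differentiable (at x)" if "x \<in> S" for x using Suc.prems[OF that] by auto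
  moreover have "Ck_on k S (\<lambda>x. frechet_derivative F (at x) v)" for v
  proof (rule Suc.IH)
    fix x assume "x \<in> S"
    then obtain T where "open T" "x \<in> T" "Ck_on (Suc k) T F" using Suc.prems by blast
    then show "\<exists>T. open T \<and> x \<in> T \<and> Ck_on k T (\<lambda>x. frechet_derivative F (at x) v)" by auto
  qed
  ultimately show ?case by simp
qed

section \<open>Smooth maps: the closure properties for all orders at once\<close>

lemma smooth_on_cong:
  "open S \<Longrightarrow> (\<And>x. x \<in> S \<Longrightarrow> F x = G x) \<Longrightarrow> smooth_on S F \<longleftrightarrow> smooth_on S G"
  by (simp add: smooth_on_def Ck_on_cong[of S F G])

lemma smooth_on_subset: "smooth_on S F \<Longrightarrow> T \<subseteq> S \<Longrightarrow> smooth_on T F"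
  unfolding smooth_on_def using Ck_on_subset[of _ S F T] by simp

lemma smooth_on_continuous: "smooth_on S F \<Longrightarrow> continuous_on S F"
  unfolding smooth_on_def by (drule spec[of _ 0]) simp

lemma smooth_on_has_derivative:
  "smooth_on S F \<Longrightarrow> x \<in> S \<Longrightarrow> (F has_derivative frechet_derivative F (at x)) (at x)"
  unfolding smooth_on_def using Ck_on_Suc_has_derivative[of 0 S F x] by simp

lemma smooth_on_frechet_derivative: "smooth_on S F \<Longrightarrow> smooth_on S (\<lambda>x. frechet_derivative F (at x) v)"
  unfolding smooth_on_def using Ck_on.simps(2)[of _ S F] by simp

lemma smooth_on_const: "open S \<Longrightarrow> smooth_on S (\<lambda>x. a)"
  by (simp add: smooth_on_def Ck_on_const)

lemma smooth_on_bounded_linear: "open S \<Longrightarrow> bounded_linear L \<Longrightarrow> smooth_on S L"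
  by (simp add: smooth_on_def Ck_on_bounded_linear)

lemma smooth_on_add:
  "open S \<Longrightarrow> smooth_on S F \<Longrightarrow> smooth_on S G \<Longrightarrow> smooth_on S (\<lambda>x. F x + G x)"
  by (simp add: smooth_on_def Ck_on_add)

lemma smooth_on_sum:
  "open S \<Longrightarrow> (\<And>i. i \<in> I \<Longrightarrow> smooth_on S (F i)) \<Longrightarrow> smooth_on S (\<lambda>x. \<Sum>i\<in>I. F i x)"
  by (simp add: smooth_on_def Ck_on_sum)

lemma smooth_on_bilinear:
  "open S \<Longrightarrow> bounded_bilinear B \<Longrightarrow> smooth_on S F \<Longrightarrow> smooth_on S G \<Longrightarrow> smooth_on S (\<lambda>x. B (F x) (G x))"
  by (simp add: smooth_on_def Ck_on_bilinear)

lemmas smooth_on_scaleR = smooth_on_bilinear[OF _ bounded_bilinear_scaleR]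
lemmas smooth_on_mult = smooth_on_bilinear[OF _ bounded_bilinear_mult]
lemmas smooth_on_inner = smooth_on_bilinear[OF _ bounded_bilinear_inner]

lemma smooth_on_Pair:
  "open S \<Longrightarrow> smooth_on S F \<Longrightarrow> smooth_on S G \<Longrightarrow> smooth_on S (\<lambda>x. (F x, G x))"
  by (simp add: smooth_on_def Ck_on_Pair)

lemma smooth_on_compose:
  fixes F :: "'e::real_normed_vector \<Rightarrow> 'f::euclidean_space"
  shows "open S \<Longrightarrow> smooth_on S F \<Longrightarrow> smooth_on T G \<Longrightarrow> F ` S \<subseteq> T \<Longrightarrow> smooth_on S (\<lambda>x. G (F x))"
  by (simp add: smooth_on_def Ck_on_compose[where T = T])

lemma smooth_on_local:
  assumes "\<And>x. x \<in> S \<Longrightarrow> \<exists>T. open T \<and> x \<in> T \<and> smooth_on T F"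
  shows "smooth_on S F"
  unfolding smooth_on_def
proof (intro allI Ck_on_local)
  fix k x assume "x \<in> S"
  from assms[OF this] show "\<exists>T. open T \<and> x \<in> T \<and> Ck_on k T F"
    unfolding smooth_on_def by blast
qed

text \<open>Smoothness jointly in the base point and the direction. With base and fibre coordinates
  as \<open>K\<close> and \<open>Y\<close> it makes tangent maps smooth; with \<open>K\<close> the
  identity it makes directional derivatives along fields smooth.\<close>

lemma smooth_on_derivative_apply:
  fixes H :: "'f::euclidean_space \<Rightarrow> 'g::real_normed_vector" and K :: "'e::real_normed_vector \<Rightarrow> 'f"
  assumes "open S" "smooth_on S K" "smooth_on S Y" "smooth_on T H" "K ` S \<subseteq> T"
  shows "smooth_on S (\<lambda>x. frechet_derivative H (at (K x)) (Y x))"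
proof -
  have "frechet_derivative H (at (K x)) (Y x) =
      (\<Sum>b\<in>Basis. (Y x \<bullet> b) *\<^sub>R frechet_derivative H (at (K x)) b)" if "x \<in> S" for x
    using that assms(5)
    by (intro linear_basis_expansion has_derivative_linear[OF smooth_on_has_derivative[OF assms(4)]]) auto
  moreover have "smooth_on S (\<lambda>x. \<Sum>b\<in>Basis. (Y x \<bullet> b) *\<^sub>R frechet_derivative H (at (K x)) b)"
    (is "smooth_on S ?R")
    by (intro smooth_on_sum smooth_on_scaleR smooth_on_inner smooth_on_const assms(1,3)
        smooth_on_compose[OF assms(1,2) smooth_on_frechet_derivative[OF assms(4)] assms(5)])
  ultimately show ?thesis
    using smooth_on_cong[OF assms(1), of "\<lambda>x. frechet_derivative H (at (K x)) (Y x)" ?R] by simp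
qed

section \<open>Atlases and differentials\<close>

text \<open>
  A smooth manifold without the separation axioms: enough for the differential calculus, and
  satisfied by the tangent bundle without any topological argument.
\<close>

definition atlas :: "('a, 'e::euclidean_space) chart set \<Rightarrow> bool" where
  "atlas A \<longleftrightarrow>
     (\<forall>c\<in>A. inj_on (snd c) (fst c) \<and> open (snd c ` fst c)) \<and>
     (\<forall>c\<in>A. \<forall>d\<in>A. open (snd c ` (fst c \<inter> fst d)) \<and>
        smooth_on (snd c ` (fst c \<inter> fst d)) (snd d \<circ> chart_inv c))"

lemma smooth_manifold_atlas: "smooth_manifold A \<Longrightarrow> atlas A"
  by (simp add: smooth_manifold_def atlas_def)

section \<open>Coordinate expressions of maps and changes of charts\<close>

definition lrep :: "('a \<Rightarrow> 'b) \<Rightarrow> ('a, 'e) chart \<Rightarrow> ('b, 'f) chart \<Rightarrow> 'e \<Rightarrow> 'f" where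
  "lrep f c d = snd d \<circ> f \<circ> chart_inv c"

definition ldom :: "('a \<Rightarrow> 'b) \<Rightarrow> ('a, 'e) chart \<Rightarrow> ('b, 'f) chart \<Rightarrow> 'e set" where
  "ldom f c d = snd c ` {p \<in> fst c. f p \<in> fst d}"

text \<open>The Jacobian of \<open>f\<close> in two charts. For \<open>f = id\<close> it is the
  Jacobian of a change of charts, so one chain rule covers both maps and changes of
  coordinates.\<close>

definition lderiv ::
  "('a \<Rightarrow> 'b) \<Rightarrow> ('a, 'e::real_normed_vector) chart \<Rightarrow> ('b, 'f::real_normed_vector) chart \<Rightarrow> 'a \<Rightarrow> 'e \<Rightarrow> 'f" where
  "lderiv f c d p = frechet_derivative (lrep f c d) (at (snd c p))"

lemma atlas_inj: "atlas A \<Longrightarrow> c \<in> A \<Longrightarrow> inj_on (snd c) (fst c)"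
  and atlas_open: "atlas A \<Longrightarrow> c \<in> A \<Longrightarrow> open (snd c ` fst c)"
  by (simp_all add: atlas_def)

lemma chart_inv_snd: "atlas A \<Longrightarrow> c \<in> A \<Longrightarrow> p \<in> fst c \<Longrightarrow> chart_inv c (snd c p) = p"
  by (simp add: chart_inv_def atlas_inj)

lemma chart_inv_in: "x \<in> snd c ` fst c \<Longrightarrow> chart_inv c x \<in> fst c"
  and snd_chart_inv: "x \<in> snd c ` fst c \<Longrightarrow> snd c (chart_inv c x) = x"
  by (simp_all add: chart_inv_def inv_into_into f_inv_into_f)

lemma ldom_iff:
  assumes "atlas A" "c \<in> A"
  shows "x \<in> ldom f c d \<longleftrightarrow> x \<in> snd c ` fst c \<and> f (chart_inv c x) \<in> fst d"
  using chart_inv_snd[OF assms] unfolding ldom_def by (auto simp: snd_chart_inv chart_inv_in)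

lemma snd_in_ldom: "p \<in> fst c \<Longrightarrow> f p \<in> fst d \<Longrightarrow> snd c p \<in> ldom f c d"
  by (auto simp: ldom_def)

lemma lrep_snd: "atlas A \<Longrightarrow> c \<in> A \<Longrightarrow> p \<in> fst c \<Longrightarrow> lrep f c d (snd c p) = snd d (f p)"
  by (simp add: lrep_def chart_inv_snd)

lemma ldom_id: "ldom id c d = snd c ` (fst c \<inter> fst d)"
  by (auto simp: ldom_def)

lemma atlas_transition:
  assumes "atlas A" "c \<in> A" "d \<in> A"
  shows "open (ldom id c d)" "smooth_on (ldom id c d) (lrep id c d)"
  using assms by (simp_all add: atlas_def ldom_id lrep_def)

section \<open>The atlas topology and smoothness in charts\<close>

lemma charts_at_iff: "c \<in> charts_at A p \<longleftrightarrow> c \<in> A \<and> p \<in> fst c"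
  by (simp add: charts_at_def)

lemma charts_at_nonempty: "p \<in> points A \<Longrightarrow> \<exists>c. c \<in> charts_at A p"
  by (auto simp: points_def charts_at_def)

lemma pointsI: "c \<in> charts_at A p \<Longrightarrow> p \<in> points A"
  by (auto simp: points_def charts_at_def)

text \<open>\<open>topology\<close> has the intended open sets only once they are known to satisfy
  \<open>istopology\<close>. Injectivity of the charts is what makes images commute with
  intersections.\<close>

lemma openin_atlas_topology:
  assumes "atlas A"
  shows "openin (atlas_topology A) W \<longleftrightarrow> W \<subseteq> points A \<and> (\<forall>c\<in>A. open (snd c ` (W \<inter> fst c)))"
proof -
  have int: "snd c ` ((S \<inter> T) \<inter> fst c) = snd c ` (S \<inter> fst c) \<inter> snd c ` (T \<inter> fst c)" if "c \<in> A" for c S T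
    using atlas_inj[OF assms that] by (auto simp: inj_on_def)
  have un: "snd c ` (\<Union>K \<inter> fst c) = (\<Union>S\<in>K. snd c ` (S \<inter> fst c))" for c and K :: "'a set set"
    by auto
  have "istopology (\<lambda>W. W \<subseteq> points A \<and> (\<forall>c\<in>A. open (snd c ` (W \<inter> fst c))))"
    unfolding istopology_def by (auto simp: int un)
  then show ?thesis by (simp add: atlas_topology_def)
qed

lemma topspace_atlas_topology: "atlas A \<Longrightarrow> topspace (atlas_topology A) = points A"
proof -
  assume A: "atlas A"
  have "points A \<inter> fst c = fst c" if "c \<in> A" for c using that by (auto simp: points_def)
  then have "openin (atlas_topology A) (points A)"
    using A by (simp add: openin_atlas_topology atlas_open)
  then show ?thesis
    using openin_atlas_topology[OF A] by (metis openin_subset openin_topspace subset_antisym)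
qed

lemma chart_domain_openin: "atlas A \<Longrightarrow> c \<in> A \<Longrightarrow> openin (atlas_topology A) (fst c)"
  using atlas_transition(1)[of A]
  by (auto simp: openin_atlas_topology ldom_id points_def Int_commute)

text \<open>Trades continuity for openness of the domains of the coordinate expressions. In this
  form smoothness of maps to and from bundles is a statement about open subsets of Euclidean
  spaces.\<close>

lemma smooth_map_iff:
  assumes A: "atlas A" and B: "atlas B"
  shows "smooth_map A B f \<longleftrightarrow> f \<in> points A \<rightarrow> points B \<and>
     (\<forall>c\<in>A. \<forall>d\<in>B. open (ldom f c d) \<and> smooth_on (ldom f c d) (lrep f c d))"
    (is "?L \<longleftrightarrow> ?R")
proof
  assume L: ?L
  then have cont: "continuous_map (atlas_topology A) (atlas_topology B) f"
    and sm: "\<forall>c\<in>A. \<forall>d\<in>B. smooth_on (ldom f c d) (lrep f c d)"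
    by (simp_all add: smooth_map_def ldom_def lrep_def)
  have "open (ldom f c d)" if "c \<in> A" "d \<in> B" for c d
  proof -
    have "openin (atlas_topology A) {p \<in> topspace (atlas_topology A). f p \<in> fst d}"
      using openin_continuous_map_preimage[OF cont chart_domain_openin[OF B that(2)]] .
    then have "open (snd c ` ({p \<in> points A. f p \<in> fst d} \<inter> fst c))"
      using that A by (simp add: openin_atlas_topology topspace_atlas_topology)
    moreover have "{p \<in> points A. f p \<in> fst d} \<inter> fst c = {p \<in> fst c. f p \<in> fst d}"
      using that by (auto simp: points_def)
    ultimately show ?thesis by (simp add: ldom_def)
  qed
  moreover have "f \<in> points A \<rightarrow> points B"
    using continuous_map_funspace[OF cont] A B by (simp add: topspace_atlas_topology)
  ultimately show ?R using sm by simp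
next
  assume R: ?R
  have "continuous_map (atlas_topology A) (atlas_topology B) f"
    unfolding continuous_map_def topspace_atlas_topology[OF A] topspace_atlas_topology[OF B]
  proof (intro conjI allI impI)
    show "f \<in> points A \<rightarrow> points B" using R by simp
    fix W assume W: "openin (atlas_topology B) W"
    have "open (snd c ` ({p \<in> points A. f p \<in> W} \<inter> fst c))" if c: "c \<in> A" for c
    proof -
      \<comment> \<open>Seen in \<open>c\<close>, the preimage of \<open>W\<close> is the union of
        its parts that \<open>f\<close> sends into the various charts \<open>d\<close>; each part is
        a preimage under the continuous map \<open>lrep f c d\<close>.\<close>
      have "snd c ` ({p \<in> points A. f p \<in> W} \<inter> fst c) =
          (\<Union>d\<in>B. {x \<in> ldom f c d. lrep f c d x \<in> snd d ` (W \<inter> fst d)})" (is "?l = ?r")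
      proof (intro equalityI subsetI)
        fix x assume "x \<in> ?l"
        then obtain p where p: "p \<in> points A" "f p \<in> W" "p \<in> fst c" "x = snd c p" by auto
        then have "f p \<in> points B" using R by auto
        then obtain d where "d \<in> B" "f p \<in> fst d" by (auto simp: points_def)
        then show "x \<in> ?r" using p c by (auto simp: lrep_snd[OF A] ldom_def)
      next
        fix x assume "x \<in> ?r"
        then obtain d where d: "d \<in> B" "x \<in> ldom f c d" "lrep f c d x \<in> snd d ` (W \<inter> fst d)" by auto
        then obtain p where p: "x = snd c p" "p \<in> fst c" "f p \<in> fst d" by (auto simp: ldom_def)
        then have "snd d (f p) \<in> snd d ` (W \<inter> fst d)" using d c by (simp add: lrep_snd[OF A])
        then have "f p \<in> W" using p atlas_inj[OF B d(1)] by (auto simp: inj_on_def)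
        then show "x \<in> ?l" using p c by (auto simp: points_def)
      qed
      moreover have "open {x \<in> ldom f c d. lrep f c d x \<in> snd d ` (W \<inter> fst d)}" if d: "d \<in> B" for d
      proof -
        have "open (snd d ` (W \<inter> fst d))" using W d B by (simp add: openin_atlas_topology)
        then have "open (ldom f c d \<inter> lrep f c d -` (snd d ` (W \<inter> fst d)))"
          using R c d by (intro continuous_open_preimage smooth_on_continuous) auto
        then show ?thesis by (simp add: vimage_def Int_def)
      qed
      ultimately show ?thesis by auto
    qed
    moreover have "{p \<in> points A. f p \<in> W} \<subseteq> points A" by auto
    ultimately show "openin (atlas_topology A) {p \<in> points A. f p \<in> W}"
      using A by (simp add: openin_atlas_topology)
  qed
  then show ?L using R by (simp add: smooth_map_def ldom_def lrep_def)
qed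

lemma smooth_map_ldom:
  assumes "atlas A" "atlas B" "smooth_map A B f" "c \<in> A" "d \<in> B"
  shows "open (ldom f c d)" "smooth_on (ldom f c d) (lrep f c d)"
  using assms by (auto simp: smooth_map_iff)

lemma smooth_map_points: "atlas A \<Longrightarrow> atlas B \<Longrightarrow> smooth_map A B f \<Longrightarrow> p \<in> points A \<Longrightarrow> f p \<in> points B"
  by (auto simp: smooth_map_iff)

text \<open>A fixed middle chart \<open>d\<close> sees only the points that \<open>f\<close> sends
  into its domain, so \<open>R\<close> can be smaller than the domain of the composite expression
  and the conclusions are local. Allowing arbitrary open \<open>S\<close> and \<open>T\<close> makes
  the lemma applicable to its own output.\<close>

lemma lrep_compose_domain:
  assumes A: "atlas A" and B: "atlas B" and c: "c \<in> A" and d: "d \<in> B"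
    and S: "open S" "S \<subseteq> ldom f c d" "smooth_on S (lrep f c d)" and T: "open T" "T \<subseteq> ldom g d e"
    and gT: "smooth_on T (lrep g d e)"
  defines "R \<equiv> S \<inter> lrep f c d -` T"
  shows "open R" "R \<subseteq> ldom (g \<circ> f) c e" "\<And>x. x \<in> R \<Longrightarrow> lrep (g \<circ> f) c e x = lrep g d e (lrep f c d x)"
    "smooth_on R (lrep (g \<circ> f) c e)"
proof -
  show o: "open R" unfolding R_def
    by (intro continuous_open_preimage smooth_on_continuous S T)
  have *: "f (chart_inv c x) \<in> fst d \<and> chart_inv d (lrep f c d x) = f (chart_inv c x)" if "x \<in> R" for x
    using that S(2) ldom_iff[OF A c, of x f d] by (auto simp: R_def lrep_def chart_inv_snd[OF B d])
  show sub: "R \<subseteq> ldom (g \<circ> f) c e"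
  proof
    fix x assume x: "x \<in> R"
    then have "lrep f c d x \<in> ldom g d e" "x \<in> ldom f c d" using S(2) T(2) by (auto simp: R_def)
    then show "x \<in> ldom (g \<circ> f) c e" using *[OF x]
      by (simp add: ldom_iff[OF A c] ldom_iff[OF B d])
  qed
  show eq: "lrep (g \<circ> f) c e x = lrep g d e (lrep f c d x)" if "x \<in> R" for x
    using *[OF that] by (simp add: lrep_def)
  have "smooth_on R (\<lambda>x. lrep g d e (lrep f c d x))"
    by (rule smooth_on_compose[OF o smooth_on_subset[OF S(3)] gT]) (auto simp: R_def)
  then show "smooth_on R (lrep (g \<circ> f) c e)"
    using smooth_on_cong[OF o, of "lrep (g \<circ> f) c e" "\<lambda>x. lrep g d e (lrep f c d x)"] eq by simp
qed

text \<open>Near a point, the expression of \<open>f\<close> in any other pair of charts is the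
  given one, preceded by the change from \<open>c'\<close> to \<open>c\<close> and followed by the
  change from \<open>d\<close> to \<open>d'\<close>. So one good pair of charts per point is
  enough.\<close>

lemma smooth_map_localI:
  assumes A: "atlas A" and B: "atlas B"
    and loc: "\<And>p. p \<in> points A \<Longrightarrow> \<exists>c\<in>A. \<exists>d\<in>B. \<exists>S. p \<in> fst c \<and> f p \<in> fst d \<and> open S \<and> snd c p \<in> S \<and>
      S \<subseteq> ldom f c d \<and> smooth_on S (lrep f c d)"
  shows "smooth_map A B f"
proof -
  have key: "\<exists>R. open R \<and> x \<in> R \<and> R \<subseteq> ldom f c' d' \<and> smooth_on R (lrep f c' d')"
    if c': "c' \<in> A" and d': "d' \<in> B" and x: "x \<in> ldom f c' d'" for c' d' x
  proof -
    obtain p where p: "p \<in> fst c'" "f p \<in> fst d'" "x = snd c' p" using x by (auto simp: ldom_def)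
    then have "p \<in> points A" using c' by (auto simp: points_def)
    then obtain c d S where *: "c \<in> A" "d \<in> B" "p \<in> fst c" "f p \<in> fst d" "open S" "snd c p \<in> S"
      "S \<subseteq> ldom f c d" "smooth_on S (lrep f c d)" using loc by blast
    define R1 where "R1 = S \<inter> lrep f c d -` ldom id d d'"
    note R1 = lrep_compose_domain[OF A B *(1,2) *(5,7,8) atlas_transition(1)[OF B *(2) d'] order_refl
        atlas_transition(2)[OF B *(2) d'], folded R1_def, simplified]
    define R where "R = ldom id c' c \<inter> lrep id c' c -` R1"
    note R = lrep_compose_domain[OF A A c' *(1) atlas_transition(1)[OF A c' *(1)] order_refl
        atlas_transition(2)[OF A c' *(1)] R1(1,2,4), folded R_def, simplified]
    have "x \<in> R" using p * c' unfolding R_def R1_def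
      by (auto simp: lrep_snd[OF A] snd_in_ldom)
    then show ?thesis using R(1,2,4) by (intro exI[of _ R] conjI)
  qed
  have "open (ldom f c d)" if "c \<in> A" "d \<in> B" for c d
    using key[OF that] by (subst open_subopen) blast
  moreover have "smooth_on (ldom f c d) (lrep f c d)" if "c \<in> A" "d \<in> B" for c d
  proof (rule smooth_on_local)
    fix x assume "x \<in> ldom f c d"
    from key[OF that this] show "\<exists>T. open T \<and> x \<in> T \<and> smooth_on T (lrep f c d)" by (elim exE conjE) (intro exI conjI)
  qed
  moreover have "f \<in> points A \<rightarrow> points B"
  proof
    fix p assume "p \<in> points A"
    then show "f p \<in> points B" using loc[of p] unfolding points_def by blast
  qed
  ultimately show ?thesis using A B by (simp add: smooth_map_iff)
qed

lemma smooth_map_id: "atlas A \<Longrightarrow> smooth_map A A id"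
  by (auto simp: smooth_map_iff atlas_transition)

lemma smooth_map_compose:
  assumes A: "atlas A" and B: "atlas B" and C: "atlas C"
    and f: "smooth_map A B f" and g: "smooth_map B C g"
  shows "smooth_map A C (g \<circ> f)"
proof (rule smooth_map_localI[OF A C])
  fix p assume p: "p \<in> points A"
  obtain c where c: "c \<in> A" "p \<in> fst c" using p by (auto simp: points_def)
  obtain d where d: "d \<in> B" "f p \<in> fst d"
    using smooth_map_points[OF A B f p] by (auto simp: points_def)
  obtain e where e: "e \<in> C" "g (f p) \<in> fst e"
    using smooth_map_points[OF B C g smooth_map_points[OF A B f p]] by (auto simp: points_def)
  note R = lrep_compose_domain[OF A B c(1) d(1) smooth_map_ldom(1)[OF A B f c(1) d(1)] order_refl
      smooth_map_ldom(2)[OF A B f c(1) d(1)] smooth_map_ldom(1)[OF B C g d(1) e(1)] order_refl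
      smooth_map_ldom(2)[OF B C g d(1) e(1)]]
  have "snd c p \<in> ldom f c d \<inter> lrep f c d -` ldom g d e"
    using c d e by (auto simp: lrep_snd[OF A] snd_in_ldom)
  then show "\<exists>c\<in>A. \<exists>e\<in>C. \<exists>S. p \<in> fst c \<and> (g \<circ> f) p \<in> fst e \<and> open S \<and> snd c p \<in> S \<and>
      S \<subseteq> ldom (g \<circ> f) c e \<and> smooth_on S (lrep (g \<circ> f) c e)"
    using R(1,2,4) c e
    by (intro bexI[of _ c] bexI[of _ e] exI[of _ "ldom f c d \<inter> lrep f c d -` ldom g d e"] conjI) simp_all
qed

lemma lrep_cong:
  assumes "x \<in> snd c ` fst c" "c \<in> A" "\<And>p. p \<in> points A \<Longrightarrow> f p = g p"
  shows "lrep f c d x = lrep g c d x"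
proof -
  have "chart_inv c x \<in> points A" using chart_inv_in[OF assms(1)] assms(2) by (auto simp: points_def)
  then show ?thesis using assms(3) by (simp add: lrep_def)
qed

text \<open>Identities between maps, such as those of \<open>f\<close> with its inverse, hold on the
  points of the manifold only and not as equations of total functions. This lemma and its analogue
  for differentials make them usable.\<close>

lemma smooth_map_cong:
  fixes A :: "('a, 'e::euclidean_space) chart set" and B :: "('b, 'f::euclidean_space) chart set"
  assumes A: "atlas A" and B: "atlas B" and eq: "\<And>p. p \<in> points A \<Longrightarrow> f p = g p" and f: "smooth_map A B f"
  shows "smooth_map A B g"
proof -
  have "ldom g c d = ldom f c d" if "c \<in> A" for c and d :: "('b, 'f) chart"
    using eq that by (force simp: ldom_def points_def)
  moreover have "smooth_on (ldom f c d) (lrep g c d)" if cd: "c \<in> A" "d \<in> B" for c d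
  proof -
    have "lrep g c d x = lrep f c d x" if "x \<in> ldom f c d" for x
      using lrep_cong[where f = f and g = g and d = d and c = c and x = x, OF _ cd(1)] eq that cd A by (auto simp: ldom_iff)
    then show ?thesis
      using smooth_on_cong[OF smooth_map_ldom(1)[OF A B f cd], of "lrep g c d" "lrep f c d"]
        smooth_map_ldom(2)[OF A B f cd] by simp
  qed
  moreover have "g \<in> points A \<rightarrow> points B"
    using smooth_map_points[OF A B f] eq by auto
  ultimately show ?thesis using f A B by (simp add: smooth_map_iff)
qed

section \<open>Jacobians and the chain rule in charts\<close>

lemma lderiv_has_derivative:
  assumes A: "atlas A" and B: "atlas B" and f: "smooth_map A B f"
    and c: "c \<in> charts_at A p" and d: "d \<in> charts_at B (f p)"
  shows "(lrep f c d has_derivative lderiv f c d p) (at (snd c p))"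
  using smooth_on_has_derivative[OF smooth_map_ldom(2)[OF A B f]] c d
  by (simp add: lderiv_def charts_at_iff snd_in_ldom)

lemma lderiv_linear:
  "atlas A \<Longrightarrow> atlas B \<Longrightarrow> smooth_map A B f \<Longrightarrow> c \<in> charts_at A p \<Longrightarrow> d \<in> charts_at B (f p) \<Longrightarrow>
    linear (lderiv f c d p)"
  by (rule has_derivative_linear[OF lderiv_has_derivative])

lemma lderiv_compose:
  assumes A: "atlas A" and B: "atlas B" and C: "atlas C"
    and f: "smooth_map A B f" and g: "smooth_map B C g"
    and c: "c \<in> charts_at A p" and d: "d \<in> charts_at B (f p)" and e: "e \<in> charts_at C (g (f p))"
  shows "lderiv (g \<circ> f) c e p x = lderiv g d e (f p) (lderiv f c d p x)"
proof -
  have c': "c \<in> A" "p \<in> fst c" and d': "d \<in> B" "f p \<in> fst d" and e': "e \<in> C" "g (f p) \<in> fst e"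
    using c d e by (simp_all add: charts_at_iff)
  note R = lrep_compose_domain[OF A B c'(1) d'(1) smooth_map_ldom(1)[OF A B f c'(1) d'(1)] order_refl
      smooth_map_ldom(2)[OF A B f c'(1) d'(1)] smooth_map_ldom(1)[OF B C g d'(1) e'(1)] order_refl
      smooth_map_ldom(2)[OF B C g d'(1) e'(1)]]
  have x: "snd c p \<in> ldom f c d \<inter> lrep f c d -` ldom g d e"
    using c' d' e' by (auto simp: lrep_snd[OF A] snd_in_ldom)
  have "((\<lambda>x. lrep g d e (lrep f c d x)) has_derivative
      (\<lambda>x. lderiv g d e (f p) (lderiv f c d p x))) (at (snd c p))"
    using lderiv_has_derivative[OF B C g d e] c'
    by (intro has_derivative_compose[OF lderiv_has_derivative[OF A B f c d]]) (simp add: lrep_snd[OF A])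
  then have "(lrep (g \<circ> f) c e has_derivative (\<lambda>x. lderiv g d e (f p) (lderiv f c d p x))) (at (snd c p))"
    by (rule has_derivative_transform_within_open[OF _ R(1) x]) (simp add: R(3))
  then show ?thesis unfolding lderiv_def[of "g \<circ> f"] by (metis frechet_derivative_at)
qed

lemma lderiv_cong:
  assumes A: "atlas A" and B: "atlas B" and eq: "\<And>q. q \<in> points A \<Longrightarrow> f q = g q" and f: "smooth_map A B f"
    and c: "c \<in> charts_at A p" and d: "d \<in> charts_at B (f p)"
  shows "lderiv g c d p = lderiv f c d p"
proof -
  have c': "c \<in> A" "p \<in> fst c" using c by (simp_all add: charts_at_iff)
  have "(lrep g c d has_derivative lderiv f c d p) (at (snd c p))"
    by (rule has_derivative_transform_within_open[OF lderiv_has_derivative[OF A B f c d]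
          atlas_open[OF A c'(1)]]) (use c' eq lrep_cong[where f = f and g = g and d = d and c = c, OF _ c'(1)] in auto)
  then show ?thesis unfolding lderiv_def[of g] by (metis frechet_derivative_at)
qed

lemma lderiv_id:
  assumes A: "atlas A" and c: "c \<in> charts_at A p"
  shows "lderiv id c c p = (\<lambda>x. x)"
proof -
  have c': "c \<in> A" "p \<in> fst c" using c by (simp_all add: charts_at_iff)
  have "(lrep id c c has_derivative (\<lambda>x. x)) (at (snd c p))"
    by (rule has_derivative_transform_within_open[OF has_derivative_ident atlas_open[OF A c'(1)]])
      (use c' in \<open>auto simp: lrep_def snd_chart_inv\<close>)
  then show ?thesis unfolding lderiv_def by (metis frechet_derivative_at)
qed

section \<open>Tangent vectors and their coordinates\<close>

lemma tangent_space_iff: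
  "v \<in> tangent_space A p \<longleftrightarrow>
     (\<forall>c\<in>charts_at A p. \<forall>d\<in>charts_at A p. v d = lderiv id c d p (v c)) \<and> (\<forall>c. c \<notin> charts_at A p \<longrightarrow> v c = 0)"
  by (simp add: tangent_space_def lderiv_def lrep_def)

lemma tangent_space_transition:
  "v \<in> tangent_space A p \<Longrightarrow> c \<in> charts_at A p \<Longrightarrow> d \<in> charts_at A p \<Longrightarrow> lderiv id c d p (v c) = v d"
  unfolding tangent_space_iff by (rule sym) blast

lemma tangent_space_outside: "v \<in> tangent_space A p \<Longrightarrow> c \<notin> charts_at A p \<Longrightarrow> v c = 0"
  unfolding tangent_space_iff by blast

lemma tangent_spaceI:
  assumes "\<And>c d. c \<in> charts_at A p \<Longrightarrow> d \<in> charts_at A p \<Longrightarrow> lderiv id c d p (v c) = v d"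
    and "\<And>c. c \<notin> charts_at A p \<Longrightarrow> v c = 0"
  shows "v \<in> tangent_space A p"
  unfolding tangent_space_iff using assms by simp

lemma tvec_of_eq: "tvec_of A p c x = (\<lambda>d. if d \<in> charts_at A p then lderiv id c d p x else 0)"
  by (rule ext) (simp add: tvec_of_def lderiv_def lrep_def)

text \<open>The transformation law is the chain rule for \<open>id \<circ> id\<close> through the
  chart \<open>d\<close>.\<close>

lemma tvec_of_tangent:
  assumes A: "atlas A" and c: "c \<in> charts_at A p"
  shows "tvec_of A p c x \<in> tangent_space A p"
proof (rule tangent_spaceI)
  fix d d' assume "d \<in> charts_at A p" "d' \<in> charts_at A p"
  then show "lderiv id d d' p (tvec_of A p c x d) = tvec_of A p c x d'"
    using lderiv_compose[OF A A A smooth_map_id[OF A] smooth_map_id[OF A] c, of d d' x]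
    by (simp add: tvec_of_eq)
qed (simp add: tvec_of_eq)

lemma tvec_of_same: "atlas A \<Longrightarrow> c \<in> charts_at A p \<Longrightarrow> tvec_of A p c x c = x"
  by (simp add: tvec_of_eq lderiv_id)

lemma tangent_space_eqI:
  assumes "v \<in> tangent_space A p" "w \<in> tangent_space A p" "c \<in> charts_at A p" "v c = w c"
  shows "v = w"
proof
  fix d show "v d = w d"
  proof (cases "d \<in> charts_at A p")
    case True
    then show ?thesis using tangent_space_transition[OF _ assms(3) True] assms(1,2,4) by metis
  next
    case False
    then show ?thesis using assms(1,2) by (simp add: tangent_space_outside)
  qed
qed

lemma tvec_of_coord:
  "atlas A \<Longrightarrow> c \<in> charts_at A p \<Longrightarrow> v \<in> tangent_space A p \<Longrightarrow> tvec_of A p c (v c) = v"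
  by (rule tangent_space_eqI[of _ A p _ c]) (simp_all add: tvec_of_tangent tvec_of_same)

context
  fixes A :: "('a, 'e::euclidean_space) chart set" and p :: 'a
  assumes A: "atlas A"
begin

lemma tangent_space_0: "0 \<in> tangent_space A p"
  by (rule tangent_spaceI) (simp_all add: linear_0[OF lderiv_linear[OF A A smooth_map_id[OF A]]])

lemma tangent_space_add: "v \<in> tangent_space A p \<Longrightarrow> w \<in> tangent_space A p \<Longrightarrow> v + w \<in> tangent_space A p"
  by (rule tangent_spaceI)
    (simp_all add: linear_add[OF lderiv_linear[OF A A smooth_map_id[OF A]]] tangent_space_transition
      tangent_space_outside)

lemma tangent_space_scale: "v \<in> tangent_space A p \<Longrightarrow> a \<cdot>\<^sub>t v \<in> tangent_space A p"
  by (rule tangent_spaceI)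
    (simp_all add: linear_scale[OF lderiv_linear[OF A A smooth_map_id[OF A]]] tangent_space_transition
      tangent_space_outside tscale_def)

end

lemma tscale_apply: "(a \<cdot>\<^sub>t v) c = a *\<^sub>R v c"
  by (simp add: tscale_def)

text \<open>The rules for connections and metrics speak of sums and multiples only; differences are
  brought into that form.\<close>

lemma tvec_diff: "v - w = v + (-1) \<cdot>\<^sub>t (w :: ('a, 'e::euclidean_space) tvec)"
  by (auto simp: tscale_def)

lemma tangent_space_diff:
  "atlas A \<Longrightarrow> v \<in> tangent_space A p \<Longrightarrow> w \<in> tangent_space A p \<Longrightarrow> v - w \<in> tangent_space A p"
  by (simp add: tvec_diff tangent_space_add tangent_space_scale)

text \<open>The chart that \<open>differential\<close> picks by \<open>SOME\<close> is replaced by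
  an arbitrary one: \<open>v\<close> transforms by the change of charts, and the chain rule for
  \<open>f \<circ> id\<close> absorbs it.\<close>

lemma differential_apply:
  assumes A: "atlas A" and B: "atlas B" and f: "smooth_map A B f" and v: "v \<in> tangent_space A p"
    and c: "c \<in> charts_at A p" and d: "d \<in> charts_at B (f p)"
  shows "differential A B f p v d = lderiv f c d p (v c)"
proof -
  define c0 where "c0 = (SOME c. c \<in> charts_at A p)"
  have c0: "c0 \<in> charts_at A p" unfolding c0_def using c by (rule someI)
  have "differential A B f p v d = lderiv f c0 d p (v c0)"
    using d by (simp add: differential_def Let_def c0_def lderiv_def lrep_def)
  also have "v c0 = lderiv id c c0 p (v c)" using v c c0 by (simp add: tangent_space_transition)
  also have "lderiv f c0 d p \<dots> = lderiv (f \<circ> id) c d p (v c)"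
    using lderiv_compose[OF A A B smooth_map_id[OF A] f c, of c0 d] c0 d by simp
  finally show ?thesis by simp
qed

lemma differential_outside: "d \<notin> charts_at B (f p) \<Longrightarrow> differential A B f p v d = 0"
  by (simp add: differential_def Let_def)

lemma differential_tangent:
  assumes A: "atlas A" and B: "atlas B" and f: "smooth_map A B f" and v: "v \<in> tangent_space A p"
    and p: "p \<in> points A"
  shows "differential A B f p v \<in> tangent_space B (f p)"
proof -
  obtain c where c: "c \<in> charts_at A p" using charts_at_nonempty[OF p] by auto
  have "lderiv id d d' (f p) (lderiv f c d p (v c)) = lderiv f c d' p (v c)"
    if "d \<in> charts_at B (f p)" "d' \<in> charts_at B (f p)" for d d'
    using lderiv_compose[OF A B B f smooth_map_id[OF B] c, of d d'] that by simp
  then show ?thesis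
    by (intro tangent_spaceI) (simp_all add: differential_outside differential_apply[OF A B f v c])
qed

lemma differential_compose:
  assumes A: "atlas A" and B: "atlas B" and C: "atlas C"
    and f: "smooth_map A B f" and g: "smooth_map B C g" and p: "p \<in> points A" and v: "v \<in> tangent_space A p"
  shows "differential A C (g \<circ> f) p v = differential B C g (f p) (differential A B f p v)"
proof
  fix e
  obtain c where c: "c \<in> charts_at A p" using charts_at_nonempty[OF p] by auto
  obtain d where d: "d \<in> charts_at B (f p)"
    using charts_at_nonempty[OF smooth_map_points[OF A B f p]] by auto
  show "differential A C (g \<circ> f) p v e = differential B C g (f p) (differential A B f p v) e"
  proof (cases "e \<in> charts_at C (g (f p))")
    case True
    then show ?thesis
      by (simp add: differential_apply[OF A C smooth_map_compose[OF A B C f g] v c]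
          differential_apply[OF B C g differential_tangent[OF A B f v p] d]
          differential_apply[OF A B f v c d] lderiv_compose[OF A B C f g c d])
  qed (simp add: differential_outside)
qed

lemma differential_cong:
  assumes A: "atlas A" and B: "atlas B" and eq: "\<And>q. q \<in> points A \<Longrightarrow> f q = g q" and f: "smooth_map A B f"
    and p: "p \<in> points A" and v: "v \<in> tangent_space A p"
  shows "differential A B g p v = differential A B f p v"
proof
  fix d
  obtain c where c: "c \<in> charts_at A p" using charts_at_nonempty[OF p] by auto
  show "differential A B g p v d = differential A B f p v d"
  proof (cases "d \<in> charts_at B (f p)")
    case True
    then show ?thesis
      using eq[OF p] differential_apply[OF A B f v c] lderiv_cong[OF A B eq f c]
        differential_apply[OF A B smooth_map_cong[OF A B eq f] v c] by simp
  qed (use eq[OF p] in \<open>simp add: differential_outside\<close>)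
qed

lemma differential_id:
  assumes A: "atlas A" and p: "p \<in> points A" and v: "v \<in> tangent_space A p"
  shows "differential A A id p v = v"
proof -
  obtain c where c: "c \<in> charts_at A p" using charts_at_nonempty[OF p] by auto
  show ?thesis
    using differential_tangent[OF A A smooth_map_id[OF A] v p]
      differential_apply[OF A A smooth_map_id[OF A] v c, of c]
    by (intro tangent_space_eqI[of _ A p _ c] v c) (simp_all add: c lderiv_id[OF A])
qed

lemma differential_add:
  assumes A: "atlas A" and B: "atlas B" and f: "smooth_map A B f" and p: "p \<in> points A"
    and v: "v \<in> tangent_space A p" and w: "w \<in> tangent_space A p"
  shows "differential A B f p (v + w) = differential A B f p v + differential A B f p w"
proof
  fix d
  obtain c where c: "c \<in> charts_at A p" using charts_at_nonempty[OF p] by auto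
  show "differential A B f p (v + w) d = (differential A B f p v + differential A B f p w) d"
    by (cases "d \<in> charts_at B (f p)")
      (simp_all add: differential_outside differential_apply[OF A B f _ c] tangent_space_add[OF A] v w
        linear_add[OF lderiv_linear[OF A B f c]])
qed

lemma differential_scale:
  assumes A: "atlas A" and B: "atlas B" and f: "smooth_map A B f" and p: "p \<in> points A"
    and v: "v \<in> tangent_space A p"
  shows "differential A B f p (a \<cdot>\<^sub>t v) = a \<cdot>\<^sub>t differential A B f p v"
proof
  fix d
  obtain c where c: "c \<in> charts_at A p" using charts_at_nonempty[OF p] by auto
  show "differential A B f p (a \<cdot>\<^sub>t v) d = (a \<cdot>\<^sub>t differential A B f p v) d"
    by (cases "d \<in> charts_at B (f p)")
      (simp_all add: differential_outside differential_apply[OF A B f _ c] tangent_space_scale[OF A] v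
        linear_scale[OF lderiv_linear[OF A B f c]] tscale_apply)
qed

section \<open>The tangent bundle and pull-back bundles\<close>

lemma diffeomorphismI:
  assumes A: "atlas A" and B: "atlas B" and f: "smooth_map A B f" and g: "smooth_map B A g"
    and gf: "\<And>p. p \<in> points A \<Longrightarrow> g (f p) = p" and fg: "\<And>q. q \<in> points B \<Longrightarrow> f (g q) = q"
  shows "diffeomorphism A B f"
proof -
  have bij: "bij_betw f (points A) (points B)"
    by (rule bij_betw_byWitness[where f' = g])
      (use gf fg smooth_map_points[OF A B f] smooth_map_points[OF B A g] in auto)
  have "inv_into (points A) f q = g q" if "q \<in> points B" for q
    using that by (intro inv_into_f_eq bij_betw_imp_inj_on[OF bij] fg smooth_map_points[OF B A g])
  then have "smooth_map B A (inv_into (points A) f)"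
    by (intro smooth_map_cong[OF B A _ g]) simp
  then show ?thesis using bij f by (simp add: diffeomorphism_def)
qed

lemma diffeomorphism_inverse:
  assumes A: "atlas A" and B: "atlas B" and f: "diffeomorphism A B f"
  obtains g where "smooth_map B A g" "\<And>p. p \<in> points A \<Longrightarrow> g (f p) = p" "\<And>q. q \<in> points B \<Longrightarrow> f (g q) = q"
proof (rule that)
  have bij: "bij_betw f (points A) (points B)" using f by (simp add: diffeomorphism_def)
  show "smooth_map B A (inv_into (points A) f)" using f by (simp add: diffeomorphism_def)
  show "inv_into (points A) f (f p) = p" if "p \<in> points A" for p
    using bij_betw_inv_into_left[OF bij that] .
  show "f (inv_into (points A) f q) = q" if "q \<in> points B" for q
    using bij_betw_inv_into_right[OF bij that] .
qed

text \<open>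
  The charts of the pull-back bundle \<open>f\<^sup>*TM\<close>; those with \<open>f = id\<close> and \<open>c = d\<close> are the charts
  of the tangent bundle itself.
\<close>

definition bchart ::
  "('a, 'e::euclidean_space) chart set \<Rightarrow> ('a \<Rightarrow> 'a) \<Rightarrow> ('a, 'e) chart \<Rightarrow> ('a, 'e) chart \<Rightarrow>
   (('a, 'e) tpoint, 'e \<times> 'e) chart" where
  "bchart A f c d = ({(p, v). p \<in> fst c \<and> f p \<in> fst d \<and> v \<in> tangent_space A (f p)}, \<lambda>(p, v). (snd c p, v d))"

text \<open>The index set makes both atlases of the theorem instances: the diagonal for the tangent
  bundle, all pairs of charts for the pull-back bundle.\<close>

definition bundle_atlas ::
  "('a, 'e::euclidean_space) chart set \<Rightarrow> ('a \<Rightarrow> 'a) \<Rightarrow> (('a, 'e) chart \<times> ('a, 'e) chart) set \<Rightarrow>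
   (('a, 'e) tpoint, 'e \<times> 'e) chart set" where
  "bundle_atlas A f I = (\<lambda>(c, d). bchart A f c d) ` I"

text \<open>A map over \<open>k\<close> from the pull-back of the tangent bundle by \<open>f\<close>
  to its pull-back by \<open>f'\<close>, given by \<open>dh\<close> on fibres; it lands there if
  \<open>h \<circ> f = f' \<circ> k\<close> on points. For \<open>f = f' = id\<close> and
  \<open>k = h\<close> it is the tangent map of \<open>h\<close>, for \<open>k = id\<close> it is a
  map over the base, and for \<open>k = h = id\<close> it is the identity.\<close>

definition bundle_map ::
  "('a, 'e::euclidean_space) chart set \<Rightarrow> ('a \<Rightarrow> 'a) \<Rightarrow> ('a \<Rightarrow> 'a) \<Rightarrow> ('a \<Rightarrow> 'a) \<Rightarrow> ('a, 'e) tpoint \<Rightarrow> ('a, 'e) tpoint"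
  where "bundle_map A f k h u = (k (fst u), differential A A h (f (fst u)) (snd u))"

lemma in_bchart: "u \<in> fst (bchart A f c d) \<longleftrightarrow> fst u \<in> fst c \<and> f (fst u) \<in> fst d \<and> snd u \<in> tangent_space A (f (fst u))"
  and snd_bchart: "snd (bchart A f c d) u = (snd c (fst u), snd u d)"
  by (simp_all add: bchart_def case_prod_beta)

section \<open>Bundle maps in coordinates and the resulting atlases\<close>

context
  fixes A :: "('a, 'e::euclidean_space) chart set"
  assumes A: "atlas A"
begin

lemma bchart_inj:
  assumes "c \<in> A" "d \<in> A"
  shows "inj_on (snd (bchart A f c d)) (fst (bchart A f c d))"
proof (rule inj_onI)
  fix u w
  assume u: "u \<in> fst (bchart A f c d)" and w: "w \<in> fst (bchart A f c d)"
    and eq: "snd (bchart A f c d) u = snd (bchart A f c d) w"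
  have p: "fst u = fst w"
    using u w eq atlas_inj[OF A assms(1)] by (auto simp: in_bchart snd_bchart inj_on_def)
  have "d \<in> charts_at A (f (fst u))" using u assms by (simp add: in_bchart charts_at_iff)
  then have "snd u = snd w"
    using u w eq p by (intro tangent_space_eqI[of "snd u" A "f (fst u)"]) (auto simp: in_bchart snd_bchart)
  with p show "u = w" by (simp add: prod_eq_iff)
qed

lemma bchart_image:
  assumes "c \<in> A" "d \<in> A"
  shows "snd (bchart A f c d) ` fst (bchart A f c d) = ldom f c d \<times> UNIV"
proof (intro equalityI subsetI)
  fix z assume "z \<in> snd (bchart A f c d) ` fst (bchart A f c d)"
  then show "z \<in> ldom f c d \<times> UNIV" by (auto simp: in_bchart snd_bchart ldom_def)
next
  fix z assume "z \<in> ldom f c d \<times> (UNIV :: 'e set)"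
  then obtain p where p: "p \<in> fst c" "f p \<in> fst d" "fst z = snd c p" by (auto simp: ldom_def)
  then have d: "d \<in> charts_at A (f p)" using assms by (simp add: charts_at_iff)
  have "z = snd (bchart A f c d) (p, tvec_of A (f p) d (snd z))"
    using p(3) by (simp add: snd_bchart tvec_of_same[OF A d] prod_eq_iff)
  moreover have "(p, tvec_of A (f p) d (snd z)) \<in> fst (bchart A f c d)"
    using p by (simp add: in_bchart tvec_of_tangent[OF A d])
  ultimately show "z \<in> snd (bchart A f c d) ` fst (bchart A f c d)" by blast
qed

lemma bchart_inv:
  assumes "c \<in> A" "d \<in> A" "x \<in> ldom f c d"
  shows "chart_inv (bchart A f c d) (x, y) = (chart_inv c x, tvec_of A (f (chart_inv c x)) d y)" (is "_ = ?u")
proof -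
  have x: "x \<in> snd c ` fst c" "f (chart_inv c x) \<in> fst d"
    using assms by (simp_all add: ldom_iff[OF A])
  then have d: "d \<in> charts_at A (f (chart_inv c x))" using assms by (simp add: charts_at_iff)
  have "?u \<in> fst (bchart A f c d)"
    using x by (simp add: in_bchart chart_inv_in tvec_of_tangent[OF A d])
  moreover have "snd (bchart A f c d) ?u = (x, y)"
    using x by (simp add: snd_bchart snd_chart_inv tvec_of_same[OF A d])
  ultimately show ?thesis
    unfolding chart_inv_def[of "bchart A f c d"] using inv_into_f_eq[OF bchart_inj[OF assms(1,2)]] by metis
qed

text \<open>In coordinates the map is (x, y) -> (k x, Dh (f x) y), with \<open>k\<close>,
  \<open>f\<close>, \<open>h\<close> standing for their own expressions; smoothness in both
  variables together is \<open>smooth_on_derivative_apply\<close>. The condition \<open>comm\<close>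
  puts the image vector into the fibre of the target.\<close>

lemma bundle_map_chart:
  assumes f: "smooth_map A A f" and k: "smooth_map A A k" and h: "smooth_map A A h"
    and comm: "\<And>p. p \<in> points A \<Longrightarrow> h (f p) = f' (k p)"
    and c: "c \<in> A" "d \<in> A" "c' \<in> A" "d' \<in> A"
  defines "C \<equiv> bchart A f c d" and "D \<equiv> bchart A f' c' d'"
  shows "open (ldom (bundle_map A f k h) C D)"
    and "smooth_on (ldom (bundle_map A f k h) C D) (lrep (bundle_map A f k h) C D)"
proof -
  \<comment> \<open>All conditions for the image to lie in \<open>D\<close> concern the base point;
    the fibre coordinate is unrestricted, so the domain will be
    \<open>R \<times> UNIV\<close>.\<close>
  define R where "R = ldom k c c' \<inter> (ldom f c d \<inter> lrep f c d -` ldom h d d')"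
  have oR: "open R" unfolding R_def
    by (intro open_Int continuous_open_preimage smooth_on_continuous smooth_map_ldom[OF A A] f k h c)
  have RK: "x \<in> R \<Longrightarrow> x \<in> ldom f c d" for x by (simp add: R_def)
  have img: "z \<in> snd C ` fst C \<longleftrightarrow> fst z \<in> ldom f c d" for z
    unfolding C_def bchart_image[OF c(1,2)] by (auto simp: mem_Times_iff)
  have inv: "chart_inv C z = (chart_inv c (fst z), tvec_of A (f (chart_inv c (fst z))) d (snd z))"
    if "fst z \<in> ldom f c d" for z
    using bchart_inv[OF c(1,2) that, of "snd z"] by (simp add: C_def)
  have at: "d \<in> charts_at A (f (chart_inv c x)) \<and> chart_inv c x \<in> points A \<and> chart_inv c x \<in> fst c"
    if "x \<in> ldom f c d" for x
  proof -
    have "chart_inv c x \<in> fst c" "f (chart_inv c x) \<in> fst d"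
      using that c by (simp_all add: ldom_iff[OF A] chart_inv_in)
    then show ?thesis using c by (auto simp: charts_at_iff points_def)
  qed
  have R_iff: "x \<in> R \<longleftrightarrow> x \<in> ldom f c d \<and> k (chart_inv c x) \<in> fst c' \<and> h (f (chart_inv c x)) \<in> fst d'" for x
    unfolding R_def
    by (auto simp: ldom_iff[OF A] c lrep_def chart_inv_snd[OF A c(2)])
  have "z \<in> ldom (bundle_map A f k h) C D \<longleftrightarrow> fst z \<in> R" for z
  proof -
    have "z \<in> ldom (bundle_map A f k h) C D \<longleftrightarrow>
        z \<in> snd C ` fst C \<and> bundle_map A f k h (chart_inv C z) \<in> fst D"
    proof -
      have "chart_inv C (snd C u) = u" if "u \<in> fst C" for u
        using that bchart_inj[OF c(1,2)] by (simp add: chart_inv_def C_def)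
      then show ?thesis unfolding ldom_def by (auto simp: snd_chart_inv chart_inv_in)
    qed
    also have "\<dots> \<longleftrightarrow> fst z \<in> R"
    proof (cases "fst z \<in> ldom f c d")
      case True
      then show ?thesis
        using at[OF True] comm[of "chart_inv c (fst z)"]
          differential_tangent[OF A A h tvec_of_tangent[OF A, of d "f (chart_inv c (fst z))" "snd z"]]
          smooth_map_points[OF A A f]
        by (simp add: img inv[OF True] R_iff D_def in_bchart bundle_map_def)
    qed (simp add: img R_iff)
    finally show ?thesis .
  qed
  then have dom: "ldom (bundle_map A f k h) C D = R \<times> UNIV" by (auto simp: mem_Times_iff)
  then show "open (ldom (bundle_map A f k h) C D)" using oR by (simp add: open_Times)
  have o: "open (R \<times> (UNIV :: 'e set))" using oR by (simp add: open_Times)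
  have rep: "lrep (bundle_map A f k h) C D z =
      (lrep k c c' (fst z), frechet_derivative (lrep h d d') (at (lrep f c d (fst z))) (snd z))"
    if "z \<in> R \<times> UNIV" for z
  proof -
    have z: "fst z \<in> R" using that by auto
    note a = at[OF RK[OF z]]
    have d': "d' \<in> charts_at A (h (f (chart_inv c (fst z))))"
      using z c by (simp add: R_iff charts_at_iff)
    have "differential A A h (f (chart_inv c (fst z))) (tvec_of A (f (chart_inv c (fst z))) d (snd z)) d'
        = lderiv h d d' (f (chart_inv c (fst z))) (snd z)"
      using a d' by (simp add: differential_apply[OF A A h tvec_of_tangent[OF A, of d] _ d', of d] tvec_of_same[OF A])
    then show ?thesis
      by (simp add: lrep_def[of "bundle_map A f k h"] inv[OF RK[OF z]] bundle_map_def D_def snd_bchart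
          lderiv_def lrep_def)
  qed
  have k_smooth: "smooth_on (R \<times> (UNIV :: 'e set)) (\<lambda>z. lrep k c c' (fst z))"
    by (rule smooth_on_compose[OF o smooth_on_bounded_linear[OF o bounded_linear_fst] smooth_map_ldom(2)[OF A A k c(1,3)]])
      (auto simp: R_def)
  have f_smooth: "smooth_on (R \<times> (UNIV :: 'e set)) (\<lambda>z. lrep f c d (fst z))"
    by (rule smooth_on_compose[OF o smooth_on_bounded_linear[OF o bounded_linear_fst] smooth_map_ldom(2)[OF A A f c(1,2)]])
      (auto simp: R_def)
  have "smooth_on (R \<times> UNIV)
      (\<lambda>z. (lrep k c c' (fst z), frechet_derivative (lrep h d d') (at (lrep f c d (fst z))) (snd z)))"
    by (rule smooth_on_Pair[OF o k_smooth smooth_on_derivative_apply[OF o f_smooth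
            smooth_on_bounded_linear[OF o bounded_linear_snd] smooth_map_ldom(2)[OF A A h c(2,4)]]])
      (auto simp: R_def)
  then show "smooth_on (ldom (bundle_map A f k h) C D) (lrep (bundle_map A f k h) C D)"
    unfolding dom using rep smooth_on_cong[OF o, of "lrep (bundle_map A f k h) C D"
        "\<lambda>z. (lrep k c c' (fst z), frechet_derivative (lrep h d d') (at (lrep f c d (fst z))) (snd z))"] by simp
qed

text \<open>A change of bundle charts is the coordinate expression of the bundle map with
  \<open>k = h = id\<close>, which fixes every point of a bundle chart because the differential of
  the identity is the identity.\<close>

lemma atlas_bundle_atlas:
  assumes f: "smooth_map A A f" and I: "I \<subseteq> A \<times> A"
  shows "atlas (bundle_atlas A f I)"
proof -
  have trans: "open (snd C ` (fst C \<inter> fst D)) \<and> smooth_on (snd C ` (fst C \<inter> fst D)) (snd D \<circ> chart_inv C)"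
    if C: "C = bchart A f c d" "(c, d) \<in> I" and D: "D = bchart A f c' d'" "(c', d') \<in> I" for C D c d c' d'
  proof -
    have c: "c \<in> A" "d \<in> A" "c' \<in> A" "d' \<in> A" using C D I by auto
    note * = bundle_map_chart[OF f smooth_map_id[OF A] smooth_map_id[OF A] _ c, of f, simplified, folded C(1) D(1)]
    have id: "bundle_map A f id id u = u" if "u \<in> fst C" for u
    proof -
      have "f (fst u) \<in> points A" "snd u \<in> tangent_space A (f (fst u))"
        using that c by (auto simp: C in_bchart points_def)
      then show ?thesis by (simp add: bundle_map_def differential_id[OF A])
    qed
    have eq: "ldom (bundle_map A f id id) C D = snd C ` (fst C \<inter> fst D)"
      using id by (force simp: ldom_def)
    have "(snd D \<circ> chart_inv C) z = lrep (bundle_map A f id id) C D z" if "z \<in> snd C ` (fst C \<inter> fst D)" for z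
      using that by (simp add: lrep_def id chart_inv_in image_iff) (metis IntD1 chart_inv_in id imageI)
    then show ?thesis
      using * smooth_on_cong[of "snd C ` (fst C \<inter> fst D)" "snd D \<circ> chart_inv C" "lrep (bundle_map A f id id) C D"]
      by (simp add: eq)
  qed
  show ?thesis
    unfolding atlas_def
  proof (intro conjI ballI)
    fix C assume "C \<in> bundle_atlas A f I"
    then obtain c d where C: "C = bchart A f c d" "(c, d) \<in> I" by (auto simp: bundle_atlas_def)
    then have c: "c \<in> A" "d \<in> A" using I by auto
    show "inj_on (snd C) (fst C)" unfolding C by (rule bchart_inj[OF c])
    show "open (snd C ` fst C)" using trans[OF C C] by simp
    fix D assume "D \<in> bundle_atlas A f I"
    then obtain c' d' where D: "D = bchart A f c' d'" "(c', d') \<in> I" by (auto simp: bundle_atlas_def)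
    show "open (snd C ` (fst C \<inter> fst D))" "smooth_on (snd C ` (fst C \<inter> fst D)) (snd D \<circ> chart_inv C)"
      using trans[OF C D] by simp_all
  qed
qed

lemma points_bundle_atlas:
  assumes "I \<subseteq> A \<times> A" "\<And>p. p \<in> points A \<Longrightarrow> \<exists>(c, d)\<in>I. p \<in> fst c \<and> f p \<in> fst d"
  shows "u \<in> points (bundle_atlas A f I) \<longleftrightarrow> fst u \<in> points A \<and> snd u \<in> tangent_space A (f (fst u))"
proof
  assume "u \<in> points (bundle_atlas A f I)"
  then obtain c d where "(c, d) \<in> I" "u \<in> fst (bchart A f c d)"
    by (auto simp: points_def bundle_atlas_def)
  then show "fst u \<in> points A \<and> snd u \<in> tangent_space A (f (fst u))"
    using assms(1) by (auto simp: in_bchart points_def)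
next
  assume u: "fst u \<in> points A \<and> snd u \<in> tangent_space A (f (fst u))"
  then obtain c d where "(c, d) \<in> I" "fst u \<in> fst c" "f (fst u) \<in> fst d" using assms(2) by blast
  then have "u \<in> fst (bchart A f c d)" "bchart A f c d \<in> bundle_atlas A f I"
    using u by (auto simp: in_bchart bundle_atlas_def)
  then show "u \<in> points (bundle_atlas A f I)" unfolding points_def by blast
qed

lemma smooth_bundle_map:
  assumes f: "smooth_map A A f" and f': "smooth_map A A f'"
    and k: "smooth_map A A k" and h: "smooth_map A A h"
    and comm: "\<And>p. p \<in> points A \<Longrightarrow> h (f p) = f' (k p)"
    and I: "I \<subseteq> A \<times> A" and J: "J \<subseteq> A \<times> A"
    and I': "\<And>p. p \<in> points A \<Longrightarrow> \<exists>(c, d)\<in>I. p \<in> fst c \<and> f p \<in> fst d"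
    and J': "\<And>p. p \<in> points A \<Longrightarrow> \<exists>(c, d)\<in>J. p \<in> fst c \<and> f' p \<in> fst d"
  shows "smooth_map (bundle_atlas A f I) (bundle_atlas A f' J) (bundle_map A f k h)"
  unfolding smooth_map_iff[OF atlas_bundle_atlas[OF f I] atlas_bundle_atlas[OF f' J]]
proof (intro conjI ballI funcsetI)
  fix u assume "u \<in> points (bundle_atlas A f I)"
  then have u: "fst u \<in> points A" "snd u \<in> tangent_space A (f (fst u))"
    using points_bundle_atlas[OF I I'] by auto
  then show "bundle_map A f k h u \<in> points (bundle_atlas A f' J)"
    using points_bundle_atlas[OF J J'] smooth_map_points[OF A A] f k comm
      differential_tangent[OF A A h u(2)] by (simp add: bundle_map_def)
next
  fix C D assume "C \<in> bundle_atlas A f I" "D \<in> bundle_atlas A f' J"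
  then obtain c d c' d' where "C = bchart A f c d" "D = bchart A f' c' d'" "(c, d) \<in> I" "(c', d') \<in> J"
    by (auto simp: bundle_atlas_def)
  then show "open (ldom (bundle_map A f k h) C D)"
    "smooth_on (ldom (bundle_map A f k h) C D) (lrep (bundle_map A f k h) C D)"
    using bundle_map_chart[OF f k h comm, of c d c' d'] I J by auto
qed

section \<open>The tangent bundle and the pull-back bundle as instances\<close>

abbreviation "diagonal \<equiv> (\<lambda>c. (c, c)) ` A"

lemma tangent_atlas_eq: "tangent_atlas A = bundle_atlas A id diagonal"
  unfolding tangent_atlas_def bundle_atlas_def bchart_def by (simp only: image_image Setcompr_eq_image prod.case id_apply conj_left_absorb)

lemma pullback_tangent_atlas_eq: "pullback_tangent_atlas A f = bundle_atlas A f (A \<times> A)"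
proof -
  have "{F c d |c d. c \<in> X \<and> d \<in> X} = (\<lambda>(c, d). F c d) ` (X \<times> X)" for F :: "'x \<Rightarrow> 'x \<Rightarrow> 'y" and X
    by auto
  then show ?thesis unfolding pullback_tangent_atlas_def bundle_atlas_def bchart_def .
qed

lemma diagonal_cover: "p \<in> points A \<Longrightarrow> \<exists>(c, d)\<in>diagonal. p \<in> fst c \<and> id p \<in> fst d"
  by (auto simp: points_def)

lemma product_cover:
  assumes "smooth_map A A f" "p \<in> points A"
  shows "\<exists>(c, d)\<in>A \<times> A. p \<in> fst c \<and> f p \<in> fst d"
  using assms(2) smooth_map_points[OF A A assms] by (auto simp: points_def)

lemma atlas_tangent_atlas: "atlas (tangent_atlas A)"
  unfolding tangent_atlas_eq by (rule atlas_bundle_atlas[OF smooth_map_id[OF A]]) auto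

lemma points_tangent_atlas:
  "u \<in> points (tangent_atlas A) \<longleftrightarrow> fst u \<in> points A \<and> snd u \<in> tangent_space A (fst u)"
  unfolding tangent_atlas_eq by (subst points_bundle_atlas) (auto simp: points_def)

lemma atlas_pullback_tangent_atlas: "smooth_map A A f \<Longrightarrow> atlas (pullback_tangent_atlas A f)"
  unfolding pullback_tangent_atlas_eq by (rule atlas_bundle_atlas) auto

lemma points_pullback_tangent_atlas:
  "smooth_map A A f \<Longrightarrow>
    u \<in> points (pullback_tangent_atlas A f) \<longleftrightarrow> fst u \<in> points A \<and> snd u \<in> tangent_space A (f (fst u))"
  unfolding pullback_tangent_atlas_eq by (intro points_bundle_atlas product_cover) auto

lemma smooth_tangent_map:
  assumes "smooth_map A A f"
  shows "smooth_map (tangent_atlas A) (tangent_atlas A) (tangent_map A f)"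
proof -
  have eq: "tangent_map A f = bundle_map A id f f" by (simp add: fun_eq_iff tangent_map_def bundle_map_def)
  show ?thesis unfolding eq tangent_atlas_eq
    by (rule smooth_bundle_map[OF smooth_map_id[OF A] smooth_map_id[OF A] assms assms _ _ _ diagonal_cover
          diagonal_cover]) auto
qed

section \<open>The bundle maps induced by a diffeomorphism\<close>

context
  fixes f :: "'a \<Rightarrow> 'a"
  assumes f: "diffeomorphism A A f"
begin

lemma diffeomorphism_differential_inverse:
  assumes g: "smooth_map A A g" "\<And>p. p \<in> points A \<Longrightarrow> g (f p) = p" "p \<in> points A"
    and v: "v \<in> tangent_space A p"
  shows "differential A A g (f p) (differential A A f p v) = v"
proof -
  have fs: "smooth_map A A f" using f by (simp add: diffeomorphism_def)
  have "differential A A g (f p) (differential A A f p v) = differential A A (g \<circ> f) p v"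
    using differential_compose[OF A A A fs g(1,3) v] by simp
  also have "\<dots> = differential A A id p v"
    by (rule differential_cong[OF A A _ smooth_map_id[OF A] g(3) v]) (simp add: g(2))
  finally show ?thesis by (simp add: differential_id[OF A g(3) v])
qed

lemma diffeomorphism_differential_inverse':
  assumes g: "smooth_map A A g" "\<And>q. q \<in> points A \<Longrightarrow> f (g q) = q" "q \<in> points A"
    and v: "v \<in> tangent_space A q"
  shows "differential A A f (g q) (differential A A g q v) = v"
proof -
  have fs: "smooth_map A A f" using f by (simp add: diffeomorphism_def)
  have "differential A A f (g q) (differential A A g q v) = differential A A (f \<circ> g) q v"
    using differential_compose[OF A A A g(1) fs g(3) v] by simp
  also have "\<dots> = differential A A id q v"
    by (rule differential_cong[OF A A _ smooth_map_id[OF A] g(3) v]) (simp add: g(2))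
  finally show ?thesis by (simp add: differential_id[OF A g(3) v])
qed

lemma diffeomorphism_tangent_map: "diffeomorphism (tangent_atlas A) (tangent_atlas A) (tangent_map A f)"
proof -
  obtain g where g: "smooth_map A A g" "\<And>p. p \<in> points A \<Longrightarrow> g (f p) = p" "\<And>q. q \<in> points A \<Longrightarrow> f (g q) = q"
    using diffeomorphism_inverse[OF A A f] by blast
  have fs: "smooth_map A A f" using f by (simp add: diffeomorphism_def)
  show ?thesis
    by (rule diffeomorphismI[OF atlas_tangent_atlas atlas_tangent_atlas
          smooth_tangent_map[OF fs] smooth_tangent_map[OF g(1)]])
      (simp_all add: tangent_map_def points_tangent_atlas g(2,3)
        diffeomorphism_differential_inverse[OF g(1,2)] diffeomorphism_differential_inverse'[OF g(1,3)])
qed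

lemma vector_bundle_isomorphism_differential:
  "vector_bundle_isomorphism (tangent_atlas A) (pullback_tangent_atlas A f) (differential_bundle_map A f)"
proof -
  obtain g where g: "smooth_map A A g" "\<And>p. p \<in> points A \<Longrightarrow> g (f p) = p" "\<And>q. q \<in> points A \<Longrightarrow> f (g q) = q"
    using diffeomorphism_inverse[OF A A f] by blast
  have fs: "smooth_map A A f" using f by (simp add: diffeomorphism_def)
  have eq: "differential_bundle_map A f = bundle_map A id id f"
    by (simp add: fun_eq_iff differential_bundle_map_def bundle_map_def)
  have sm: "smooth_map (tangent_atlas A) (pullback_tangent_atlas A f) (differential_bundle_map A f)"
    unfolding eq tangent_atlas_eq pullback_tangent_atlas_eq
    by (rule smooth_bundle_map[OF smooth_map_id[OF A] fs smooth_map_id[OF A] fs _ _ _ diagonal_cover product_cover[OF fs]])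
      auto
  \<comment> \<open>The inverse of df over the identity of the base: a vector at \<open>f p\<close>
    is sent back to the fibre over \<open>p\<close> by \<open>dg\<close>. The compatibility
    condition is \<open>g (f p) = p\<close>.\<close>
  have "smooth_map (pullback_tangent_atlas A f) (tangent_atlas A) (bundle_map A f id g)"
    unfolding eq tangent_atlas_eq pullback_tangent_atlas_eq
    by (rule smooth_bundle_map[OF fs smooth_map_id[OF A] smooth_map_id[OF A] g(1) _ _ _ product_cover[OF fs] diagonal_cover])
      (auto simp: g(2))
  moreover have "differential A A f p (differential A A g (f p) v) = v"
    if "p \<in> points A" "v \<in> tangent_space A (f p)" for p v
    using diffeomorphism_differential_inverse'[OF g(1,3) smooth_map_points[OF A A fs that(1)] that(2)] that
    by (simp add: g(2))
  ultimately have "diffeomorphism (tangent_atlas A) (pullback_tangent_atlas A f) (differential_bundle_map A f)"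
    by (intro diffeomorphismI[OF atlas_tangent_atlas atlas_pullback_tangent_atlas[OF fs] sm,
          where g = "bundle_map A f id g"])
      (simp_all add: differential_bundle_map_def bundle_map_def points_tangent_atlas
        points_pullback_tangent_atlas[OF fs] diffeomorphism_differential_inverse[OF g(1,2)])
  then show ?thesis
    by (auto simp: vector_bundle_isomorphism_def differential_bundle_map_def points_tangent_atlas
        differential_add[OF A A fs] differential_scale[OF A A fs])
qed

end

end

section \<open>Smooth functions and cutoffs\<close>

text \<open>
  The functions \<open>t \<mapsto> t\<^sup>-\<^sup>n exp (-1/t)\<close>, extended by \<open>0\<close> to \<open>t \<le> 0\<close>; their span is closed under
  differentiation.
\<close>

definition flat_fun :: "nat \<Rightarrow> real \<Rightarrow> real" where
  "flat_fun n t = (if t > 0 then inverse t ^ n / exp (inverse t) else 0)"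

text \<open>This is the difference quotient at 0, where \<open>flat_fun n\<close> vanishes. On the
  right, substituting s = 1/t turns it into a power of s divided by exp s.\<close>

lemma flat_fun_div_tendsto: "((\<lambda>t. flat_fun n t / t) \<longlongrightarrow> 0) (at 0)"
proof -
  have "((\<lambda>t::real. inverse t ^ Suc n / exp (inverse t)) \<longlongrightarrow> 0) (at_right 0)"
    by (rule filterlim_compose[OF tendsto_power_div_exp_0 filterlim_inverse_at_top_right])
  moreover have "\<forall>\<^sub>F t in at_right 0. flat_fun n t / t = inverse t ^ Suc n / exp (inverse t)"
    using eventually_at_right_less[of "0::real"]
    by eventually_elim (simp add: flat_fun_def field_simps)
  ultimately have "((\<lambda>t. flat_fun n t / t) \<longlongrightarrow> 0) (at_right 0)"
    by (simp add: tendsto_cong)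
  moreover have "\<forall>\<^sub>F t in at_left 0. flat_fun n t / t = 0"
    by (simp add: eventually_at_filter flat_fun_def)
  then have "((\<lambda>t. flat_fun n t / t) \<longlongrightarrow> 0) (at_left 0)"
    by (simp add: tendsto_eventually)
  ultimately show ?thesis by (simp add: filterlim_split_at)
qed

lemma flat_fun_derivative:
  "(flat_fun n has_real_derivative flat_fun (n + 2) t - real n * flat_fun (n + 1) t) (at t)"
proof -
  consider "t > 0" | "t = 0" | "t < 0" by linarith
  then show ?thesis
  proof cases
    case 1
    have "((\<lambda>t. inverse t ^ n * exp (- inverse t)) has_real_derivative
        flat_fun (n + 2) t - real n * flat_fun (n + 1) t) (at t)"
    \<comment> \<open>The power rule produces the exponent \<open>n - 1\<close> on naturals, so
      \<open>n = 0\<close> is treated apart.\<close>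
    proof (cases n)
      case 0
      show ?thesis unfolding 0 using 1
        by (auto intro!: derivative_eq_intros simp: flat_fun_def exp_minus field_simps power2_eq_square)
    next
      case (Suc m)
      show ?thesis unfolding Suc using 1
        by (auto intro!: derivative_eq_intros simp: flat_fun_def exp_minus field_simps power2_eq_square)
          (metis Suc_pred neq0_conv power_Suc)
    qed
    then show ?thesis
      by (rule has_field_derivative_transform_within_open[where S = "{0<..}"])
        (use 1 in \<open>auto simp: flat_fun_def exp_minus field_simps\<close>)
  next
    case 2
    then show ?thesis using flat_fun_div_tendsto[of n]
      by (simp add: DERIV_def flat_fun_def[of _ 0])
  next
    case 3
    have "((\<lambda>t. 0) has_real_derivative 0) (at t)" by simp
    then have "(flat_fun n has_real_derivative 0) (at t)"
      by (rule has_field_derivative_transform_within_open[where S = "{..<0}"]) (use 3 in \<open>auto simp: flat_fun_def\<close>)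
    then show ?thesis using 3 by (simp add: flat_fun_def)
  qed
qed

lemma smooth_flat_fun: "smooth_on UNIV (flat_fun n)"
proof -
  have "Ck_on k UNIV (flat_fun n)" for k
  proof (induction k arbitrary: n)
    case 0
    show ?case
      using DERIV_isCont[OF flat_fun_derivative] by (simp add: continuous_at_imp_continuous_on)
  next
    case (Suc k)
    have *: "(flat_fun n has_derivative (\<lambda>v. v * (flat_fun (n + 2) t + (- real n) * flat_fun (n + 1) t))) (at t)" for t
      using flat_fun_derivative[of n t] by (simp add: has_field_derivative_def mult_commute_abs)
    show ?case
      by (rule Ck_on_SucI[OF open_UNIV *])
        (intro Ck_on_bilinear[OF _ bounded_bilinear_mult] Ck_on_add Ck_on_const open_UNIV Suc.IH)
  qed
  then show ?thesis by (simp add: smooth_on_def)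
qed

text \<open>Smoothness is asked for in the chart \<open>c\<close> only; as \<open>\<psi>\<close>
  vanishes off a closed set inside that chart, products with it extend by zero.
  \<open>\<psi>\<close> need not be constant near any point: only its value 1 at \<open>p\<close>
  will be used, together with factors that vanish at \<open>p\<close> whenever derivatives are
  taken.\<close>

definition cutoff :: "('a, 'e::euclidean_space) chart set \<Rightarrow> ('a, 'e) chart \<Rightarrow> 'a set \<Rightarrow> ('a \<Rightarrow> real) \<Rightarrow> bool" where
  "cutoff A c K \<psi> \<longleftrightarrow> closedin (atlas_topology A) K \<and> K \<subseteq> fst c \<and> (\<forall>q. q \<notin> K \<longrightarrow> \<psi> q = 0) \<and>
     smooth_on (snd c ` fst c) (\<psi> \<circ> chart_inv c)"

text \<open>The support lies in the image of a closed coordinate ball. That image is compact, and it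
  is closed in the manifold because the atlas topology is Hausdorff.\<close>

lemma exists_cutoff:
  assumes M: "smooth_manifold A" and c: "c \<in> charts_at A p"
  shows "\<exists>K \<psi>. cutoff A c K \<psi> \<and> \<psi> p = 1"
proof -
  have A: "atlas A" using M by (rule smooth_manifold_atlas)
  have c': "c \<in> A" "p \<in> fst c" using c by (simp_all add: charts_at_iff)
  define x where "x = snd c p"
  obtain r where r: "r > 0" "cball x r \<subseteq> snd c ` fst c"
    using atlas_open[OF A c'(1)] c'(2) by (auto simp: open_contains_cball x_def)
  \<comment> \<open>The argument of \<open>flat_fun 0\<close> is positive exactly inside the ball of
    radius \<open>r\<close>; the constant factor normalises the value at the centre to 1.\<close>
  define \<beta> where "\<beta> y = flat_fun 0 (r\<^sup>2 - (y - x) \<bullet> (y - x)) * inverse (flat_fun 0 (r\<^sup>2))" for y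
  define K where "K = chart_inv c ` cball x r"
  define \<psi> where "\<psi> q = (if q \<in> fst c then \<beta> (snd c q) else 0)" for q
  let ?U = "snd c ` fst c"
  \<comment> \<open>Continuity of the inverse chart carries compactness of the ball over to
    \<open>K\<close>.\<close>
  have "continuous_map (subtopology euclidean ?U) (atlas_topology A) (chart_inv c)"
    unfolding continuous_map_def topspace_atlas_topology[OF A]
  proof (intro conjI allI impI funcsetI)
    fix y assume "y \<in> topspace (top_of_set ?U)"
    then show "chart_inv c y \<in> points A"
      using c'(1) chart_inv_in[of y c] by (auto simp: points_def simp del: chart_inv_in)
  next
    fix W assume "openin (atlas_topology A) W"
    then have "open (snd c ` (W \<inter> fst c))" using c' A by (simp add: openin_atlas_topology)
    moreover have "{y \<in> topspace (top_of_set ?U). chart_inv c y \<in> W} = snd c ` (W \<inter> fst c)"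
      using chart_inv_snd[OF A c'(1)] by auto
    moreover have "snd c ` (W \<inter> fst c) \<subseteq> ?U" by auto
    ultimately show "openin (top_of_set ?U) {y \<in> topspace (top_of_set ?U). chart_inv c y \<in> W}"
      using openin_open_eq[OF atlas_open[OF A c'(1)]] by simp
  qed
  moreover have "compactin (subtopology euclidean ?U) (cball x r)"
    using r by (simp add: compactin_subtopology compactin_euclidean_iff)
  ultimately have "compactin (atlas_topology A) K"
    unfolding K_def by (rule image_compactin[rotated])
  then have "closedin (atlas_topology A) K"
    using M by (intro compactin_imp_closedin) (simp_all add: smooth_manifold_def)
  moreover have "K \<subseteq> fst c" unfolding K_def using r(2) chart_inv_in[of _ c] by auto
  moreover have "\<psi> q = 0" if "q \<notin> K" for q
  proof (cases "q \<in> fst c")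
    case True
    have "snd c q \<notin> cball x r"
      using that chart_inv_snd[OF A c'(1) True] unfolding K_def by force
    then have "r < norm (snd c q - x)" by (simp add: dist_norm norm_minus_commute)
    then have "r\<^sup>2 < (norm (snd c q - x))\<^sup>2" using r(1) by (intro power_strict_mono) auto
    then show ?thesis using True by (simp add: \<psi>_def \<beta>_def flat_fun_def power2_norm_eq_inner)
  qed (simp add: \<psi>_def)
  moreover have "smooth_on ?U (\<psi> \<circ> chart_inv c)"
  proof -
    have d: "smooth_on UNIV (\<lambda>y. y - x)"
      using smooth_on_add[OF open_UNIV smooth_on_bounded_linear[OF open_UNIV bounded_linear_ident]
          smooth_on_const[OF open_UNIV, of "- x"]] by simp
    have "smooth_on UNIV (\<lambda>y. r\<^sup>2 + (-1) * ((y - x) \<bullet> (y - x)))"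
      by (intro smooth_on_add smooth_on_mult smooth_on_inner smooth_on_const d open_UNIV)
    then have "smooth_on UNIV \<beta>"
      unfolding \<beta>_def
      by (intro smooth_on_mult smooth_on_const open_UNIV smooth_on_compose[OF _ _ smooth_flat_fun]) auto
    then have "smooth_on ?U \<beta>" by (rule smooth_on_subset) simp
    moreover have "(\<psi> \<circ> chart_inv c) y = \<beta> y" if "y \<in> ?U" for y
      using that by (simp add: \<psi>_def chart_inv_in snd_chart_inv)
    ultimately show ?thesis
      using smooth_on_cong[OF atlas_open[OF A c'(1)], of "\<psi> \<circ> chart_inv c" \<beta>] by simp
  qed
  moreover have "\<psi> p = 1"
    using c'(2) r(1) by (simp add: \<psi>_def \<beta>_def x_def flat_fun_def)
  ultimately show ?thesis unfolding cutoff_def by (intro exI[of _ K] exI[of _ \<psi>]) simp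
qed

text \<open>Since \<open>K\<close> lies in the domain of \<open>c\<close>, the chart
  \<open>d\<close> is covered by two open sets: its overlap with \<open>c\<close>, where smoothness
  is assumed, and the complement of \<open>K\<close>, where \<open>G\<close> is zero.\<close>

lemma smooth_on_extend_by_zero:
  assumes A: "atlas A" and K: "closedin (atlas_topology A) K" "K \<subseteq> fst c" and c: "c \<in> A" and d: "d \<in> A"
    and G: "smooth_on (ldom id d c) G" and 0: "\<And>q. q \<in> fst d \<Longrightarrow> q \<notin> K \<Longrightarrow> G (snd d q) = 0"
  shows "smooth_on (snd d ` fst d) G"
proof (rule smooth_on_local)
  fix x assume "x \<in> snd d ` fst d"
  then obtain q where q: "q \<in> fst d" "x = snd d q" by auto
  show "\<exists>T. open T \<and> x \<in> T \<and> smooth_on T G"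
  proof (cases "q \<in> fst c")
    case True
    then show ?thesis using q G atlas_transition(1)[OF A d c]
      by (intro exI[of _ "ldom id d c"]) (simp add: snd_in_ldom)
  next
    case False
    have "openin (atlas_topology A) (points A - K)"
      using K(1) by (simp add: openin_diff topspace_atlas_topology[OF A] flip: topspace_atlas_topology[OF A])
    then have o: "open (snd d ` ((points A - K) \<inter> fst d))"
      using d by (simp add: openin_atlas_topology[OF A])
    have "smooth_on (snd d ` ((points A - K) \<inter> fst d)) G"
      using smooth_on_cong[OF o, of G "\<lambda>x. 0"] smooth_on_const[OF o, of 0] 0 by auto
    moreover have "x \<in> snd d ` ((points A - K) \<inter> fst d)"
      using q False K(2) d by (auto simp: points_def)
    ultimately show ?thesis using o by blast
  qed
qed

lemma sum_fun_apply: "(\<Sum>i\<in>I. w i) d = (\<Sum>i\<in>I. w i d)"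
  for w :: "'i \<Rightarrow> 'c \<Rightarrow> 'd::comm_monoid_add"
  by (induction I rule: infinite_finite_induct) simp_all

text \<open>With the real line as a manifold, smooth functions are smooth maps and
  \<open>dir_deriv\<close> is a differential, so linearity and the chain rule are inherited. The
  curves behind vertical lifts use it as their source.\<close>

definition real_atlas :: "(real, real) chart set" where
  "real_atlas = {(UNIV, id)}"

lemma atlas_real: "atlas real_atlas"
proof -
  have "chart_inv (UNIV, id) = (id :: real \<Rightarrow> real)" by (rule ext) (simp add: chart_inv_def inv_id)
  then show ?thesis
    by (simp add: atlas_def real_atlas_def smooth_on_bounded_linear bounded_linear_ident id_def comp_def)
qed

lemma points_real: "points real_atlas = UNIV"
  by (simp add: points_def real_atlas_def)

lemma charts_at_real: "charts_at real_atlas t = {(UNIV, id)}"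
  by (auto simp: charts_at_def real_atlas_def)

section \<open>Smooth functions and vector fields\<close>

context
  fixes A :: "('a, 'e::euclidean_space) chart set"
  assumes A: "atlas A"
begin

lemma smooth_fun_iff: "smooth_fun A h \<longleftrightarrow> smooth_map A real_atlas h"
proof -
  have "ldom h c (UNIV, id) = snd c ` fst c" for c :: "('a, 'e) chart" by (auto simp: ldom_def)
  then show ?thesis
    unfolding smooth_map_iff[OF A atlas_real] points_real
    by (auto simp: smooth_fun_def real_atlas_def lrep_def atlas_open[OF A])
qed

lemma dir_deriv_differential: "dir_deriv A h p v = differential A real_atlas h p v (UNIV, id)"
  by (simp add: dir_deriv_def differential_def charts_at_real Let_def)

lemma dir_deriv_eq:
  assumes "smooth_fun A h" "c \<in> charts_at A p" "v \<in> tangent_space A p"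
  shows "dir_deriv A h p v = frechet_derivative (h \<circ> chart_inv c) (at (snd c p)) (v c)"
  using assms differential_apply[OF A atlas_real, of h v p c "(UNIV, id)"]
  by (simp add: dir_deriv_differential smooth_fun_iff charts_at_real lderiv_def lrep_def)

lemma dir_deriv_add:
  "smooth_fun A h \<Longrightarrow> p \<in> points A \<Longrightarrow> v \<in> tangent_space A p \<Longrightarrow> w \<in> tangent_space A p \<Longrightarrow>
    dir_deriv A h p (v + w) = dir_deriv A h p v + dir_deriv A h p w"
  by (simp add: dir_deriv_differential smooth_fun_iff differential_add[OF A atlas_real])

lemma dir_deriv_scale:
  "smooth_fun A h \<Longrightarrow> p \<in> points A \<Longrightarrow> v \<in> tangent_space A p \<Longrightarrow>
    dir_deriv A h p (a \<cdot>\<^sub>t v) = a * dir_deriv A h p v"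
  by (simp add: dir_deriv_differential smooth_fun_iff differential_scale[OF A atlas_real] tscale_apply)

lemma dir_deriv_diff:
  "smooth_fun A h \<Longrightarrow> p \<in> points A \<Longrightarrow> v \<in> tangent_space A p \<Longrightarrow> w \<in> tangent_space A p \<Longrightarrow>
    dir_deriv A h p (v - w) = dir_deriv A h p v - dir_deriv A h p w"
  by (simp add: tvec_diff dir_deriv_add dir_deriv_scale tangent_space_scale[OF A])

lemma dir_deriv_cong:
  assumes "smooth_fun A h" "\<And>q. q \<in> points A \<Longrightarrow> h q = h' q" "p \<in> points A" "v \<in> tangent_space A p"
  shows "dir_deriv A h' p v = dir_deriv A h p v"
proof -
  have "differential A real_atlas h' p v = differential A real_atlas h p v"
    by (rule differential_cong[OF A atlas_real assms(2)]) (use assms in \<open>simp_all add: smooth_fun_iff\<close>)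
  then show ?thesis by (simp add: dir_deriv_differential)
qed

lemma smooth_fun_compose: "smooth_fun A h \<Longrightarrow> smooth_map A A f \<Longrightarrow> smooth_fun A (h \<circ> f)"
  unfolding smooth_fun_iff by (rule smooth_map_compose[OF A A atlas_real])

lemma dir_deriv_compose:
  assumes "smooth_fun A h" "smooth_map A A f" "p \<in> points A" "v \<in> tangent_space A p"
  shows "dir_deriv A h (f p) (differential A A f p v) = dir_deriv A (h \<circ> f) p v"
  using assms differential_compose[OF A A atlas_real, of f h p v]
  by (simp add: dir_deriv_differential smooth_fun_iff)

lemma smooth_fun_const: "smooth_fun A (\<lambda>q. a)"
  by (simp add: smooth_fun_def comp_def smooth_on_const atlas_open[OF A])

lemma smooth_fun_mult: "smooth_fun A h \<Longrightarrow> smooth_fun A k \<Longrightarrow> smooth_fun A (\<lambda>q. h q * k q)"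
  by (auto simp: smooth_fun_def comp_def intro!: smooth_on_mult atlas_open[OF A])

lemma smooth_fun_add: "smooth_fun A h \<Longrightarrow> smooth_fun A k \<Longrightarrow> smooth_fun A (\<lambda>q. h q + k q)"
  by (auto simp: smooth_fun_def comp_def intro!: smooth_on_add atlas_open[OF A])

lemma smooth_vfield_tangent: "smooth_vfield A X \<Longrightarrow> p \<in> points A \<Longrightarrow> X p \<in> tangent_space A p"
  by (simp add: smooth_vfield_def)

lemma smooth_vfield_add: "smooth_vfield A X \<Longrightarrow> smooth_vfield A Y \<Longrightarrow> smooth_vfield A (\<lambda>q. X q + Y q)"
  by (auto simp: smooth_vfield_def tangent_space_add[OF A] intro!: smooth_on_add atlas_open[OF A])

lemma smooth_vfield_scale: "smooth_fun A h \<Longrightarrow> smooth_vfield A X \<Longrightarrow> smooth_vfield A (\<lambda>q. h q \<cdot>\<^sub>t X q)"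
  by (auto simp: smooth_vfield_def smooth_fun_def comp_def tangent_space_scale[OF A] tscale_apply
      intro!: smooth_on_scaleR atlas_open[OF A])

lemma smooth_vfield_0: "smooth_vfield A (\<lambda>q. 0)"
  by (simp add: smooth_vfield_def tangent_space_0[OF A] smooth_on_const atlas_open[OF A])

lemma smooth_vfield_sum:
  assumes "\<And>i. i \<in> I \<Longrightarrow> smooth_vfield A (X i)"
  shows "smooth_vfield A (\<lambda>q. \<Sum>i\<in>I. X i q)"
  using assms
  by (induction I rule: infinite_finite_induct) (simp_all add: smooth_vfield_0 smooth_vfield_add)

text \<open>Needed because torsion-freeness differentiates these functions once more.\<close>

lemma smooth_fun_dir_deriv:
  assumes h: "smooth_fun A h" and Y: "smooth_vfield A Y"
  shows "smooth_fun A (\<lambda>q. dir_deriv A h q (Y q))"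
  unfolding smooth_fun_def
proof
  fix c assume c: "c \<in> A"
  have o: "open (snd c ` fst c)" by (rule atlas_open[OF A c])
  have "((\<lambda>q. dir_deriv A h q (Y q)) \<circ> chart_inv c) x =
      frechet_derivative (h \<circ> chart_inv c) (at x) (Y (chart_inv c x) c)" if "x \<in> snd c ` fst c" for x
  proof -
    have "c \<in> charts_at A (chart_inv c x)" using that c by (simp add: charts_at_iff chart_inv_in)
    then show ?thesis
      using dir_deriv_eq[OF h _ smooth_vfield_tangent[OF Y pointsI]] that by (simp add: snd_chart_inv)
  qed
  moreover have "smooth_on (snd c ` fst c)
      (\<lambda>x. frechet_derivative (h \<circ> chart_inv c) (at x) (Y (chart_inv c x) c))"
    by (rule smooth_on_derivative_apply[OF o smooth_on_bounded_linear[OF o bounded_linear_ident]])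
      (use h Y c in \<open>auto simp: smooth_fun_def smooth_vfield_def\<close>)
  ultimately show "smooth_on (snd c ` fst c) ((\<lambda>q. dir_deriv A h q (Y q)) \<circ> chart_inv c)"
    using smooth_on_cong[OF o, of "(\<lambda>q. dir_deriv A h q (Y q)) \<circ> chart_inv c"
        "\<lambda>x. frechet_derivative (h \<circ> chart_inv c) (at x) (Y (chart_inv c x) c)"] by simp
qed

section \<open>Global functions and fields from local ones\<close>

lemma smooth_fun_cutoff:
  assumes "cutoff A c K \<psi>" "c \<in> A" "smooth_on (snd c ` fst c) k"
  shows "smooth_fun A (\<lambda>q. if q \<in> fst c then \<psi> q * k (snd c q) else 0)" (is "smooth_fun A ?h")
  unfolding smooth_fun_def
proof
  fix d assume d: "d \<in> A"
  have K: "closedin (atlas_topology A) K" "K \<subseteq> fst c" "\<And>q. q \<notin> K \<Longrightarrow> \<psi> q = 0"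
    "smooth_on (snd c ` fst c) (\<lambda>x. \<psi> (chart_inv c x))"
    using assms(1) by (simp_all add: cutoff_def comp_def)
  note o = atlas_transition(1)[OF A d assms(2)]
  have img: "lrep id d c ` ldom id d c \<subseteq> snd c ` fst c" by (auto simp: ldom_iff[OF A d] lrep_def)
  have "smooth_on (snd c ` fst c) (\<lambda>y. \<psi> (chart_inv c y) * k y)"
    by (rule smooth_on_mult[OF atlas_open[OF A assms(2)] K(4) assms(3)])
  from smooth_on_compose[OF o atlas_transition(2)[OF A d assms(2)] this img]
  have "smooth_on (ldom id d c) (\<lambda>x. \<psi> (chart_inv c (lrep id d c x)) * k (lrep id d c x))" .
  moreover have "\<psi> (chart_inv c (lrep id d c x)) * k (lrep id d c x) = (?h \<circ> chart_inv d) x"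
    if "x \<in> ldom id d c" for x
    using that by (simp add: ldom_iff[OF A d] lrep_def chart_inv_snd[OF A assms(2)])
  ultimately have "smooth_on (ldom id d c) (?h \<circ> chart_inv d)"
    using smooth_on_cong[OF o, of "\<lambda>x. \<psi> (chart_inv c (lrep id d c x)) * k (lrep id d c x)" "?h \<circ> chart_inv d"]
    by simp
  then show "smooth_on (snd d ` fst d) (?h \<circ> chart_inv d)"
    by (rule smooth_on_extend_by_zero[OF A K(1,2) assms(2) d]) (simp add: chart_inv_snd[OF A d] K(3))
qed

text \<open>The constant coordinate field \<open>e\<close> of \<open>c\<close>, cut off. Its
  component in another chart is the Jacobian of the change of charts applied to \<open>e\<close>,
  hence smooth on the overlap.\<close>

lemma smooth_vfield_cutoff:
  assumes "cutoff A c K \<psi>" "c \<in> A"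
  shows "smooth_vfield A (\<lambda>q. if q \<in> fst c then \<psi> q \<cdot>\<^sub>t tvec_of A q c e else 0)" (is "smooth_vfield A ?X")
  unfolding smooth_vfield_def
proof (intro conjI ballI)
  fix q
  show "?X q \<in> tangent_space A q"
    using assms(2) by (simp add: tangent_space_0[OF A] tangent_space_scale[OF A] tvec_of_tangent[OF A] charts_at_iff)
next
  fix d assume d: "d \<in> A"
  have K: "closedin (atlas_topology A) K" "K \<subseteq> fst c" "\<And>q. q \<notin> K \<Longrightarrow> \<psi> q = 0"
    "smooth_on (snd c ` fst c) (\<lambda>x. \<psi> (chart_inv c x))"
    using assms(1) by (simp_all add: cutoff_def comp_def)
  note o = atlas_transition(1)[OF A d assms(2)]
  have img: "lrep id d c ` ldom id d c \<subseteq> snd c ` fst c" by (auto simp: ldom_iff[OF A d] lrep_def)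
  have img': "lrep id d c ` ldom id d c \<subseteq> ldom id c d"
    by (auto simp: ldom_iff[OF A d] ldom_iff[OF A assms(2)] lrep_def chart_inv_snd[OF A assms(2)] chart_inv_in)
  let ?G = "\<lambda>x. \<psi> (chart_inv c (lrep id d c x)) *\<^sub>R frechet_derivative (lrep id c d) (at (lrep id d c x)) e"
  have "smooth_on (ldom id d c) ?G"
    by (intro smooth_on_scaleR[OF o] smooth_on_compose[OF o atlas_transition(2)[OF A d assms(2)] K(4) img]
        smooth_on_derivative_apply[OF o atlas_transition(2)[OF A d assms(2)] smooth_on_const[OF o]
          atlas_transition(2)[OF A assms(2) d] img'])
  moreover have "?G x = ?X (chart_inv d x) d" if "x \<in> ldom id d c" for x
    using that assms(2) d
    by (simp add: ldom_iff[OF A d] lrep_def[of id d c] chart_inv_snd[OF A assms(2)] tscale_apply tvec_of_eq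
        charts_at_iff chart_inv_in lderiv_def)
  ultimately have "smooth_on (ldom id d c) (\<lambda>x. ?X (chart_inv d x) d)"
    using smooth_on_cong[OF o, of ?G "\<lambda>x. ?X (chart_inv d x) d"] by simp
  then show "smooth_on (snd d ` fst d) (\<lambda>x. ?X (chart_inv d x) d)"
    by (rule smooth_on_extend_by_zero[OF A K(1,2) assms(2) d]) (simp add: chart_inv_snd[OF A d] K(3) tscale_apply)
qed

lemma tvec_basis_expansion:
  assumes c: "c \<in> charts_at A p" and v: "v \<in> tangent_space A p"
  shows "v = (\<Sum>i\<in>Basis. (v c \<bullet> i) \<cdot>\<^sub>t tvec_of A p c i)"
proof
  fix d
  show "v d = (\<Sum>i\<in>Basis. (v c \<bullet> i) \<cdot>\<^sub>t tvec_of A p c i) d"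
  proof (cases "d \<in> charts_at A p")
    case True
    have "v d = lderiv id c d p (v c)" using tangent_space_transition[OF v c True] by simp
    also have "\<dots> = (\<Sum>i\<in>Basis. (v c \<bullet> i) *\<^sub>R lderiv id c d p i)"
      using True by (intro linear_basis_expansion lderiv_linear[OF A A smooth_map_id[OF A] c]) simp
    finally show ?thesis using True by (simp add: sum_fun_apply tscale_apply tvec_of_eq)
  qed (use tangent_space_outside[OF v] in \<open>simp add: sum_fun_apply tscale_apply tvec_of_eq\<close>)
qed

end

section \<open>Affine connections\<close>

lemma tscale_simps [simp]: "0 \<cdot>\<^sub>t v = 0" "1 \<cdot>\<^sub>t v = v" "a \<cdot>\<^sub>t 0 = 0"
  by (simp_all add: tscale_def fun_eq_iff)

section \<open>Prescribing values and first derivatives at a point\<close>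

context
  fixes A :: "('a, 'e::euclidean_space) chart set"
  assumes M: "smooth_manifold A"
begin

private lemma A: "atlas A"
  using M by (rule smooth_manifold_atlas)

lemma exists_vfield:
  assumes p: "p \<in> points A" and v: "v \<in> tangent_space A p"
  obtains X where "smooth_vfield A X" "X p = v"
proof -
  obtain c where c: "c \<in> charts_at A p" using charts_at_nonempty[OF p] by auto
  obtain K \<psi> where \<psi>: "cutoff A c K \<psi>" "\<psi> p = 1" using exists_cutoff[OF M c] by blast
  have "c \<in> A" "p \<in> fst c" using c by (simp_all add: charts_at_iff)
  then show thesis
    using that[OF smooth_vfield_cutoff[OF A \<psi>(1), of "v c"]] \<psi>(2) tvec_of_coord[OF A c v]
    by (simp add: tscale_def)
qed

text \<open>In the Leibniz rule the derivative of \<open>\<psi>\<close> is multiplied by the value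
  of \<open>k\<close> at the point, which is 0.\<close>

lemma dir_deriv_cutoff:
  assumes c: "c \<in> charts_at A p" and \<psi>: "cutoff A c K \<psi>" "\<psi> p = 1"
    and k: "smooth_on (snd c ` fst c) k" "k (snd c p) = 0" and v: "v \<in> tangent_space A p"
  shows "dir_deriv A (\<lambda>q. if q \<in> fst c then \<psi> q * k (snd c q) else 0) p v
       = frechet_derivative k (at (snd c p)) (v c)" (is "dir_deriv A ?h p v = _")
proof -
  have c': "c \<in> A" "p \<in> fst c" using c by (simp_all add: charts_at_iff)
  let ?\<phi> = "\<psi> \<circ> chart_inv c" and ?x = "snd c p"
  have x: "?x \<in> snd c ` fst c" using c' by simp
  have s: "smooth_on (snd c ` fst c) ?\<phi>" using \<psi>(1) by (simp add: cutoff_def)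
  have "((\<lambda>x. ?\<phi> x * k x) has_derivative
      (\<lambda>e. ?\<phi> ?x * frechet_derivative k (at ?x) e + frechet_derivative ?\<phi> (at ?x) e * k ?x)) (at ?x)"
    by (intro has_derivative_mult smooth_on_has_derivative[OF s x] smooth_on_has_derivative[OF k(1) x])
  then have "((?h \<circ> chart_inv c) has_derivative
      (\<lambda>e. ?\<phi> ?x * frechet_derivative k (at ?x) e + frechet_derivative ?\<phi> (at ?x) e * k ?x)) (at ?x)"
    by (rule has_derivative_transform_within_open[OF _ atlas_open[OF A c'(1)] x])
      (simp add: chart_inv_in snd_chart_inv)
  from frechet_derivative_at[OF this]
  show ?thesis
    using dir_deriv_eq[OF A smooth_fun_cutoff[OF A \<psi>(1) c'(1) k(1)] c v] c' \<psi>(2) k(2)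
    by (simp add: chart_inv_snd[OF A] fun_eq_iff)
qed

text \<open>A cut-off of the affine coordinate function y -> (y - x) . e, where x is the coordinate
  of \<open>p\<close>. Such functions separate tangent vectors and later correct sections to first
  order.\<close>

lemma exists_linear_fun:
  assumes c: "c \<in> charts_at A p"
  obtains h where "smooth_fun A h" "h p = 0" "\<And>v. v \<in> tangent_space A p \<Longrightarrow> dir_deriv A h p v = v c \<bullet> e"
proof -
  obtain K \<psi> where \<psi>: "cutoff A c K \<psi>" "\<psi> p = 1" using exists_cutoff[OF M c] by blast
  have c': "c \<in> A" "p \<in> fst c" using c by (simp_all add: charts_at_iff)
  define k where "k = (\<lambda>y. (y + (- snd c p)) \<bullet> e)"
  have o: "open (snd c ` fst c)" by (rule atlas_open[OF A c'(1)])
  have k: "smooth_on (snd c ` fst c) k" "k (snd c p) = 0"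
    unfolding k_def
    by (intro smooth_on_inner smooth_on_add smooth_on_const smooth_on_bounded_linear[OF _ bounded_linear_ident] o) simp
  have "(k has_derivative (\<lambda>v. v \<bullet> e)) (at (snd c p))"
    unfolding k_def by (auto intro!: derivative_eq_intros)
  then have "frechet_derivative k (at (snd c p)) = (\<lambda>v. v \<bullet> e)"
    by (metis frechet_derivative_at)
  then show thesis
    using that[OF smooth_fun_cutoff[OF A \<psi>(1) c'(1) k(1)]] dir_deriv_cutoff[OF c \<psi> k] k(2) by simp
qed

text \<open>Torsion-freeness is stated through the action on functions, so equations between vectors
  must be recovered from it. Testing with a function whose derivative is the inner product with
  \<open>v c\<close> gives that \<open>v c\<close> has length 0.\<close>

lemma tangent_vector_eq_0I:
  assumes p: "p \<in> points A" and v: "v \<in> tangent_space A p"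
    and h: "\<And>h. smooth_fun A h \<Longrightarrow> dir_deriv A h p v = 0"
  shows "v = 0"
proof -
  obtain c where c: "c \<in> charts_at A p" using charts_at_nonempty[OF p] by auto
  obtain k where k: "smooth_fun A k" "\<And>w. w \<in> tangent_space A p \<Longrightarrow> dir_deriv A k p w = w c \<bullet> v c"
    using exists_linear_fun[OF c, of "v c"] by blast
  have "v c \<bullet> v c = 0" using k(2)[OF v] h[OF k(1)] by (rule trans[OF sym])
  then show ?thesis by (intro tangent_space_eqI[OF v tangent_space_0[OF A] c]) simp
qed

text \<open>Hadamard's lemma, in a form that makes identities for derivations pointwise.\<close>

lemma vanishing_vfield_decomposition:
  assumes W: "smooth_vfield A W" "W p = 0" and c: "c \<in> charts_at A p"
  obtains \<kappa> h E where "smooth_fun A \<kappa>" "\<kappa> p = 0" "\<forall>i. smooth_fun A (h i)" "\<forall>i. smooth_vfield A (E i)"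
    "\<forall>i. h i p = 0" "\<forall>i. E i p = tvec_of A p c i"
    "\<forall>i. \<forall>v\<in>tangent_space A p.
       dir_deriv A (h i) p v = frechet_derivative (\<lambda>x. W (chart_inv c x) c) (at (snd c p)) (v c) \<bullet> i"
    "W = (\<lambda>q. \<kappa> q \<cdot>\<^sub>t W q + (\<Sum>i\<in>Basis. h i q \<cdot>\<^sub>t E i q))"
proof -
  obtain K \<psi> where \<psi>: "cutoff A c K \<psi>" "\<psi> p = 1" using exists_cutoff[OF M c] by blast
  have c': "c \<in> A" "p \<in> fst c" using c by (simp_all add: charts_at_iff)
  have \<psi>0: "\<psi> q = 0" if "q \<notin> fst c" for q using \<psi>(1) that by (auto simp: cutoff_def)
  have o: "open (snd c ` fst c)" by (rule atlas_open[OF A c'(1)])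
  have Wc: "smooth_on (snd c ` fst c) (\<lambda>x. W (chart_inv c x) c)" using W c' by (simp add: smooth_vfield_def)
  define E where "E i = (\<lambda>q. if q \<in> fst c then \<psi> q \<cdot>\<^sub>t tvec_of A q c i else 0)" for i
  define k where "k i = (\<lambda>y. W (chart_inv c y) c \<bullet> i)" for i
  define h where "h i = (\<lambda>q. if q \<in> fst c then \<psi> q * k i (snd c q) else 0)" for i
  \<comment> \<open>Equal to \<open>\<psi>\<close>, in the shape of \<open>smooth_fun_cutoff\<close>
    with the constant 1 as coordinate function.\<close>
  define \<psi>' where "\<psi>' = (\<lambda>q. if q \<in> fst c then \<psi> q * 1 else 0)"
  have sk: "smooth_on (snd c ` fst c) (k i)" for i
    unfolding k_def by (intro smooth_on_inner smooth_on_const Wc o)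
  have k0: "k i (snd c p) = 0" for i using W(2) c' by (simp add: k_def chart_inv_snd[OF A])
  have "smooth_fun A \<psi>'"
    unfolding \<psi>'_def by (rule smooth_fun_cutoff[OF A \<psi>(1) c'(1) smooth_on_const[OF o]])
  \<comment> \<open>\<open>W\<close> is split into \<open>1 - \<psi>\<^sup>2\<close> times
    \<open>W\<close> and \<open>\<psi>\<^sup>2\<close> times \<open>W\<close>. In the second part
    one factor \<open>\<psi>\<close> makes the coefficients \<open>h i\<close> global, the other
    makes the frame \<open>E i\<close> global.\<close>
  then have f1: "smooth_fun A (\<lambda>q. 1 + (-1) * (\<psi>' q * \<psi>' q))"
    by (intro smooth_fun_add[OF A] smooth_fun_mult[OF A] smooth_fun_const[OF A])
  have f2: "1 + (-1) * (\<psi>' p * \<psi>' p) = 0" using \<psi>(2) c'(2) by (simp add: \<psi>'_def)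
  have f3: "smooth_fun A (h i)" for i
    unfolding h_def by (rule smooth_fun_cutoff[OF A \<psi>(1) c'(1) sk])
  have f4: "smooth_vfield A (E i)" for i
    unfolding E_def by (rule smooth_vfield_cutoff[OF A \<psi>(1) c'(1)])
  have f5: "h i p = 0" for i by (simp add: h_def k0)
  have f6: "E i p = tvec_of A p c i" for i using c'(2) \<psi>(2) by (simp add: E_def tscale_def)
  have f7: "dir_deriv A (h i) p v = frechet_derivative (\<lambda>x. W (chart_inv c x) c) (at (snd c p)) (v c) \<bullet> i"
    if v: "v \<in> tangent_space A p" for i v
  proof -
    have "(k i has_derivative (\<lambda>v. frechet_derivative (\<lambda>x. W (chart_inv c x) c) (at (snd c p)) v \<bullet> i)) (at (snd c p))"
      unfolding k_def using c'(2)
      by (intro has_derivative_inner_left smooth_on_has_derivative[OF Wc]) simp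
    from frechet_derivative_at[OF this] show ?thesis
      unfolding h_def using dir_deriv_cutoff[OF c \<psi> sk k0 v] by (simp add: fun_eq_iff)
  qed
  have f8: "W = (\<lambda>q. (1 + (-1) * (\<psi>' q * \<psi>' q)) \<cdot>\<^sub>t W q + (\<Sum>i\<in>Basis. h i q \<cdot>\<^sub>t E i q))"
  proof
    fix q
    show "W q = (1 + (-1) * (\<psi>' q * \<psi>' q)) \<cdot>\<^sub>t W q + (\<Sum>i\<in>Basis. h i q \<cdot>\<^sub>t E i q)"
    proof (cases "q \<in> fst c")
      case True
      then have cq: "c \<in> charts_at A q" using c' by (simp add: charts_at_iff)
      have Wq: "W q \<in> tangent_space A q" using smooth_vfield_tangent[OF A W(1) pointsI[OF cq]] .
      have scale_sum: "a \<cdot>\<^sub>t (\<Sum>i\<in>I. w i) = (\<Sum>i\<in>I. a \<cdot>\<^sub>t w i)" for a I and w :: "'e \<Rightarrow> ('a, 'e) tvec"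
        by (rule ext) (simp add: sum_fun_apply tscale_def scaleR_sum_right)
      have "(\<psi> q * \<psi> q) \<cdot>\<^sub>t W q = (\<psi> q * \<psi> q) \<cdot>\<^sub>t (\<Sum>i\<in>Basis. (W q c \<bullet> i) \<cdot>\<^sub>t tvec_of A q c i)"
        using tvec_basis_expansion[OF A cq Wq] by simp
      also have "\<dots> = (\<Sum>i\<in>Basis. h i q \<cdot>\<^sub>t E i q)"
        using True unfolding scale_sum
        by (simp add: h_def E_def k_def chart_inv_snd[OF A c'(1)] tscale_def mult_ac)
      finally have "(\<Sum>i\<in>Basis. h i q \<cdot>\<^sub>t E i q) = (\<psi> q * \<psi> q) \<cdot>\<^sub>t W q" by simp
      then show ?thesis using True by (simp add: \<psi>'_def tscale_def fun_eq_iff algebra_simps)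
    next
      case False
      then show ?thesis by (simp add: \<psi>'_def h_def E_def)
    qed
  qed
  show thesis
    by (rule that[of "\<lambda>q. 1 + (-1) * (\<psi>' q * \<psi>' q)" h E]; (intro allI ballI)?;
        fact f1 f2 f3 f4 f5 f6 f7 f8)
qed

text \<open>Used for \<open>nabla\<close> at a point, with \<open>T\<close> acting on its first or
  on its second argument.\<close>

lemma vfield_sum_additive:
  fixes T :: "('a, 'e) vfield \<Rightarrow> ('a, 'e) tvec"
  assumes "T (\<lambda>q. 0) = 0"
    and "\<And>X Y. smooth_vfield A X \<Longrightarrow> smooth_vfield A Y \<Longrightarrow> T (\<lambda>q. X q + Y q) = T X + T Y"
    and "\<And>i. smooth_vfield A (X i)" and "finite I"
  shows "T (\<lambda>q. \<Sum>i\<in>I. X i q) = (\<Sum>i\<in>I. T (X i))"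
  using assms(4)
proof (induction I rule: finite_induct)
  case empty
  show ?case unfolding sum.empty by (rule assms(1))
next
  case (insert i I)
  show ?case unfolding sum.insert[OF insert.hyps] insert.IH[symmetric]
    by (intro assms(2,3) smooth_vfield_sum[OF A])
qed

section \<open>Pointwise behaviour of a connection on global fields\<close>

context
  fixes nabla :: "('a, 'e) vfield \<Rightarrow> ('a, 'e) vfield \<Rightarrow> ('a, 'e) vfield"
  assumes nabla: "affine_connection A nabla"
begin

lemma nabla_smooth: "smooth_vfield A X \<Longrightarrow> smooth_vfield A Y \<Longrightarrow> smooth_vfield A (nabla X Y)"
  using nabla unfolding affine_connection_def by blast

lemma nabla_rules:
  assumes "smooth_vfield A X" "smooth_vfield A Y" "smooth_vfield A Z" "smooth_fun A h" "p \<in> points A"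
  shows nabla_add_left: "nabla (\<lambda>q. X q + Y q) Z p = nabla X Z p + nabla Y Z p"
    and nabla_scale_left: "nabla (\<lambda>q. h q \<cdot>\<^sub>t X q) Z p = h p \<cdot>\<^sub>t nabla X Z p"
    and nabla_add_right: "nabla X (\<lambda>q. Y q + Z q) p = nabla X Y p + nabla X Z p"
    and nabla_leibniz: "nabla X (\<lambda>q. h q \<cdot>\<^sub>t Y q) p = dir_deriv A h p (X p) \<cdot>\<^sub>t Y p + h p \<cdot>\<^sub>t nabla X Y p"
  using nabla assms unfolding affine_connection_def by blast+

lemma nabla_0:
  assumes X: "smooth_vfield A X" and p: "p \<in> points A"
  shows "nabla (\<lambda>q. 0) X p = 0" "nabla X (\<lambda>q. 0) p = 0"
  using nabla_add_left[OF smooth_vfield_0[OF A] smooth_vfield_0[OF A] X smooth_fun_const[OF A] p]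
    nabla_add_right[OF X smooth_vfield_0[OF A] smooth_vfield_0[OF A] smooth_fun_const[OF A] p]
  by simp_all

text \<open>Every summand of the decomposition of \<open>X\<close> carries a coefficient that
  vanishes at \<open>p\<close>, and the connection is linear over functions in its first
  argument.\<close>

lemma nabla_tensorial_0:
  assumes X: "smooth_vfield A X" "X p = 0" and Y: "smooth_vfield A Y" and p: "p \<in> points A"
  shows "nabla X Y p = 0"
proof -
  obtain c where c: "c \<in> charts_at A p" using charts_at_nonempty[OF p] by auto
  obtain \<kappa> h E where *: "smooth_fun A \<kappa>" "\<kappa> p = 0" "\<forall>i. smooth_fun A (h i)" "\<forall>i. smooth_vfield A (E i)"
    "\<forall>i. h i p = 0" "\<forall>i. E i p = tvec_of A p c i"
    "\<forall>i. \<forall>v\<in>tangent_space A p.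
       dir_deriv A (h i) p v = frechet_derivative (\<lambda>x. X (chart_inv c x) c) (at (snd c p)) (v c) \<bullet> i"
    "X = (\<lambda>q. \<kappa> q \<cdot>\<^sub>t X q + (\<Sum>i\<in>Basis. h i q \<cdot>\<^sub>t E i q))"
    by (rule vanishing_vfield_decomposition[OF X c])
  note hE = smooth_vfield_scale[OF A *(3)[rule_format] *(4)[rule_format]]
  have "nabla X Y p = nabla (\<lambda>q. \<kappa> q \<cdot>\<^sub>t X q + (\<Sum>i\<in>Basis. h i q \<cdot>\<^sub>t E i q)) Y p"
    using arg_cong[OF *(8), of "\<lambda>X. nabla X Y p"] .
  also have "\<dots> = nabla (\<lambda>q. \<kappa> q \<cdot>\<^sub>t X q) Y p + nabla (\<lambda>q. \<Sum>i\<in>Basis. h i q \<cdot>\<^sub>t E i q) Y p"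
    by (rule nabla_add_left[OF smooth_vfield_scale[OF A *(1) X(1)] smooth_vfield_sum[OF A hE] Y
          smooth_fun_const[OF A] p])
  also have "nabla (\<lambda>q. \<Sum>i\<in>Basis. h i q \<cdot>\<^sub>t E i q) Y p = (\<Sum>i\<in>Basis. nabla (\<lambda>q. h i q \<cdot>\<^sub>t E i q) Y p)"
    by (rule vfield_sum_additive[where T = "\<lambda>X. nabla X Y p", OF nabla_0(1)[OF Y p] _ hE finite_Basis])
      (rule nabla_add_left[OF _ _ Y smooth_fun_const[OF A] p])
  also have "\<dots> = 0"
    using nabla_scale_left[OF *(4)[rule_format] Y Y *(3)[rule_format] p] *(5) by simp
  also have "nabla (\<lambda>q. \<kappa> q \<cdot>\<^sub>t X q) Y p = 0"
    using nabla_scale_left[OF X(1) Y Y *(1) p] *(2) by simp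
  finally show ?thesis by (simp add: zero_fun_def)
qed

text \<open>At a zero of \<open>W\<close> the Leibniz rule keeps only the derivatives of the
  coefficients, and these assemble to the coordinate derivative of \<open>W\<close>. No Christoffel
  symbols appear, which is what makes horizontal lifts unique.\<close>

lemma nabla_vanishing:
  assumes X: "smooth_vfield A X" and W: "smooth_vfield A W" "W p = 0" and c: "c \<in> charts_at A p"
  shows "nabla X W p c = frechet_derivative (\<lambda>x. W (chart_inv c x) c) (at (snd c p)) (X p c)"
proof -
  have p: "p \<in> points A" by (rule pointsI[OF c])
  obtain \<kappa> h E where *: "smooth_fun A \<kappa>" "\<kappa> p = 0" "\<forall>i. smooth_fun A (h i)" "\<forall>i. smooth_vfield A (E i)"
    "\<forall>i. h i p = 0" "\<forall>i. E i p = tvec_of A p c i"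
    "\<forall>i. \<forall>v\<in>tangent_space A p.
       dir_deriv A (h i) p v = frechet_derivative (\<lambda>x. W (chart_inv c x) c) (at (snd c p)) (v c) \<bullet> i"
    "W = (\<lambda>q. \<kappa> q \<cdot>\<^sub>t W q + (\<Sum>i\<in>Basis. h i q \<cdot>\<^sub>t E i q))"
    by (rule vanishing_vfield_decomposition[OF W c])
  note hE = smooth_vfield_scale[OF A *(3)[rule_format] *(4)[rule_format]]
  let ?D = "frechet_derivative (\<lambda>x. W (chart_inv c x) c) (at (snd c p)) (X p c)"
  have "nabla X W p = nabla X (\<lambda>q. \<kappa> q \<cdot>\<^sub>t W q + (\<Sum>i\<in>Basis. h i q \<cdot>\<^sub>t E i q)) p"
    using arg_cong[OF *(8), of "\<lambda>W. nabla X W p"] .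
  also have "\<dots> = nabla X (\<lambda>q. \<kappa> q \<cdot>\<^sub>t W q) p + nabla X (\<lambda>q. \<Sum>i\<in>Basis. h i q \<cdot>\<^sub>t E i q) p"
    by (rule nabla_add_right[OF X smooth_vfield_scale[OF A *(1) W(1)] smooth_vfield_sum[OF A hE]
          smooth_fun_const[OF A] p])
  also have "nabla X (\<lambda>q. \<Sum>i\<in>Basis. h i q \<cdot>\<^sub>t E i q) p = (\<Sum>i\<in>Basis. nabla X (\<lambda>q. h i q \<cdot>\<^sub>t E i q) p)"
    by (rule vfield_sum_additive[where T = "\<lambda>Y. nabla X Y p", OF nabla_0(2)[OF X p] _ hE finite_Basis])
      (rule nabla_add_right[OF X _ _ smooth_fun_const[OF A] p])
  also have "\<dots> = (\<Sum>i\<in>Basis. (?D \<bullet> i) \<cdot>\<^sub>t tvec_of A p c i)"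
  proof (rule sum.cong[OF refl])
    fix i
    show "nabla X (\<lambda>q. h i q \<cdot>\<^sub>t E i q) p = (?D \<bullet> i) \<cdot>\<^sub>t tvec_of A p c i"
      using nabla_leibniz[OF X *(4)[rule_format] X *(3)[rule_format] p] *(5,6) *(7)[rule_format, OF smooth_vfield_tangent[OF A X p]]
      by simp
  qed
  also have "\<dots> = tvec_of A p c ?D"
    using tvec_basis_expansion[OF A c tvec_of_tangent[OF A c, of ?D]] by (simp add: tvec_of_same[OF A c])
  also have "nabla X (\<lambda>q. \<kappa> q \<cdot>\<^sub>t W q) p = 0"
    using nabla_leibniz[OF X W(1) X *(1) p] *(2) W(2) by simp
  finally show ?thesis by (simp add: tvec_of_same[OF A c])
qed

lemma smooth_vfield_diff:
  "smooth_vfield A X \<Longrightarrow> smooth_vfield A Y \<Longrightarrow> smooth_vfield A (\<lambda>q. X q + (-1) \<cdot>\<^sub>t Y q)"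
  by (intro smooth_vfield_add[OF A] smooth_vfield_scale[OF A, of "\<lambda>q. -1"] smooth_fun_const[OF A])

lemma nabla_tensorial:
  assumes X: "smooth_vfield A X" and X': "smooth_vfield A X'" and Y: "smooth_vfield A Y"
    and p: "p \<in> points A" and eq: "X p = X' p"
  shows "nabla X Y p = nabla X' Y p"
proof -
  have s: "smooth_vfield A (\<lambda>q. (-1) \<cdot>\<^sub>t X' q)"
    by (rule smooth_vfield_scale[OF A smooth_fun_const[OF A] X'])
  have "nabla (\<lambda>q. X q + (-1) \<cdot>\<^sub>t X' q) Y p = nabla X Y p + (-1) \<cdot>\<^sub>t nabla X' Y p"
    using nabla_add_left[OF X s Y smooth_fun_const[OF A] p] nabla_scale_left[OF X' Y Y smooth_fun_const[OF A, of "-1"] p]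
    by simp
  moreover have "nabla (\<lambda>q. X q + (-1) \<cdot>\<^sub>t X' q) Y p = 0"
    by (rule nabla_tensorial_0[OF smooth_vfield_diff[OF X X'] _ Y p]) (simp add: eq tscale_def fun_eq_iff)
  ultimately show ?thesis by (simp flip: tvec_diff)
qed

end

end

section \<open>Horizontal and vertical lifts\<close>

context
  fixes A :: "('a, 'e::euclidean_space) chart set"
  assumes A: "atlas A"
begin

abbreviation (input) "tchart c \<equiv> bchart A id c c"

lemma tangent_atlas_image: "tangent_atlas A = (\<lambda>c. tchart c) ` A"
  by (simp add: tangent_atlas_eq[OF A] bundle_atlas_def image_image)

lemma charts_at_tangent_atlas:
  assumes "u \<in> points (tangent_atlas A)"
  shows "charts_at (tangent_atlas A) u = (\<lambda>c. tchart c) ` charts_at A (fst u)"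
proof -
  have "u \<in> fst (tchart c) \<longleftrightarrow> fst u \<in> fst c" for c
    using assms points_tangent_atlas[OF A, of u] by (simp add: in_bchart)
  then show ?thesis unfolding charts_at_def tangent_atlas_image by blast
qed

lemma tchart_charts_at:
  "u \<in> points (tangent_atlas A) \<Longrightarrow> c \<in> charts_at A (fst u) \<Longrightarrow> tchart c \<in> charts_at (tangent_atlas A) u"
  by (simp add: charts_at_tangent_atlas)

section \<open>Sections of the tangent bundle and their differentials\<close>

lemma section_chart:
  assumes Y: "smooth_vfield A Y" and c: "c \<in> A"
  shows "ldom (\<lambda>q. (q, Y q)) c (tchart c) = snd c ` fst c"
    and "x \<in> snd c ` fst c \<Longrightarrow> lrep (\<lambda>q. (q, Y q)) c (tchart c) x = (x, Y (chart_inv c x) c)"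
proof -
  have "(q, Y q) \<in> fst (tchart c)" if "q \<in> fst c" for q
    using that c smooth_vfield_tangent[OF A Y, of q] by (auto simp: in_bchart points_def)
  then show "ldom (\<lambda>q. (q, Y q)) c (tchart c) = snd c ` fst c" by (auto simp: ldom_def)
  show "lrep (\<lambda>q. (q, Y q)) c (tchart c) x = (x, Y (chart_inv c x) c)" if "x \<in> snd c ` fst c"
    using that by (simp add: lrep_def snd_bchart snd_chart_inv)
qed

lemma smooth_section:
  assumes Y: "smooth_vfield A Y"
  shows "smooth_map A (tangent_atlas A) (\<lambda>q. (q, Y q))"
proof (rule smooth_map_localI[OF A atlas_tangent_atlas[OF A]])
  fix p assume p: "p \<in> points A"
  obtain c where c: "c \<in> charts_at A p" using charts_at_nonempty[OF p] by auto
  then have c': "c \<in> A" "p \<in> fst c" by (simp_all add: charts_at_iff)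
  have u: "(p, Y p) \<in> points (tangent_atlas A)"
    using p smooth_vfield_tangent[OF A Y p] by (simp add: points_tangent_atlas[OF A])
  have C: "tchart c \<in> tangent_atlas A" "(p, Y p) \<in> fst (tchart c)"
    using tchart_charts_at[OF u, of c] c by (simp_all add: charts_at_iff)
  note o = atlas_open[OF A c'(1)]
  have "smooth_on (snd c ` fst c) (\<lambda>x. (x, Y (chart_inv c x) c))"
    using Y c' by (intro smooth_on_Pair smooth_on_bounded_linear[OF _ bounded_linear_ident] o)
      (simp add: smooth_vfield_def)
  then have "smooth_on (snd c ` fst c) (lrep (\<lambda>q. (q, Y q)) c (tchart c))"
    using smooth_on_cong[OF o, of "lrep (\<lambda>q. (q, Y q)) c (tchart c)" "\<lambda>x. (x, Y (chart_inv c x) c)"]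
      section_chart(2)[OF Y c'(1)] by simp
  then show "\<exists>c\<in>A. \<exists>d\<in>tangent_atlas A. \<exists>S. p \<in> fst c \<and> (p, Y p) \<in> fst d \<and> open S \<and> snd c p \<in> S \<and>
      S \<subseteq> ldom (\<lambda>q. (q, Y q)) c d \<and> smooth_on S (lrep (\<lambda>q. (q, Y q)) c d)"
    using c' C o section_chart(1)[OF Y c'(1)]
    by (intro bexI[of _ c] bexI[of _ "tchart c"] exI[of _ "snd c ` fst c"] conjI) simp_all
qed

lemma section_differential:
  assumes Y: "smooth_vfield A Y" and v: "v \<in> tangent_space A p" and c: "c \<in> charts_at A p"
  shows "differential A (tangent_atlas A) (\<lambda>q. (q, Y q)) p v (tchart c)
       = (v c, frechet_derivative (\<lambda>x. Y (chart_inv c x) c) (at (snd c p)) (v c))"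
proof -
  have c': "c \<in> A" "p \<in> fst c" using c by (simp_all add: charts_at_iff)
  have u: "(p, Y p) \<in> points (tangent_atlas A)"
    using pointsI[OF c] smooth_vfield_tangent[OF A Y] by (simp add: points_tangent_atlas[OF A])
  have "smooth_on (snd c ` fst c) (\<lambda>x. Y (chart_inv c x) c)" using Y c' by (simp add: smooth_vfield_def)
  then have "((\<lambda>x. (x, Y (chart_inv c x) c)) has_derivative
      (\<lambda>e. (e, frechet_derivative (\<lambda>x. Y (chart_inv c x) c) (at (snd c p)) e))) (at (snd c p))"
    using c' by (intro has_derivative_Pair has_derivative_ident smooth_on_has_derivative) auto
  then have "(lrep (\<lambda>q. (q, Y q)) c (tchart c) has_derivative
      (\<lambda>e. (e, frechet_derivative (\<lambda>x. Y (chart_inv c x) c) (at (snd c p)) e))) (at (snd c p))"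
    by (rule has_derivative_transform_within_open[OF _ atlas_open[OF A c'(1)]])
      (use c' section_chart(2)[OF Y c'(1)] in auto)
  from frechet_derivative_at[OF this] show ?thesis
    using differential_apply[OF A atlas_tangent_atlas[OF A] smooth_section[OF Y] v c tchart_charts_at[OF u]] c
    by (simp add: lderiv_def fun_eq_iff)
qed

section \<open>The bundle projection\<close>

lemma projection_chart:
  assumes c: "c \<in> A" and z: "z \<in> snd (tchart c) ` fst (tchart c)"
  shows "z \<in> ldom fst (tchart c) c" "lrep fst (tchart c) c z = fst z"
proof -
  obtain u where u: "u \<in> fst (tchart c)" "z = snd (tchart c) u" using z by auto
  then show "z \<in> ldom fst (tchart c) c" by (auto simp: ldom_def in_bchart)
  have "chart_inv (tchart c) z = u"
    using u bchart_inj[OF A c c, of id] by (simp add: chart_inv_def)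
  then show "lrep fst (tchart c) c z = fst z" using u by (simp add: lrep_def snd_bchart)
qed

lemma smooth_projection: "smooth_map (tangent_atlas A) A fst"
proof (rule smooth_map_localI[OF atlas_tangent_atlas[OF A] A])
  fix u assume u: "u \<in> points (tangent_atlas A)"
  then obtain c where c: "c \<in> charts_at A (fst u)"
    using charts_at_nonempty[of "fst u" A] points_tangent_atlas[OF A, of u] by auto
  then have c': "c \<in> A" "fst u \<in> fst c" by (simp_all add: charts_at_iff)
  have C: "tchart c \<in> tangent_atlas A" "u \<in> fst (tchart c)"
    using tchart_charts_at[OF u c] by (simp_all add: charts_at_iff)
  let ?S = "snd (tchart c) ` fst (tchart c)"
  have o: "open ?S" by (rule atlas_open[OF atlas_tangent_atlas[OF A] C(1)])
  have "smooth_on ?S (lrep fst (tchart c) c)"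
    using smooth_on_cong[OF o, of "lrep fst (tchart c) c" fst] projection_chart(2)[OF c'(1)]
      smooth_on_bounded_linear[OF o bounded_linear_fst] by simp
  then show "\<exists>c\<in>tangent_atlas A. \<exists>d\<in>A. \<exists>S. u \<in> fst c \<and> fst u \<in> fst d \<and> open S \<and> snd c u \<in> S \<and>
      S \<subseteq> ldom fst c d \<and> smooth_on S (lrep fst c d)"
    using c' C o projection_chart(1)[OF c'(1)]
    by (intro bexI[of _ "tchart c"] bexI[of _ c] exI[of _ ?S] conjI) auto
qed

lemma proj_differential_apply:
  assumes u: "u \<in> points (tangent_atlas A)" and \<xi>: "\<xi> \<in> tangent_space (tangent_atlas A) u"
    and c: "c \<in> charts_at A (fst u)"
  shows "proj_differential A u \<xi> c = fst (\<xi> (tchart c))"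
proof -
  have c': "c \<in> A" "fst u \<in> fst c" using c by (simp_all add: charts_at_iff)
  have C: "tchart c \<in> tangent_atlas A" "u \<in> fst (tchart c)"
    using tchart_charts_at[OF u c] by (simp_all add: charts_at_iff)
  have "(lrep fst (tchart c) c has_derivative fst) (at (snd (tchart c) u))"
    by (rule has_derivative_transform_within_open[OF bounded_linear_imp_has_derivative[OF bounded_linear_fst]
          atlas_open[OF atlas_tangent_atlas[OF A] C(1)]])
      (use C projection_chart(2)[OF c'(1)] in auto)
  from frechet_derivative_at[OF this] show ?thesis
    using differential_apply[OF atlas_tangent_atlas[OF A] A smooth_projection \<xi> tchart_charts_at[OF u c]] c
    by (simp add: proj_differential_def lderiv_def)
qed

lemma proj_differential_tangent:
  "u \<in> points (tangent_atlas A) \<Longrightarrow> \<xi> \<in> tangent_space (tangent_atlas A) u \<Longrightarrow>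
    proj_differential A u \<xi> \<in> tangent_space A (fst u)"
  unfolding proj_differential_def
  by (rule differential_tangent[OF atlas_tangent_atlas[OF A] A smooth_projection])

text \<open>A section followed by the projection is the identity; in the bundle chart this is the
  first component of \<open>section_differential\<close>.\<close>

lemma proj_differential_section:
  assumes Y: "smooth_vfield A Y" and p: "p \<in> points A" and v: "v \<in> tangent_space A p"
  shows "proj_differential A (p, Y p) (differential A (tangent_atlas A) (\<lambda>q. (q, Y q)) p v) = v"
proof -
  obtain c where c: "c \<in> charts_at A p" using charts_at_nonempty[OF p] by auto
  have u: "(p, Y p) \<in> points (tangent_atlas A)"
    using p smooth_vfield_tangent[OF A Y] by (simp add: points_tangent_atlas[OF A])
  have \<xi>: "differential A (tangent_atlas A) (\<lambda>q. (q, Y q)) p v \<in> tangent_space (tangent_atlas A) (p, Y p)"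
    using differential_tangent[OF A atlas_tangent_atlas[OF A] smooth_section[OF Y] v p] .
  show ?thesis
    by (rule tangent_space_eqI[OF _ v c])
      (use proj_differential_tangent[OF u \<xi>] proj_differential_apply[OF u \<xi>, of c]
        section_differential[OF Y v c] c in simp_all)
qed

text \<open>Rewriting the chartwise velocity as the differential of a smooth curve from
  \<open>real_atlas\<close> makes the vertical lift a tangent vector, and its image under other maps
  becomes a matter of the chain rule.\<close>

lemma vertical_lift_differential:
  assumes u: "u \<in> points (tangent_atlas A)" and w: "w \<in> tangent_space A (fst u)"
  defines "\<gamma> \<equiv> \<lambda>t. (fst u, snd u + t \<cdot>\<^sub>t w)"
  shows "smooth_map real_atlas (tangent_atlas A) \<gamma>"
    and "vertical_lift A u w = differential real_atlas (tangent_atlas A) \<gamma> 0 (tvec_of real_atlas 0 (UNIV, id) 1)"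
    and "c \<in> charts_at A (fst u) \<Longrightarrow> vertical_lift A u w (tchart c) = (0, w c)"
proof -
  have \<gamma>: "\<gamma> t \<in> points (tangent_atlas A)" for t
    using u w by (simp add: points_tangent_atlas[OF A] \<gamma>_def tangent_space_add[OF A] tangent_space_scale[OF A])
  have inv: "chart_inv (UNIV, id) = (id :: real \<Rightarrow> real)" by (rule ext) (simp add: chart_inv_def inv_id)
  have rep: "lrep \<gamma> (UNIV, id) (tchart c) = (\<lambda>t. (snd c (fst u), snd u c + t *\<^sub>R w c))" for c
    by (simp add: lrep_def inv fun_eq_iff snd_bchart \<gamma>_def tscale_apply)
  have dom: "ldom \<gamma> (UNIV, id) (tchart c) = UNIV" if "c \<in> charts_at A (fst u)" for c
    using tchart_charts_at[OF \<gamma>, of c] that by (auto simp: ldom_def charts_at_iff \<gamma>_def)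
  show s: "smooth_map real_atlas (tangent_atlas A) \<gamma>"
  proof (rule smooth_map_localI[OF atlas_real atlas_tangent_atlas[OF A]])
    fix t :: real
    obtain c where c: "c \<in> charts_at A (fst u)"
      using charts_at_nonempty[of "fst u" A] u points_tangent_atlas[OF A, of u] by auto
    have C: "tchart c \<in> tangent_atlas A" "\<gamma> t \<in> fst (tchart c)"
      using tchart_charts_at[OF \<gamma>, of c] c by (simp_all add: charts_at_iff \<gamma>_def)
    have "smooth_on UNIV (\<lambda>t. (snd c (fst u), snd u c + t *\<^sub>R w c))"
      by (intro smooth_on_Pair smooth_on_add smooth_on_scaleR smooth_on_const
          smooth_on_bounded_linear[OF _ bounded_linear_ident] open_UNIV)
    then show "\<exists>c\<in>real_atlas. \<exists>d\<in>tangent_atlas A. \<exists>S. t \<in> fst c \<and> \<gamma> t \<in> fst d \<and> open S \<and> snd c t \<in> S \<and>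
        S \<subseteq> ldom \<gamma> c d \<and> smooth_on S (lrep \<gamma> c d)"
      using C dom[OF c]
      by (intro bexI[of _ "(UNIV, id)"] bexI[of _ "tchart c"] exI[of _ UNIV] conjI) (simp_all add: rep real_atlas_def)
  qed
  have \<gamma>0: "\<gamma> 0 = u" by (simp add: \<gamma>_def)
  have o: "(UNIV, id) \<in> charts_at real_atlas (0::real)" by (simp add: charts_at_real)
  show eq: "vertical_lift A u w = differential real_atlas (tangent_atlas A) \<gamma> 0 (tvec_of real_atlas 0 (UNIV, id) 1)"
  proof
    fix C
    show "vertical_lift A u w C =
        differential real_atlas (tangent_atlas A) \<gamma> 0 (tvec_of real_atlas 0 (UNIV, id) 1) C"
    proof (cases "C \<in> charts_at (tangent_atlas A) u")
      case True
      then have C: "C \<in> charts_at (tangent_atlas A) (\<gamma> 0)" by (simp add: \<gamma>0)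
      have D: "(lrep \<gamma> (UNIV, id) C has_derivative lderiv \<gamma> (UNIV, id) C 0) (at 0)"
        using lderiv_has_derivative[OF atlas_real atlas_tangent_atlas[OF A] s o C] by simp
      have "lderiv \<gamma> (UNIV, id) C 0 x = x *\<^sub>R lderiv \<gamma> (UNIV, id) C 0 1" for x
        using linear_scale[OF has_derivative_linear[OF D], of x 1] by simp
      then have "lderiv \<gamma> (UNIV, id) C 0 = (\<lambda>x. x *\<^sub>R lderiv \<gamma> (UNIV, id) C 0 1)" by (rule ext)
      then have "(lrep \<gamma> (UNIV, id) C has_vector_derivative lderiv \<gamma> (UNIV, id) C 0 1) (at 0)"
        using D by (simp add: has_vector_derivative_def)
      moreover have "lrep \<gamma> (UNIV, id) C = (\<lambda>t. snd C (fst u, snd u + t \<cdot>\<^sub>t w))"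
        by (simp add: lrep_def inv fun_eq_iff \<gamma>_def)
      ultimately have "vertical_lift A u w C = lderiv \<gamma> (UNIV, id) C 0 1"
        using True by (simp add: vertical_lift_def vector_derivative_at)
      then show ?thesis
        using differential_apply[OF atlas_real atlas_tangent_atlas[OF A] s tvec_of_tangent[OF atlas_real o] o C]
        by (simp add: tvec_of_same[OF atlas_real o])
    qed (simp add: vertical_lift_def differential_outside \<gamma>0)
  qed
  show "vertical_lift A u w (tchart c) = (0, w c)" if c: "c \<in> charts_at A (fst u)"
  proof -
    have "((\<lambda>t. (snd c (fst u), snd u c + t *\<^sub>R w c)) has_derivative (\<lambda>t. (0, t *\<^sub>R w c))) (at (0::real))"
      by (auto intro!: derivative_eq_intros)
    from fun_cong[OF frechet_derivative_at[OF this], of 1] have "lderiv \<gamma> (UNIV, id) (tchart c) 0 1 = (0, w c)"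
      by (simp add: lderiv_def rep)
    then show ?thesis
      unfolding eq
      using differential_apply[OF atlas_real atlas_tangent_atlas[OF A] s tvec_of_tangent[OF atlas_real o] o, of "tchart c"]
        tchart_charts_at[OF u c]
      by (simp add: tvec_of_same[OF atlas_real o] \<gamma>0)
  qed
qed

lemma vertical_lift_tangent:
  assumes u: "u \<in> points (tangent_atlas A)" and w: "w \<in> tangent_space A (fst u)"
  shows "vertical_lift A u w \<in> tangent_space (tangent_atlas A) u"
proof -
  have "tvec_of real_atlas 0 (UNIV, id) 1 \<in> tangent_space real_atlas 0"
    by (rule tvec_of_tangent[OF atlas_real]) (simp add: charts_at_real)
  from differential_tangent[OF atlas_real atlas_tangent_atlas[OF A] vertical_lift_differential(1)[OF u w] this]
  show ?thesis by (simp add: vertical_lift_differential(2)[OF u w] points_real)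
qed

lemma tangent_map_vertical_lift:
  assumes f: "smooth_map A A f"
    and u: "u \<in> points (tangent_atlas A)" and w: "w \<in> tangent_space A (fst u)"
  shows "differential (tangent_atlas A) (tangent_atlas A) (tangent_map A f) u (vertical_lift A u w)
       = vertical_lift A (tangent_map A f u) (differential A A f (fst u) w)"
proof -
  let ?\<gamma> = "\<lambda>t. (fst u, snd u + t \<cdot>\<^sub>t w)" and ?e = "tvec_of real_atlas 0 (UNIV, id) (1::real)"
  note T = atlas_tangent_atlas[OF A]
  have p: "fst u \<in> points A" "snd u \<in> tangent_space A (fst u)" using u points_tangent_atlas[OF A, of u] by simp_all
  have e: "?e \<in> tangent_space real_atlas 0" by (rule tvec_of_tangent[OF atlas_real]) (simp add: charts_at_real)
  have u': "tangent_map A f u \<in> points (tangent_atlas A)"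
    by (rule smooth_map_points[OF T T smooth_tangent_map[OF A f] u])
  have w': "differential A A f (fst u) w \<in> tangent_space A (fst (tangent_map A f u))"
    using differential_tangent[OF A A f w p(1)] by (simp add: tangent_map_def)
  have "tangent_map A f \<circ> ?\<gamma> =
      (\<lambda>t. (fst (tangent_map A f u), snd (tangent_map A f u) + t \<cdot>\<^sub>t differential A A f (fst u) w))"
    by (simp only: fun_eq_iff comp_apply tangent_map_def fst_conv snd_conv differential_add[OF A A f p tangent_space_scale[OF A w]]
        differential_scale[OF A A f p(1) w] simp_thms)
  then show ?thesis
    using differential_compose[OF atlas_real T T vertical_lift_differential(1)[OF u w] smooth_tangent_map[OF A f] _ e]
    by (simp add: vertical_lift_differential(2)[OF u w] vertical_lift_differential(2)[OF u' w'] points_real)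
qed

end

section \<open>Existence and uniqueness of horizontal lifts\<close>

context
  fixes A :: "('a, 'e::euclidean_space) chart set"
    and nabla :: "('a, 'e) vfield \<Rightarrow> ('a, 'e) vfield \<Rightarrow> ('a, 'e) vfield"
  assumes M: "smooth_manifold A" and nabla: "affine_connection A nabla"
begin

private lemma A': "atlas A"
  using M by (rule smooth_manifold_atlas)

lemma horizontal_space_tangent:
  assumes u: "u \<in> points (tangent_atlas A)" and \<xi>: "\<xi> \<in> horizontal_space A nabla u"
  shows "\<xi> \<in> tangent_space (tangent_atlas A) u"
proof -
  obtain X Y where XY: "smooth_vfield A X" "smooth_vfield A Y" "Y (fst u) = snd u"
    "\<xi> = differential A (tangent_atlas A) (\<lambda>q. (q, Y q)) (fst u) (X (fst u))"
    using \<xi> unfolding horizontal_space_def by (elim CollectE exE conjE) (rule that; assumption)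
  have p: "fst u \<in> points A" using u points_tangent_atlas[OF A', of u] by simp_all
  show ?thesis
    using differential_tangent[OF A' atlas_tangent_atlas[OF A'] smooth_section[OF A' XY(2)]
        smooth_vfield_tangent[OF A' XY(1) p] p]
    unfolding XY(3,4) prod.collapse .
qed

text \<open>Equal projections mean that \<open>X\<close> and \<open>X'\<close> agree at the point,
  so by tensoriality both sections have vanishing covariant derivative along \<open>X\<close>. Their
  difference \<open>W\<close> vanishes at the point, hence by \<open>nabla_vanishing\<close> so does
  its coordinate derivative along \<open>X\<close>, and the two differentials agree in a bundle
  chart.\<close>

lemma horizontal_lift_unique:
  assumes u: "u \<in> points (tangent_atlas A)"
    and \<xi>: "\<xi> \<in> horizontal_space A nabla u" and \<eta>: "\<eta> \<in> horizontal_space A nabla u"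
    and eq: "proj_differential A u \<xi> = proj_differential A u \<eta>"
  shows "\<xi> = \<eta>"
proof -
  let ?p = "fst u"
  have p: "?p \<in> points A" using u points_tangent_atlas[OF A', of u] by simp_all
  obtain c where c: "c \<in> charts_at A ?p" using charts_at_nonempty[OF p] by auto
  then have c': "c \<in> A" "?p \<in> fst c" by (simp_all add: charts_at_iff)
  obtain X Y where XY: "smooth_vfield A X" "smooth_vfield A Y" "Y ?p = snd u" "nabla X Y ?p = 0"
    "\<xi> = differential A (tangent_atlas A) (\<lambda>q. (q, Y q)) ?p (X ?p)"
    using \<xi> unfolding horizontal_space_def by (elim CollectE exE conjE) (rule that; assumption)
  obtain X' Y' where XY': "smooth_vfield A X'" "smooth_vfield A Y'" "Y' ?p = snd u" "nabla X' Y' ?p = 0"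
    "\<eta> = differential A (tangent_atlas A) (\<lambda>q. (q, Y' q)) ?p (X' ?p)"
    using \<eta> unfolding horizontal_space_def by (elim CollectE exE conjE) (rule that; assumption)
  note t = smooth_vfield_tangent[OF A' _ p]
  have "X ?p = X' ?p"
    using eq proj_differential_section[OF A' XY(2) p t[OF XY(1)]] proj_differential_section[OF A' XY'(2) p t[OF XY'(1)]]
    unfolding XY(3,5) XY'(3,5) prod.collapse by metis
  define W where "W = (\<lambda>q. Y q + (-1) \<cdot>\<^sub>t Y' q)"
  have sW: "smooth_vfield A W" unfolding W_def by (rule smooth_vfield_diff[OF M nabla XY(2) XY'(2)])
  have sY': "smooth_vfield A (\<lambda>q. (-1) \<cdot>\<^sub>t Y' q)"
    by (rule smooth_vfield_scale[OF A' smooth_fun_const[OF A'] XY'(2)])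
  have "nabla X Y' ?p = 0"
    using nabla_tensorial[OF M nabla XY(1) XY'(1) XY'(2) p \<open>X ?p = X' ?p\<close>] XY'(4) by simp
  moreover have "dir_deriv A (\<lambda>q. -1) ?p (X ?p) = 0"
    by (simp add: dir_deriv_eq[OF A' smooth_fun_const[OF A'] c t[OF XY(1)]] comp_def)
  ultimately have "nabla X (\<lambda>q. (-1) \<cdot>\<^sub>t Y' q) ?p = 0"
    using nabla_leibniz[OF M nabla XY(1) XY'(2) XY(1) smooth_fun_const[OF A', of "-1"] p] by simp
  then have "nabla X W ?p = 0"
    unfolding W_def using nabla_add_right[OF M nabla XY(1,2) sY' smooth_fun_const[OF A'] p] XY(4) by simp
  moreover have "W ?p = 0" using XY(3) XY'(3) by (simp add: W_def tscale_def fun_eq_iff)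
  ultimately have "frechet_derivative (\<lambda>x. W (chart_inv c x) c) (at (snd c ?p)) (X ?p c) = 0"
    using nabla_vanishing[OF M nabla XY(1) sW _ c] by simp
  moreover have "frechet_derivative (\<lambda>x. W (chart_inv c x) c) (at (snd c ?p)) (X ?p c) =
      frechet_derivative (\<lambda>x. Y (chart_inv c x) c) (at (snd c ?p)) (X ?p c) -
      frechet_derivative (\<lambda>x. Y' (chart_inv c x) c) (at (snd c ?p)) (X ?p c)"
  proof -
    have "smooth_on (snd c ` fst c) (\<lambda>x. Y (chart_inv c x) c)" "smooth_on (snd c ` fst c) (\<lambda>x. Y' (chart_inv c x) c)"
      using XY(2) XY'(2) c' by (simp_all add: smooth_vfield_def)
    then have "((\<lambda>x. Y (chart_inv c x) c - Y' (chart_inv c x) c) has_derivative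
       (\<lambda>e. frechet_derivative (\<lambda>x. Y (chart_inv c x) c) (at (snd c ?p)) e -
         frechet_derivative (\<lambda>x. Y' (chart_inv c x) c) (at (snd c ?p)) e)) (at (snd c ?p))"
      using c' by (intro has_derivative_diff smooth_on_has_derivative[of "snd c ` fst c"]) auto
    from frechet_derivative_at[OF this] show ?thesis by (simp add: W_def tscale_apply fun_eq_iff)
  qed
  ultimately have "\<xi> (bchart A id c c) = \<eta> (bchart A id c c)"
    unfolding XY(5) XY'(5) section_differential[OF A' XY(2) t[OF XY(1)] c]
      section_differential[OF A' XY'(2) t[OF XY'(1)] c]
    using \<open>X ?p = X' ?p\<close> by simp
  then show ?thesis
    by (rule tangent_space_eqI[OF horizontal_space_tangent[OF u \<xi>] horizontal_space_tangent[OF u \<eta>]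
          tchart_charts_at[OF A' u c]])
qed

text \<open>Any section \<open>Y\<close> through \<open>u\<close> is corrected by \<open>h\<close>
  times a field \<open>Z\<close> with value \<open>nabla X Y\<close> at the point. Since
  \<open>h\<close> vanishes there, the section still passes through \<open>u\<close>. A function
  with nonzero derivative along \<open>w\<close> exists only for nonzero \<open>w\<close>; for
  \<open>w = 0\<close> tensoriality already gives the claim.\<close>

lemma horizontal_lift_exists:
  assumes u: "u \<in> points (tangent_atlas A)" and w: "w \<in> tangent_space A (fst u)"
  shows "\<exists>\<xi>\<in>horizontal_space A nabla u. proj_differential A u \<xi> = w"
proof -
  let ?p = "fst u"
  have p: "?p \<in> points A" "snd u \<in> tangent_space A ?p" using u points_tangent_atlas[OF A', of u] by simp_all
  obtain c where c: "c \<in> charts_at A ?p" using charts_at_nonempty[OF p(1)] by auto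
  obtain X where X: "smooth_vfield A X" "X ?p = w" using exists_vfield[OF M p(1) w] .
  obtain Y where Y: "smooth_vfield A Y" "Y ?p = snd u" using exists_vfield[OF M p(1,2)] .
  have "\<exists>Y. smooth_vfield A Y \<and> Y ?p = snd u \<and> nabla X Y ?p = 0"
  proof (cases "w = 0")
    case True
    then show ?thesis using nabla_tensorial_0[OF M nabla X(1) _ Y(1) p(1)] X Y by auto
  next
    case False
    have z: "nabla X Y ?p \<in> tangent_space A ?p"
      by (rule smooth_vfield_tangent[OF A' nabla_smooth[OF M nabla X(1) Y(1)] p(1)])
    obtain Z where Z: "smooth_vfield A Z" "Z ?p = nabla X Y ?p" using exists_vfield[OF M p(1) z] .
    have wc: "w c \<noteq> 0" using False tangent_space_eqI[OF w tangent_space_0[OF A'] c] by auto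
    \<comment> \<open>Dividing by the squared coordinate length of \<open>w\<close> makes the
      derivative of \<open>h\<close> along \<open>w\<close> equal to -1, so the Leibniz term cancels
      \<open>nabla X Y\<close>.\<close>
    obtain h where h: "smooth_fun A h" "h ?p = 0"
      "\<And>v. v \<in> tangent_space A ?p \<Longrightarrow> dir_deriv A h ?p v = v c \<bullet> ((- inverse (w c \<bullet> w c)) *\<^sub>R w c)"
      using exists_linear_fun[OF M c] by blast
    have "dir_deriv A h ?p w = -1" using h(3)[OF w] wc by simp
    then have "nabla X (\<lambda>q. h q \<cdot>\<^sub>t Z q) ?p = (-1) \<cdot>\<^sub>t nabla X Y ?p"
      using nabla_leibniz[OF M nabla X(1) Z(1) X(1) h(1) p(1)] h(2) X(2) Z(2) by simp
    then have "nabla X (\<lambda>q. Y q + h q \<cdot>\<^sub>t Z q) ?p = 0"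
      using nabla_add_right[OF M nabla X(1) Y(1) smooth_vfield_scale[OF A' h(1) Z(1)] smooth_fun_const[OF A'] p(1)]
      by (simp flip: tvec_diff)
    moreover have "smooth_vfield A (\<lambda>q. Y q + h q \<cdot>\<^sub>t Z q)"
      by (rule smooth_vfield_add[OF A' Y(1) smooth_vfield_scale[OF A' h(1) Z(1)]])
    moreover have "Y ?p + h ?p \<cdot>\<^sub>t Z ?p = snd u" using h(2) Y(2) by simp
    ultimately show ?thesis by (intro exI[of _ "\<lambda>q. Y q + h q \<cdot>\<^sub>t Z q"]) simp
  qed
  then obtain Y' where Y': "smooth_vfield A Y'" "Y' ?p = snd u" "nabla X Y' ?p = 0" by blast
  have "differential A (tangent_atlas A) (\<lambda>q. (q, Y' q)) ?p (X ?p) \<in> horizontal_space A nabla u"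
    unfolding horizontal_space_def using X(1) Y' by (intro CollectI exI conjI) simp_all
  moreover have "proj_differential A u (differential A (tangent_atlas A) (\<lambda>q. (q, Y' q)) ?p (X ?p)) = w"
    using proj_differential_section[OF A' Y'(1) p(1) w] unfolding X(2) Y'(2) prod.collapse .
  ultimately show ?thesis by blast
qed

lemma horizontal_lift_eqI:
  assumes u: "u \<in> points (tangent_atlas A)"
    and \<xi>: "\<xi> \<in> horizontal_space A nabla u" "proj_differential A u \<xi> = w"
  shows "horizontal_lift A nabla u w = \<xi>"
  unfolding horizontal_lift_def
proof (rule the_equality)
  fix \<eta> assume "\<eta> \<in> horizontal_space A nabla u \<and> proj_differential A u \<eta> = w"
  then show "\<eta> = \<xi>" using horizontal_lift_unique[OF u _ \<xi>(1)] \<xi>(2) by simp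
qed (simp add: \<xi>)

lemma horizontal_lift:
  assumes u: "u \<in> points (tangent_atlas A)" and w: "w \<in> tangent_space A (fst u)"
  shows "horizontal_lift A nabla u w \<in> horizontal_space A nabla u"
    and "proj_differential A u (horizontal_lift A nabla u w) = w"
    and "horizontal_lift A nabla u w \<in> tangent_space (tangent_atlas A) u"
proof -
  obtain \<xi> where \<xi>: "\<xi> \<in> horizontal_space A nabla u" "proj_differential A u \<xi> = w"
    using horizontal_lift_exists[OF u w] by blast
  then show "horizontal_lift A nabla u w \<in> horizontal_space A nabla u"
    "proj_differential A u (horizontal_lift A nabla u w) = w"
    "horizontal_lift A nabla u w \<in> tangent_space (tangent_atlas A) u"
    using horizontal_lift_eqI[OF u \<xi>] horizontal_space_tangent[OF u \<xi>(1)] by simp_all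
qed

section \<open>The splitting into horizontal and vertical parts\<close>

lemma vertical_lift_inj:
  assumes u: "u \<in> points (tangent_atlas A)"
    and w: "w \<in> tangent_space A (fst u)" and z: "z \<in> tangent_space A (fst u)"
    and eq: "vertical_lift A u w = vertical_lift A u z"
  shows "w = z"
proof -
  obtain c where c: "c \<in> charts_at A (fst u)"
    using charts_at_nonempty[of "fst u" A] u points_tangent_atlas[OF A', of u] by auto
  show ?thesis
    using arg_cong[OF eq, of "\<lambda>\<xi>. \<xi> (bchart A id c c)"]
    by (intro tangent_space_eqI[OF w z c])
      (simp add: vertical_lift_differential(3)[OF A' u w c] vertical_lift_differential(3)[OF A' u z c])
qed

lemma ver_part_eqI:
  assumes u: "u \<in> points (tangent_atlas A)" and z: "z \<in> tangent_space A (fst u)"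
    and eq: "\<xi> = horizontal_lift A nabla u (hor_part A u \<xi>) + vertical_lift A u z"
  shows "ver_part A nabla u \<xi> = z"
  unfolding ver_part_def
proof (rule the_equality)
  fix z' assume z': "z' \<in> tangent_space A (fst u) \<and>
    \<xi> = horizontal_lift A nabla u (hor_part A u \<xi>) + vertical_lift A u z'"
  then have "horizontal_lift A nabla u (hor_part A u \<xi>) + vertical_lift A u z' =
      horizontal_lift A nabla u (hor_part A u \<xi>) + vertical_lift A u z" using eq by metis
  then have "vertical_lift A u z' = vertical_lift A u z" by (rule add_left_imp_eq)
  then show "z' = z" using vertical_lift_inj[OF u _ z] z' by simp
qed (use z eq in blast)

lemma hor_part_tangent:
  "u \<in> points (tangent_atlas A) \<Longrightarrow> \<xi> \<in> tangent_space (tangent_atlas A) u \<Longrightarrow>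
    hor_part A u \<xi> \<in> tangent_space A (fst u)"
  unfolding hor_part_def by (rule proj_differential_tangent[OF A'])

lemma ver_part:
  assumes u: "u \<in> points (tangent_atlas A)" and \<xi>: "\<xi> \<in> tangent_space (tangent_atlas A) u"
  shows "ver_part A nabla u \<xi> \<in> tangent_space A (fst u)"
    and "horizontal_lift A nabla u (hor_part A u \<xi>) + vertical_lift A u (ver_part A nabla u \<xi>) = \<xi>"
proof -
  let ?h = "horizontal_lift A nabla u (hor_part A u \<xi>)"
  note T = atlas_tangent_atlas[OF A']
  obtain c where c: "c \<in> charts_at A (fst u)"
    using charts_at_nonempty[of "fst u" A] u points_tangent_atlas[OF A', of u] by auto
  note h = horizontal_lift[OF u hor_part_tangent[OF u \<xi>]]
  \<comment> \<open>\<open>\<xi>\<close> and the horizontal lift of its projection have the same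
    base component, so they differ in the fibre component alone; \<open>z\<close> is the tangent
    vector with that coordinate.\<close>
  define z where "z = tvec_of A (fst u) c (snd (\<xi> (bchart A id c c)) - snd (?h (bchart A id c c)))"
  have z: "z \<in> tangent_space A (fst u)" unfolding z_def by (rule tvec_of_tangent[OF A' c])
  have "fst (?h (bchart A id c c)) = fst (\<xi> (bchart A id c c))"
    using h(2) proj_differential_apply[OF A' u \<xi> c] proj_differential_apply[OF A' u h(3) c]
    by (simp add: hor_part_def)
  then have "\<xi> (bchart A id c c) = (?h + vertical_lift A u z) (bchart A id c c)"
    using vertical_lift_differential(3)[OF A' u z c]
    by (simp add: prod_eq_iff z_def tvec_of_same[OF A' c])
  then have eq: "\<xi> = ?h + vertical_lift A u z"
    by (rule tangent_space_eqI[OF \<xi> tangent_space_add[OF T h(3) vertical_lift_tangent[OF A' u z]]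
          tchart_charts_at[OF A' u c]])
  from ver_part_eqI[OF u z eq] have "ver_part A nabla u \<xi> = z" .
  then show "ver_part A nabla u \<xi> \<in> tangent_space A (fst u)" "?h + vertical_lift A u (ver_part A nabla u \<xi>) = \<xi>"
    using z eq[symmetric] by (simp_all only:)
qed

end

section \<open>Isometries\<close>

text \<open>The converse of \<open>smooth_section\<close>: a pushed-forward field, seen as a
  section, is a composition of smooth maps, so its smoothness needs no computation in
  charts.\<close>

lemma smooth_section_vfield:
  assumes A: "atlas A" and s: "smooth_map A (tangent_atlas A) (\<lambda>q. (q, Y q))"
  shows "smooth_vfield A Y"
  unfolding smooth_vfield_def
proof (intro conjI ballI)
  note T = atlas_tangent_atlas[OF A]
  show tan: "Y q \<in> tangent_space A q" if "q \<in> points A" for q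
    using smooth_map_points[OF A T s that] points_tangent_atlas[OF A, of "(q, Y q)"] by simp
  fix c assume c: "c \<in> A"
  have o: "open (snd c ` fst c)" by (rule atlas_open[OF A c])
  have "(q, Y q) \<in> fst (tchart A c)" if "q \<in> fst c" for q
    using that c tan[of q] by (auto simp: in_bchart points_def)
  then have dom: "ldom (\<lambda>q. (q, Y q)) c (tchart A c) = snd c ` fst c" by (auto simp: ldom_def)
  have "tchart A c \<in> tangent_atlas A" using c by (simp add: tangent_atlas_image[OF A])
  from smooth_map_ldom(2)[OF A T s c this]
  have "smooth_on (snd c ` fst c) (\<lambda>x. snd (lrep (\<lambda>q. (q, Y q)) c (tchart A c) x))"
    unfolding dom
    by (rule smooth_on_compose[OF o _ smooth_on_bounded_linear[OF open_UNIV bounded_linear_snd]]) simp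
  moreover have "snd (lrep (\<lambda>q. (q, Y q)) c (tchart A c) x) = Y (chart_inv c x) c" for x
    by (simp add: lrep_def snd_bchart)
  ultimately show "smooth_on (snd c ` fst c) (\<lambda>x. Y (chart_inv c x) c)" by simp
qed

lemma differential_diff:
  assumes "atlas A" "atlas B" "smooth_map A B f" "p \<in> points A" "v \<in> tangent_space A p" "w \<in> tangent_space A p"
  shows "differential A B f p (v - w) = differential A B f p v - differential A B f p w"
  using assms unfolding tvec_diff
  by (simp add: differential_add differential_scale tangent_space_scale)

section \<open>Riemannian metrics\<close>

context
  fixes A :: "('a, 'e::euclidean_space) chart set"
    and g :: "'a \<Rightarrow> ('a, 'e) tvec \<Rightarrow> ('a, 'e) tvec \<Rightarrow> real"
  assumes A: "atlas A" and g: "riemannian_metric A g"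
begin

lemma metric_rules:
  assumes "p \<in> points A" "v \<in> tangent_space A p" "w \<in> tangent_space A p" "z \<in> tangent_space A p"
  shows metric_sym: "g p v w = g p w v"
    and metric_add: "g p (v + w) z = g p v z + g p w z"
    and metric_scale: "g p (a \<cdot>\<^sub>t v) w = a * g p v w"
    and metric_pos: "v \<noteq> 0 \<Longrightarrow> g p v v > 0"
  using g assms unfolding riemannian_metric_def by blast+

lemma metric_diff:
  assumes "p \<in> points A" "v \<in> tangent_space A p" "w \<in> tangent_space A p" "z \<in> tangent_space A p"
  shows "g p (v - w) z = g p v z - g p w z"
  unfolding tvec_diff
  using metric_add[OF assms(1,2) tangent_space_scale[OF A assms(3), of "-1"] assms(4)]
    metric_scale[OF assms(1,3,4,4), of "-1"] by simp

lemma metric_sum: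
  assumes p: "p \<in> points A" and v: "\<And>i. v i \<in> tangent_space A p" and z: "z \<in> tangent_space A p"
    and fin: "finite I"
  shows "g p (\<Sum>i\<in>I. a i \<cdot>\<^sub>t v i) z = (\<Sum>i\<in>I. a i * g p (v i) z)"
proof -
  have sum: "(\<Sum>i\<in>J. a i \<cdot>\<^sub>t v i) \<in> tangent_space A p" if "finite J" for J
    using that
  proof (induction J rule: finite_induct)
    case empty
    show ?case unfolding sum.empty by (rule tangent_space_0[OF A])
  next
    case (insert i J)
    show ?case unfolding sum.insert[OF insert.hyps]
      by (intro tangent_space_add[OF A] tangent_space_scale[OF A] v insert.IH)
  qed
  have "g p (0 \<cdot>\<^sub>t z) z = 0" using metric_scale[OF p z z z, of 0] by simp
  then have 0: "g p 0 z = 0" unfolding tscale_simps .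
  show ?thesis
    using fin
  proof (induction I rule: finite_induct)
    case empty
    show ?case unfolding sum.empty by (rule 0)
  next
    case (insert i I)
    show ?case unfolding sum.insert[OF insert.hyps]
        metric_add[OF p tangent_space_scale[OF A v] sum[OF insert.hyps(1)] z] insert.IH
        metric_scale[OF p v z z] ..
  qed
qed

text \<open>\<open>riemannian_metric\<close> asks for smoothness of the coefficients in coordinate
  frames only, so both fields are expanded in the frame; symmetry brings the second field into the
  linear argument.\<close>

lemma smooth_fun_metric:
  assumes Y: "smooth_vfield A Y" and Z: "smooth_vfield A Z"
  shows "smooth_fun A (\<lambda>q. g q (Y q) (Z q))"
  unfolding smooth_fun_def
proof
  fix c assume c: "c \<in> A"
  have o: "open (snd c ` fst c)" by (rule atlas_open[OF A c])
  let ?e = "\<lambda>x i. tvec_of A (chart_inv c x) c i"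
  let ?G = "\<lambda>x. \<Sum>i\<in>Basis. (Y (chart_inv c x) c \<bullet> i) * (\<Sum>j\<in>Basis. (Z (chart_inv c x) c \<bullet> j) *
      g (chart_inv c x) (?e x j) (?e x i))"
  have "((\<lambda>q. g q (Y q) (Z q)) \<circ> chart_inv c) x = ?G x" if x: "x \<in> snd c ` fst c" for x
  proof -
    let ?q = "chart_inv c x"
    have cq: "c \<in> charts_at A ?q" using x c by (simp add: charts_at_iff chart_inv_in)
    note q = pointsI[OF cq]
    note YZ = smooth_vfield_tangent[OF A Y q] smooth_vfield_tangent[OF A Z q]
    note e = tvec_of_tangent[OF A cq]
    have "g ?q (Y ?q) (Z ?q) = g ?q (\<Sum>i\<in>Basis. (Y ?q c \<bullet> i) \<cdot>\<^sub>t ?e x i) (Z ?q)"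
      using tvec_basis_expansion[OF A cq YZ(1)] by simp
    also have "\<dots> = (\<Sum>i\<in>Basis. (Y ?q c \<bullet> i) * g ?q (?e x i) (Z ?q))"
      by (rule metric_sum[OF q e YZ(2) finite_Basis])
    also have "\<dots> = ?G x"
    proof (intro sum.cong refl)
      fix i :: 'e
      have "g ?q (?e x i) (Z ?q) = g ?q (\<Sum>j\<in>Basis. (Z ?q c \<bullet> j) \<cdot>\<^sub>t ?e x j) (?e x i)"
        using tvec_basis_expansion[OF A cq YZ(2)] metric_sym[OF q e YZ(2) YZ(2)] by simp
      also have "\<dots> = (\<Sum>j\<in>Basis. (Z ?q c \<bullet> j) * g ?q (?e x j) (?e x i))"
        by (rule metric_sum[OF q e e finite_Basis])
      finally show "(Y ?q c \<bullet> i) * g ?q (?e x i) (Z ?q) =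
        (Y ?q c \<bullet> i) * (\<Sum>j\<in>Basis. (Z ?q c \<bullet> j) * g ?q (?e x j) (?e x i))" by simp
    qed
    finally show ?thesis by simp
  qed
  moreover have "smooth_on (snd c ` fst c) ?G"
  proof (intro smooth_on_sum smooth_on_mult smooth_on_inner smooth_on_const o)
    show "smooth_on (snd c ` fst c) (\<lambda>x. Y (chart_inv c x) c)" "smooth_on (snd c ` fst c) (\<lambda>x. Z (chart_inv c x) c)"
      using Y Z c by (simp_all add: smooth_vfield_def)
    show "smooth_on (snd c ` fst c) (\<lambda>x. g (chart_inv c x) (?e x j) (?e x i))" for i j
      using conjunct2[OF g[unfolded riemannian_metric_def]] c by simp
  qed
  ultimately show "smooth_on (snd c ` fst c) ((\<lambda>q. g q (Y q) (Z q)) \<circ> chart_inv c)"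
    using smooth_on_cong[OF o, of "(\<lambda>q. g q (Y q) (Z q)) \<circ> chart_inv c" ?G] by simp
qed

end

section \<open>Push-forward of vector fields and of sections\<close>

context
  fixes A :: "('a, 'e::euclidean_space) chart set" and f f' :: "'a \<Rightarrow> 'a"
  assumes A: "atlas A" and f: "smooth_map A A f" and f': "smooth_map A A f'"
    and f'f: "\<forall>p\<in>points A. f' (f p) = p" and ff': "\<forall>p\<in>points A. f (f' p) = p"
begin

text \<open>The field f-related to \<open>X\<close>, with \<open>f'\<close> as the inverse of
  \<open>f\<close> on points.\<close>

definition pushforward :: "('a, 'e) vfield \<Rightarrow> ('a, 'e) vfield" where
  "pushforward X q = differential A A f (f' q) (X (f' q))"

lemma pushforward_image: "p \<in> points A \<Longrightarrow> pushforward X (f p) = differential A A f p (X p)"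
  by (simp add: pushforward_def f'f)

lemma smooth_pushforward:
  assumes X: "smooth_vfield A X"
  shows "smooth_vfield A (pushforward X)"
proof (rule smooth_section_vfield[OF A])
  note T = atlas_tangent_atlas[OF A]
  have "smooth_map A (tangent_atlas A) (tangent_map A f \<circ> ((\<lambda>q. (q, X q)) \<circ> f'))"
    by (intro smooth_map_compose[OF A A T f'] smooth_map_compose[OF A T T] smooth_section[OF A X]
        smooth_tangent_map[OF A f])
  then show "smooth_map A (tangent_atlas A) (\<lambda>q. (q, pushforward X q))"
    by (rule smooth_map_cong[OF A T, rotated]) (simp add: tangent_map_def pushforward_def ff')
qed

lemma dir_deriv_pushforward:
  assumes h: "smooth_fun A h" and X: "smooth_vfield A X" and p: "p \<in> points A"
  shows "dir_deriv A h (f p) (pushforward X (f p)) = dir_deriv A (h \<circ> f) p (X p)"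
  unfolding pushforward_image[OF p] by (rule dir_deriv_compose[OF A h f p smooth_vfield_tangent[OF A X p]])

lemma tangent_map_horizontal_section:
  assumes X: "smooth_vfield A X" and Y: "smooth_vfield A Y" and p: "p \<in> points A"
  shows "differential (tangent_atlas A) (tangent_atlas A) (tangent_map A f) (p, Y p)
           (differential A (tangent_atlas A) (\<lambda>q. (q, Y q)) p (X p))
       = differential A (tangent_atlas A) (\<lambda>q. (q, pushforward Y q)) (f p) (pushforward X (f p))"
proof -
  note T = atlas_tangent_atlas[OF A]
  note v = smooth_vfield_tangent[OF A X p]
  note sP = smooth_section[OF A smooth_pushforward[OF Y]]
  have "differential (tangent_atlas A) (tangent_atlas A) (tangent_map A f) (p, Y p)
      (differential A (tangent_atlas A) (\<lambda>q. (q, Y q)) p (X p)) =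
      differential A (tangent_atlas A) (tangent_map A f \<circ> (\<lambda>q. (q, Y q))) p (X p)"
    by (rule differential_compose[OF A T T smooth_section[OF A Y] smooth_tangent_map[OF A f] p v, symmetric])
  also have "\<dots> = differential A (tangent_atlas A) ((\<lambda>q. (q, pushforward Y q)) \<circ> f) p (X p)"
    by (rule differential_cong[OF A T _ smooth_map_compose[OF A A T f sP] p v])
      (simp add: tangent_map_def pushforward_image)
  also have "\<dots> = differential A (tangent_atlas A) (\<lambda>q. (q, pushforward Y q)) (f p) (pushforward X (f p))"
    unfolding pushforward_image[OF p] by (rule differential_compose[OF A A T f sP p v])
  finally show ?thesis .
qed

lemma proj_tangent_map:
  assumes u: "u \<in> points (tangent_atlas A)" and \<xi>: "\<xi> \<in> tangent_space (tangent_atlas A) u"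
  shows "proj_differential A (tangent_map A f u)
           (differential (tangent_atlas A) (tangent_atlas A) (tangent_map A f) u \<xi>)
       = differential A A f (fst u) (proj_differential A u \<xi>)"
proof -
  note T = atlas_tangent_atlas[OF A]
  have "fst \<circ> tangent_map A f = f \<circ> fst" by (simp add: fun_eq_iff tangent_map_def)
  then show ?thesis
    unfolding proj_differential_def
    using differential_compose[OF T T A smooth_tangent_map[OF A f] smooth_projection[OF A] u \<xi>]
      differential_compose[OF T A A smooth_projection[OF A] f u \<xi>] by simp
qed

end

section \<open>Isometries and the Levi-Civita connection\<close>

context
  fixes A :: "('a, 'e::euclidean_space) chart set"
    and g :: "'a \<Rightarrow> ('a, 'e) tvec \<Rightarrow> ('a, 'e) tvec \<Rightarrow> real"
    and nabla :: "('a, 'e) vfield \<Rightarrow> ('a, 'e) vfield \<Rightarrow> ('a, 'e) vfield"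
    and f f' :: "'a \<Rightarrow> 'a"
  assumes M: "smooth_manifold A" and g: "riemannian_metric A g" and lc: "levi_civita_connection A g nabla"
    and f: "smooth_map A A f" and f': "smooth_map A A f'"
    and f'f: "\<forall>p\<in>points A. f' (f p) = p" and ff': "\<forall>p\<in>points A. f (f' p) = p"
    and isometric: "\<forall>p\<in>points A. \<forall>v\<in>tangent_space A p. \<forall>w\<in>tangent_space A p.
      g (f p) (differential A A f p v) (differential A A f p w) = g p v w"
begin

private lemma A'': "atlas A"
  using M by (rule smooth_manifold_atlas)

private lemma nabla: "affine_connection A nabla"
  using lc by (simp add: levi_civita_connection_def)

private abbreviation (input) "push \<equiv> pushforward A f f'"

private lemmas iso = isometric[rule_format]
private lemmas push_smooth = smooth_pushforward[OF A'' f f' f'f ff']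
private lemmas push_image = pushforward_image[OF A'' f f' f'f ff']

text \<open>\<open>D\<close> is compared on global fields at one point. Positive definiteness is
  exploited by a field \<open>Z\<close> with \<open>push Z (f p) = D X Y\<close>, available because
  df is onto and every tangent vector extends to a global field.\<close>

lemma isometry_preserves_connection:
  assumes X: "smooth_vfield A X" and Y: "smooth_vfield A Y" and p: "p \<in> points A"
  shows "nabla (push X) (push Y) (f p) = differential A A f p (nabla X Y p)"
proof -
  let ?d = "differential A A f p"
  define D where "D X Y = nabla (push X) (push Y) (f p) - ?d (nabla X Y p)" for X Y
  have fp: "f p \<in> points A" by (rule smooth_map_points[OF A'' A'' f p])
  have tan: "nabla X Y p \<in> tangent_space A p" "?d (nabla X Y p) \<in> tangent_space A (f p)"
    "nabla (push X) (push Y) (f p) \<in> tangent_space A (f p)" "D X Y \<in> tangent_space A (f p)"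
    if "smooth_vfield A X" "smooth_vfield A Y" for X Y
  proof -
    show 1: "nabla X Y p \<in> tangent_space A p"
      by (rule smooth_vfield_tangent[OF A'' nabla_smooth[OF M nabla that] p])
    show 2: "?d (nabla X Y p) \<in> tangent_space A (f p)" by (rule differential_tangent[OF A'' A'' f 1 p])
    show 3: "nabla (push X) (push Y) (f p) \<in> tangent_space A (f p)"
      by (rule smooth_vfield_tangent[OF A'' nabla_smooth[OF M nabla push_smooth[OF that(1)] push_smooth[OF that(2)]] fp])
    show "D X Y \<in> tangent_space A (f p)" unfolding D_def by (rule tangent_space_diff[OF A'' 3 2])
  qed
  have sym: "D X Y = D Y X" if X: "smooth_vfield A X" and Y: "smooth_vfield A Y" for X Y
  proof -
    have "D X Y - D Y X = 0"
    proof (rule tangent_vector_eq_0I[OF M fp tangent_space_diff[OF A'' tan(4)[OF X Y] tan(4)[OF Y X]]])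
      fix h assume h: "smooth_fun A h"
      have hf: "smooth_fun A (h \<circ> f)" by (rule smooth_fun_compose[OF A'' h f])
      \<comment> \<open>The chain rule is used twice: at every point, to identify the inner
        derivative composed with \<open>f\<close>, and then at \<open>p\<close>, for the outer
        derivative.\<close>
      have second: "dir_deriv A (\<lambda>q. dir_deriv A h q (push Y q)) (f p) (push X (f p)) =
          dir_deriv A (\<lambda>q. dir_deriv A (h \<circ> f) q (Y q)) p (X p)"
        if X: "smooth_vfield A X" and Y: "smooth_vfield A Y" for X Y
      proof -
        have k: "smooth_fun A (\<lambda>q. dir_deriv A h q (push Y q))"
          by (rule smooth_fun_dir_deriv[OF A'' h push_smooth[OF Y]])
        have "dir_deriv A (\<lambda>q. dir_deriv A h q (push Y q)) (f p) (push X (f p)) =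
            dir_deriv A ((\<lambda>q. dir_deriv A h q (push Y q)) \<circ> f) p (X p)"
          by (rule dir_deriv_pushforward[OF A'' f f' f'f ff' k X p])
        also have "\<dots> = dir_deriv A (\<lambda>q. dir_deriv A (h \<circ> f) q (Y q)) p (X p)"
        proof (rule dir_deriv_cong[OF A'' smooth_fun_dir_deriv[OF A'' hf Y] _ p smooth_vfield_tangent[OF A'' X p]])
          fix q assume q: "q \<in> points A"
          show "dir_deriv A (h \<circ> f) q (Y q) = ((\<lambda>q. dir_deriv A h q (push Y q)) \<circ> f) q"
            using dir_deriv_pushforward[OF A'' f f' f'f ff' h Y q] by simp
        qed
        finally show ?thesis .
      qed
      have tf: "torsion_free A nabla" using lc by (simp add: levi_civita_connection_def)
      have "dir_deriv A h (f p) (nabla (push X) (push Y) (f p) - nabla (push Y) (push X) (f p)) =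
          dir_deriv A (\<lambda>q. dir_deriv A h q (push Y q)) (f p) (push X (f p)) -
          dir_deriv A (\<lambda>q. dir_deriv A h q (push X q)) (f p) (push Y (f p))"
        by (rule tf[unfolded torsion_free_def, rule_format]) (simp_all add: push_smooth X Y h fp)
      also have "\<dots> = dir_deriv A (h \<circ> f) p (nabla X Y p - nabla Y X p)"
        unfolding second[OF X Y] second[OF Y X]
        by (rule tf[unfolded torsion_free_def, rule_format, symmetric]) (use X Y hf p in \<open>simp_all add: comp_def\<close>)
      also have "\<dots> = dir_deriv A h (f p) (?d (nabla X Y p - nabla Y X p))"
        by (rule dir_deriv_compose[OF A'' h f p tangent_space_diff[OF A'' tan(1)[OF X Y] tan(1)[OF Y X]], symmetric])
      also have "?d (nabla X Y p - nabla Y X p) = ?d (nabla X Y p) - ?d (nabla Y X p)"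
        by (rule differential_diff[OF A'' A'' f p tan(1)[OF X Y] tan(1)[OF Y X]])
      finally show "dir_deriv A h (f p) (D X Y - D Y X) = 0"
        unfolding dir_deriv_diff[OF A'' h fp tan(4)[OF X Y] tan(4)[OF Y X]]
        unfolding D_def
          dir_deriv_diff[OF A'' h fp tan(3)[OF X Y] tan(2)[OF X Y]]
          dir_deriv_diff[OF A'' h fp tan(3)[OF Y X] tan(2)[OF Y X]]
          dir_deriv_diff[OF A'' h fp tan(3)[OF X Y] tan(3)[OF Y X]]
          dir_deriv_diff[OF A'' h fp tan(2)[OF X Y] tan(2)[OF Y X]]
        by linarith
    qed
    then show ?thesis by simp
  qed
  have anti: "g (f p) (D X Y) (push Z (f p)) = - g (f p) (D X Z) (push Y (f p))"
    if X: "smooth_vfield A X" and Y: "smooth_vfield A Y" and Z: "smooth_vfield A Z" for X Y Z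
  proof -
    have mc: "metric_compatible A g nabla" using lc by (simp add: levi_civita_connection_def)
    note P = push_smooth[OF X] push_smooth[OF Y] push_smooth[OF Z]
    note Yp = smooth_vfield_tangent[OF A'' Y p] and Zp = smooth_vfield_tangent[OF A'' Z p]
    note PYp = smooth_vfield_tangent[OF A'' P(2) fp] and PZp = smooth_vfield_tangent[OF A'' P(3) fp]
    have "g (f p) (nabla (push X) (push Y) (f p)) (push Z (f p)) + g (f p) (push Y (f p)) (nabla (push X) (push Z) (f p)) =
        dir_deriv A (\<lambda>q. g q (push Y q) (push Z q)) (f p) (push X (f p))"
      by (rule mc[unfolded metric_compatible_def, rule_format, symmetric]) (simp_all add: P fp)
    also have "\<dots> = dir_deriv A ((\<lambda>q. g q (push Y q) (push Z q)) \<circ> f) p (X p)"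
      by (rule dir_deriv_pushforward[OF A'' f f' f'f ff' smooth_fun_metric[OF A'' g P(2,3)] X p])
    also have "\<dots> = dir_deriv A (\<lambda>q. g q (Y q) (Z q)) p (X p)"
    proof (rule dir_deriv_cong[OF A'' smooth_fun_metric[OF A'' g Y Z] _ p smooth_vfield_tangent[OF A'' X p]])
      fix q assume q: "q \<in> points A"
      show "g q (Y q) (Z q) = ((\<lambda>q. g q (push Y q) (push Z q)) \<circ> f) q"
        using iso[OF q smooth_vfield_tangent[OF A'' Y q] smooth_vfield_tangent[OF A'' Z q]]
        by (simp add: push_image[OF q])
    qed
    also have "\<dots> = g p (nabla X Y p) (Z p) + g p (Y p) (nabla X Z p)"
      by (rule mc[unfolded metric_compatible_def, rule_format]) (simp_all add: X Y Z p)
    also have "\<dots> = g (f p) (?d (nabla X Y p)) (push Z (f p)) + g (f p) (push Y (f p)) (?d (nabla X Z p))"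
      by (simp add: push_image[OF p] iso[OF p tan(1)[OF X Y] Zp] iso[OF p Yp tan(1)[OF X Z]])
    finally show ?thesis
      unfolding D_def metric_diff[OF A'' g fp tan(3)[OF X Y] tan(2)[OF X Y] PZp]
        metric_diff[OF A'' g fp tan(3)[OF X Z] tan(2)[OF X Z] PYp]
        metric_sym[OF A'' g fp PYp tan(3)[OF X Z] PYp] metric_sym[OF A'' g fp PYp tan(2)[OF X Z] PYp]
      by simp
  qed
  have zero: "g (f p) (D X Y) (push Z (f p)) = 0"
    if X: "smooth_vfield A X" and Y: "smooth_vfield A Y" and Z: "smooth_vfield A Z" for X Y Z
  proof -
    \<comment> \<open>Alternating the two symmetries permutes \<open>X\<close>, \<open>Y\<close>,
      \<open>Z\<close> cyclically. Three rounds lead back to the starting expression with three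
      changes of sign, so it is its own negative.\<close>
    have "g (f p) (D X Y) (push Z (f p)) = - g (f p) (D Z X) (push Y (f p))"
      using anti[OF X Y Z] sym[OF X Z] by simp
    also have "\<dots> = g (f p) (D Y Z) (push X (f p))"
      using anti[OF Z X Y] sym[OF Z Y] by simp
    also have "\<dots> = - g (f p) (D X Y) (push Z (f p))"
      using anti[OF Y Z X] sym[OF Y X] by simp
    finally show ?thesis by simp
  qed
  have "D X Y = 0"
  proof (rule ccontr)
    assume "D X Y \<noteq> 0"
    then have pos: "g (f p) (D X Y) (D X Y) > 0"
      using metric_pos[OF A'' g fp tan(4)[OF X Y] tan(4)[OF X Y] tan(4)[OF X Y]] by simp
    have "differential A A f' (f p) (D X Y) \<in> tangent_space A p"
      using differential_tangent[OF A'' A'' f' tan(4)[OF X Y] fp] f'f[rule_format, OF p] by simp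
    then obtain Z where Z: "smooth_vfield A Z" "Z p = differential A A f' (f p) (D X Y)"
      using exists_vfield[OF M p] by blast
    have "diffeomorphism A A f" by (rule diffeomorphismI[OF A'' A'' f f']) (simp_all add: f'f ff')
    then have "differential A A f (f' (f p)) (differential A A f' (f p) (D X Y)) = D X Y"
      by (rule diffeomorphism_differential_inverse'[OF A'' _ f' _ fp tan(4)[OF X Y]]) (simp add: ff')
    then have "push Z (f p) = D X Y"
      using f'f[rule_format, OF p] by (simp add: push_image[OF p] Z(2))
    then show False using zero[OF X Y Z(1)] pos by simp
  qed
  then show ?thesis by (simp add: D_def)
qed

section \<open>The differential of f_* at a point and the splitting\<close>

context
  fixes u :: "('a, 'e) tpoint"
  assumes u: "u \<in> points (tangent_atlas A)"
begin

private abbreviation (input) "\<Phi> \<equiv> differential (tangent_atlas A) (tangent_atlas A) (tangent_map A f) u"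

private lemma p: "fst u \<in> points A" "snd u \<in> tangent_space A (fst u)"
  using u points_tangent_atlas[OF A'', of u] by simp_all

private lemma u': "tangent_map A f u \<in> points (tangent_atlas A)"
  by (rule smooth_map_points[OF atlas_tangent_atlas[OF A''] atlas_tangent_atlas[OF A''] smooth_tangent_map[OF A'' f] u])

private lemma fst_tangent_map: "fst (tangent_map A f u) = f (fst u)"
  by (simp add: tangent_map_def)

lemma tangent_map_horizontal_space:
  assumes \<xi>: "\<xi> \<in> horizontal_space A nabla u"
  shows "\<Phi> \<xi> \<in> horizontal_space A nabla (tangent_map A f u)"
proof -
  obtain X Y where XY: "smooth_vfield A X" "smooth_vfield A Y" "Y (fst u) = snd u" "nabla X Y (fst u) = 0"
    "\<xi> = differential A (tangent_atlas A) (\<lambda>q. (q, Y q)) (fst u) (X (fst u))"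
    using \<xi> unfolding horizontal_space_def by (elim CollectE exE conjE) (rule that; assumption)
  have "push Y (f (fst u)) = snd (tangent_map A f u)"
    unfolding push_image[OF p(1)] XY(3) by (simp add: tangent_map_def)
  moreover have "nabla (push X) (push Y) (f (fst u)) = 0"
  proof -
    \<comment> \<open>That df maps 0 to 0 is read off from homogeneity with the factor 0.\<close>
    have "differential A A f (fst u) (0 \<cdot>\<^sub>t 0) = 0 \<cdot>\<^sub>t differential A A f (fst u) 0"
      by (rule differential_scale[OF A'' A'' f p(1) tangent_space_0[OF A'']])
    then show ?thesis
      unfolding isometry_preserves_connection[OF XY(1,2) p(1)] XY(4) tscale_simps .
  qed
  moreover have "\<Phi> \<xi> = differential A (tangent_atlas A) (\<lambda>q. (q, push Y q)) (f (fst u)) (push X (f (fst u)))"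
    using tangent_map_horizontal_section[OF A'' f f' f'f ff' XY(1,2) p(1)]
    unfolding XY(3) prod.collapse XY(5) .
  ultimately show ?thesis
    unfolding horizontal_space_def fst_tangent_map using push_smooth[OF XY(1)] push_smooth[OF XY(2)]
    by (intro CollectI exI[of _ "push X"] exI[of _ "push Y"] conjI)
qed

lemma tangent_map_horizontal_lift:
  assumes w: "w \<in> tangent_space A (fst u)"
  shows "\<Phi> (horizontal_lift A nabla u w) =
    horizontal_lift A nabla (tangent_map A f u) (differential A A f (fst u) w)"
  using horizontal_lift_eqI[OF M nabla u' tangent_map_horizontal_space[OF horizontal_lift(1)[OF M nabla u w]]]
    proj_tangent_map[OF A'' f f' f'f ff' u horizontal_lift(3)[OF M nabla u w]] horizontal_lift(2)[OF M nabla u w]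
  by simp

text \<open>\<open>\<Phi>\<close> is additive and carries the splitting of \<open>\<xi>\<close> to a
  sum of a horizontal and a vertical lift, and such a splitting determines \<open>ver_part\<close>.
  Metric and complex structure are expressed through the two parts, so their invariance follows by
  rewriting.\<close>

lemma tangent_map_parts:
  assumes \<xi>: "\<xi> \<in> tangent_space (tangent_atlas A) u"
  shows "hor_part A (tangent_map A f u) (\<Phi> \<xi>) = differential A A f (fst u) (hor_part A u \<xi>)"
    and "ver_part A nabla (tangent_map A f u) (\<Phi> \<xi>) = differential A A f (fst u) (ver_part A nabla u \<xi>)"
proof -
  note T = atlas_tangent_atlas[OF A'']
  note h = hor_part_tangent[OF M nabla u \<xi>] and v = ver_part(1)[OF M nabla u \<xi>]
  show hor: "hor_part A (tangent_map A f u) (\<Phi> \<xi>) = differential A A f (fst u) (hor_part A u \<xi>)"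
    unfolding hor_part_def by (rule proj_tangent_map[OF A'' f f' f'f ff' u \<xi>])
  have "\<Phi> \<xi> = \<Phi> (horizontal_lift A nabla u (hor_part A u \<xi>) + vertical_lift A u (ver_part A nabla u \<xi>))"
    unfolding ver_part(2)[OF M nabla u \<xi>] ..
  also have "\<dots> = horizontal_lift A nabla (tangent_map A f u) (hor_part A (tangent_map A f u) (\<Phi> \<xi>)) +
      vertical_lift A (tangent_map A f u) (differential A A f (fst u) (ver_part A nabla u \<xi>))"
    unfolding hor differential_add[OF T T smooth_tangent_map[OF A'' f] u horizontal_lift(3)[OF M nabla u h]
        vertical_lift_tangent[OF A'' u v]]
      tangent_map_horizontal_lift[OF h] tangent_map_vertical_lift[OF A'' f u v] ..
  finally show "ver_part A nabla (tangent_map A f u) (\<Phi> \<xi>) = differential A A f (fst u) (ver_part A nabla u \<xi>)"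
    by (intro ver_part_eqI[OF M nabla u'])
      (use differential_tangent[OF A'' A'' f v p(1)] in \<open>simp_all add: fst_tangent_map\<close>)
qed

section \<open>Invariance of the weights, the metric and the complex structure\<close>

lemma radial_weight_tangent_map:
  assumes "radial_weight A g mu"
  shows "mu (tangent_map A f u) = mu u"
proof -
  have "tnorm g (tangent_map A f u) = tnorm g u"
    using iso[OF p(1) p(2) p(2)] by (simp add: tnorm_def tangent_map_def)
  then show ?thesis using assms u u' unfolding radial_weight_def by blast
qed

lemma weighted_metric_tangent_map:
  assumes "radial_weight A g mu" "radial_weight A g lam"
    and \<xi>: "\<xi> \<in> tangent_space (tangent_atlas A) u" and \<eta>: "\<eta> \<in> tangent_space (tangent_atlas A) u"
  shows "weighted_metric A g nabla mu lam (tangent_map A f u) (\<Phi> \<xi>) (\<Phi> \<eta>) = weighted_metric A g nabla mu lam u \<xi> \<eta>"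
  unfolding weighted_metric_def tangent_map_parts[OF \<xi>] tangent_map_parts[OF \<eta>] fst_tangent_map
    radial_weight_tangent_map[OF assms(1)] radial_weight_tangent_map[OF assms(2)]
    iso[OF p(1) hor_part_tangent[OF M nabla u \<xi>] hor_part_tangent[OF M nabla u \<eta>]]
    iso[OF p(1) ver_part(1)[OF M nabla u \<xi>] ver_part(1)[OF M nabla u \<eta>]] ..

lemma weighted_complex_structure_tangent_map:
  assumes "radial_weight A g mu" "radial_weight A g lam"
    and \<xi>: "\<xi> \<in> tangent_space (tangent_atlas A) u"
  shows "weighted_complex_structure A nabla mu lam (tangent_map A f u) (\<Phi> \<xi>) =
    \<Phi> (weighted_complex_structure A nabla mu lam u \<xi>)"
proof -
  note T = atlas_tangent_atlas[OF A'']
  note h = hor_part_tangent[OF M nabla u \<xi>] and v = ver_part(1)[OF M nabla u \<xi>]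
  note hv = vertical_lift_tangent[OF A'' u h] and vh = horizontal_lift(3)[OF M nabla u v]
  show ?thesis
    unfolding weighted_complex_structure_def tangent_map_parts[OF \<xi>]
      radial_weight_tangent_map[OF assms(1)] radial_weight_tangent_map[OF assms(2)]
      differential_add[OF T T smooth_tangent_map[OF A'' f] u tangent_space_scale[OF T hv] tangent_space_scale[OF T vh]]
      differential_scale[OF T T smooth_tangent_map[OF A'' f] u hv]
      differential_scale[OF T T smooth_tangent_map[OF A'' f] u vh]
      tangent_map_horizontal_lift[OF v] tangent_map_vertical_lift[OF A'' f u h] ..
qed

end

end

theorem proposition2p1:
  fixes A :: "('a, 'e::euclidean_space) chart set"
    and g :: "'a \<Rightarrow> ('a, 'e) tvec \<Rightarrow> ('a, 'e) tvec \<Rightarrow> real"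
    and nabla :: "('a, 'e) vfield \<Rightarrow> ('a, 'e) vfield \<Rightarrow> ('a, 'e) vfield"
    and mu lam :: "('a, 'e) tpoint \<Rightarrow> real"
    and f :: "'a \<Rightarrow> 'a"
  assumes "smooth_manifold A"
    and "DIM('e) > 1"
    and "riemannian_metric A g"
    and "levi_civita_connection A g nabla"
    and "radial_weight A g mu"
    and "radial_weight A g lam"
    and "isometry A g f"
  shows "vector_bundle_isomorphism (tangent_atlas A) (pullback_tangent_atlas A f)
           (differential_bundle_map A f)
       \<and> tangent_map A f \<in> points (tangent_atlas A) \<rightarrow> points (tangent_atlas A)
       \<and> isometry (tangent_atlas A) (weighted_metric A g nabla mu lam) (tangent_map A f)
       \<and> (\<forall>u\<in>points (tangent_atlas A). \<forall>\<xi>\<in>tangent_space (tangent_atlas A) u.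
            weighted_complex_structure A nabla mu lam (tangent_map A f u)
              (differential (tangent_atlas A) (tangent_atlas A) (tangent_map A f) u \<xi>)
          = differential (tangent_atlas A) (tangent_atlas A) (tangent_map A f) u
              (weighted_complex_structure A nabla mu lam u \<xi>))"
proof -
  have A: "atlas A" by (rule smooth_manifold_atlas[OF assms(1)])
  note T = atlas_tangent_atlas[OF A]
  have diff: "diffeomorphism A A f" and iso: "\<And>p v w. p \<in> points A \<Longrightarrow> v \<in> tangent_space A p \<Longrightarrow>
      w \<in> tangent_space A p \<Longrightarrow> g (f p) (differential A A f p v) (differential A A f p w) = g p v w"
    using assms(7) by (simp_all add: isometry_def)
  have f: "smooth_map A A f" using diff by (simp add: diffeomorphism_def)
  obtain f' where f': "smooth_map A A f'" "\<And>p. p \<in> points A \<Longrightarrow> f' (f p) = p" "\<And>p. p \<in> points A \<Longrightarrow> f (f' p) = p"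
    using diffeomorphism_inverse[OF A A diff] by blast
  show ?thesis
  proof (intro conjI ballI)
    show "vector_bundle_isomorphism (tangent_atlas A) (pullback_tangent_atlas A f) (differential_bundle_map A f)"
      by (rule vector_bundle_isomorphism_differential[OF A diff])
    show "tangent_map A f \<in> points (tangent_atlas A) \<rightarrow> points (tangent_atlas A)"
      using smooth_map_points[OF T T smooth_tangent_map[OF A f]] by blast
    show "isometry (tangent_atlas A) (weighted_metric A g nabla mu lam) (tangent_map A f)"
      unfolding isometry_def
    proof (intro conjI ballI)
      show "diffeomorphism (tangent_atlas A) (tangent_atlas A) (tangent_map A f)"
        by (rule diffeomorphism_tangent_map[OF A diff])
    qed (rule weighted_metric_tangent_map[OF assms(1,3,4) f f'(1) _ _ _ _ assms(5,6)]; use f'(2,3) iso in blast)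
  qed (rule weighted_complex_structure_tangent_map[OF assms(1,3,4) f f'(1) _ _ _ _ assms(5,6)]; use f'(2,3) iso in blast)+
qed

end
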